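(* Let $n\geq 2$ and $a_1\in\mathbb{F}_q^\times$. For every $t\in T_n$, $$f_{T_n}\big(e_{\psi_n}\,g_{1,n-1}(a_1,1)\,e_{\psi_n}\big)(t)=\begin{cases}\dfrac{1}{q^{n-1}}\,\psi(-\mathrm{Tr}(t)), & \det(t)=(-1)^{n-1}a_1,\\[2mm] 0, & \text{otherwise.}\end{cases}$$ Explicitly, the elements $t\in T_n$ with $\det(t)=(-1)^{n-1}a_1$ can be parameterized by $y_{1,1},y_{2,1},\dots,y_{n-1,1}\in\mathbb{F}_q^\times$ as $$t=\mathrm{diag}\Big\{\frac{y_{1,1}}{1},-\frac{y_{2,1}}{y_{1,1}},-\frac{y_{3,1}}{y_{2,1}},\dots,-\frac{y_{n-1,1}}{y_{n-2,1}},-\frac{a_1}{y_{n-1,1}}\Big\},$$ and then $$\psi(-\mathrm{Tr}(t))=\psi\Big(-\frac{y_{1,1}}{1}+\sum_{j=2}^{n-1}\frac{y_{j,1}}{y_{j-1,1}}+\frac{a_1}{y_{n-1,1}}\Big).$$ The argument of $\psi$ is the sum over the arrows of the Gelfand-Tsetlin diagram with vertical arrows $a_1\to y_{n-1,1}\to y_{n-2,1}\to\cdots\to y_{2,1}\to y_{1,1}$ and one horizontal arrow $y_{1,1}\to 1$, where a vertical arrow $x\to y$ contributes $+x/y$ and a horizontal arrow $x\to y$ contributes $-x/y$.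
   Context: Let $\mathbb{F}_q$ be a finite field, $q$ a power of an odd prime, $\psi:\mathbb{F}_q\to\mathbb{C}^\times$ a nontrivial additive character, $G_n=GL(n,\mathbb{F}_q)$, $U_n$ the subgroup of upper-triangular unipotent matrices, $B_n^-$ the subgroup of lower-triangular invertible matrices, and $T_n$ the subgroup of diagonal matrices. Extend $\psi$ to a character of $U_n$ by $\psi(u)=\psi(\sum_{i=1}^{n-1}u_{i,i+1})$. For $n_1+\cdots+n_s=n$ ($n_i>0$) and $c_1,\dots,c_s\in\mathbb{F}_q^\times$, $g_{n_1,\dots,n_s}(c_1,\dots,c_s)\in G_n$ is the block anti-diagonal matrix whose anti-diagonal blocks, from top right to bottom left, are $c_1I_{n_1},c_2I_{n_2},\dots,c_sI_{n_s}$. An irreducible representation $\pi$ of $G_n$ is generic if it is isomorphic to a subrepresentation of $\mathrm{Ind}_{U_n}^{G_n}\psi=\{f:G_n\to\mathbb{C}\mid f(ug)=\psi(u)f(g)\ \forall u\in U_n, g\in G_n\}$ (with $G_n$ acting by right translation); this representation is multiplicity-free, and $\mathcal{W}(\pi,\psi)$ denotes the unique subspace isomorphic to $\pi$. The Bessel function $J_\pi$ is the unique element of $\mathcal{W}(\pi,\psi)$ with $J_\pi(I_n)=1$ and $J_\pi(u_1gu_2)=\psi(u_1u_2)J_\pi(g)$ for all $u_1,u_2\in U_n$, $g\in G_n$. For a character $\underline{\chi}_n=(\chi_1,\dots,\chi_n)$ of $T_n$ (each $\chi_i$ a character of $\mathbb{F}_q^\times$, $\underline{\chi}_n(\mathrm{diag}(a_1,\dots,a_n))=\prod_i\chi_i(a_i)$),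 extend it to $B_n^-$ via the diagonal entries and let $\mathcal{V}_{\underline{\chi}_n}=\mathrm{Ind}_{B_n^-}^{G_n}\underline{\chi}_n=\{f:G_n\to\mathbb{C}\mid f(bg)=\underline{\chi}_n(b)f(g)\ \forall b\in B_n^-, g\in G_n\}$ with the right translation action. It has exactly one irreducible constituent in common with $\mathrm{Ind}_{U_n}^{G_n}\psi$, denoted $\pi^S_{\underline{\chi}_n}$. Let $e_{\psi_n}=\frac{1}{|U_n|}\sum_{u\in U_n}\overline{\psi(u)}\,u\in\mathbb{C}[G_n]$. The elements $e_{\psi_n}g_{n_1,\dots,n_s}(c_1,\dots,c_s)e_{\psi_n}$ form a basis of $e_{\psi_n}\mathbb{C}[G_n]e_{\psi_n}$. For each character $\underline{\chi}_n$ of $T_n$, let $f_{T_n,\underline{\chi}_n}:e_{\psi_n}\mathbb{C}[G_n]e_{\psi_n}\to\mathbb{C}$ be the algebra homomorphism with $f_{T_n,\underline{\chi}_n}(e_{\psi_n}ge_{\psi_n})=J_{\pi^S_{\underline{\chi}_n}}(g)$ for $g=g_{n_1,\dots,n_s}(c_1,\dots,c_s)$. The Curtis homomorphism $f_{T_n}:e_{\psi_n}\mathbb{C}[G_n]e_{\psi_n}\to\mathbb{C}[T_n]$, $c\mapsto\sum_{t\in T_n}f_{T_n}(c)(t)\,t$, is the unique algebra homomorphism (independent of $\underline{\chi}_n$; its existence is a theorem of Curtis) such that $\widehat{\underline{\chi}_n}\circ f_{T_n}=f_{T_n,\underline{\chi}_n}$ for every character $\underline{\chi}_n$ of $T_n$,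 where $\widehat{\underline{\chi}_n}:\mathbb{C}[T_n]\to\mathbb{C}$ is the linear extension of $\underline{\chi}_n$. *)

theory Defs
  imports
    Complex_Main
    "HOL-Library.Cardinality"
    "HOL-Library.Function_Algebras"
    "Jordan_Normal_Form.Determinant"
    "HOL-Algebra.Module"
begin

section \<open>Complex representations of a group\<close>

text \<open>Representation spaces are complex subspaces of spaces of functions \<open>'x \<Rightarrow> complex\<close>
  (with the pointwise operations). Functions on the carrier of a group are represented by
  functions on the whole type that vanish off the carrier.\<close>

definition cscale :: "complex \<Rightarrow> ('x \<Rightarrow> complex) \<Rightarrow> 'x \<Rightarrow> complex" where
  "cscale c f = (\<lambda>x. c * f x)"

definition csubspace :: "('x \<Rightarrow> complex) set \<Rightarrow> bool" where
  "csubspace V \<longleftrightarrow> Modules.module.subspace cscale V"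

definition clinear_on ::
  "('x \<Rightarrow> complex) set \<Rightarrow> (('x \<Rightarrow> complex) \<Rightarrow> 'y \<Rightarrow> complex) \<Rightarrow> bool" where
  "clinear_on V L \<longleftrightarrow>
     (\<forall>v\<in>V. \<forall>w\<in>V. L (v + w) = L v + L w) \<and> (\<forall>c. \<forall>v\<in>V. L (cscale c v) = cscale c (L v))"

definition representation ::
  "('g, 'm) monoid_scheme \<Rightarrow> ('x \<Rightarrow> complex) set \<Rightarrow>
   ('g \<Rightarrow> ('x \<Rightarrow> complex) \<Rightarrow> 'x \<Rightarrow> complex) \<Rightarrow> bool" where
  "representation G V \<rho> \<longleftrightarrow>
     csubspace V \<and>
     (\<forall>g\<in>carrier G. \<rho> g \<in> V \<rightarrow> V \<and> clinear_on V (\<rho> g)) \<and>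
     (\<forall>v\<in>V. \<rho> \<one>\<^bsub>G\<^esub> v = v) \<and>
     (\<forall>g\<in>carrier G. \<forall>h\<in>carrier G. \<forall>v\<in>V. \<rho> (g \<otimes>\<^bsub>G\<^esub> h) v = \<rho> g (\<rho> h v))"

definition subrepresentation ::
  "('g, 'm) monoid_scheme \<Rightarrow> ('g \<Rightarrow> ('x \<Rightarrow> complex) \<Rightarrow> 'x \<Rightarrow> complex) \<Rightarrow>
   ('x \<Rightarrow> complex) set \<Rightarrow> ('x \<Rightarrow> complex) set \<Rightarrow> bool" where
  "subrepresentation G \<rho> W V \<longleftrightarrow>
     csubspace W \<and> W \<subseteq> V \<and> (\<forall>g\<in>carrier G. \<rho> g \<in> W \<rightarrow> W)"

definition irreducible_rep ::
  "('g, 'm) monoid_scheme \<Rightarrow> ('x \<Rightarrow> complex) set \<Rightarrow>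
   ('g \<Rightarrow> ('x \<Rightarrow> complex) \<Rightarrow> 'x \<Rightarrow> complex) \<Rightarrow> bool" where
  "irreducible_rep G V \<rho> \<longleftrightarrow>
     representation G V \<rho> \<and> V \<noteq> {0} \<and>
     (\<forall>W. subrepresentation G \<rho> W V \<longrightarrow> W = {0} \<or> W = V)"

definition rep_iso ::
  "('g, 'm) monoid_scheme \<Rightarrow>
   ('x \<Rightarrow> complex) set \<Rightarrow> ('g \<Rightarrow> ('x \<Rightarrow> complex) \<Rightarrow> 'x \<Rightarrow> complex) \<Rightarrow>
   ('y \<Rightarrow> complex) set \<Rightarrow> ('g \<Rightarrow> ('y \<Rightarrow> complex) \<Rightarrow> 'y \<Rightarrow> complex) \<Rightarrow> bool" where
  "rep_iso G V \<rho> W \<sigma> \<longleftrightarrow>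
     (\<exists>L. bij_betw L V W \<and> clinear_on V L \<and>
          (\<forall>g\<in>carrier G. \<forall>v\<in>V. L (\<rho> g v) = \<sigma> g (L v)))"

definition right_translation ::
  "('g, 'm) monoid_scheme \<Rightarrow> 'g \<Rightarrow> ('g \<Rightarrow> complex) \<Rightarrow> 'g \<Rightarrow> complex" where
  "right_translation G g f = (\<lambda>x. if x \<in> carrier G then f (x \<otimes>\<^bsub>G\<^esub> g) else 0)"

text \<open>The space of the representation induced from the character \<open>\<theta>\<close> of the subgroup \<open>H\<close>;
  \<open>G\<close> acts on it by right translation.\<close>

definition induced ::
  "('g, 'm) monoid_scheme \<Rightarrow> 'g set \<Rightarrow> ('g \<Rightarrow> complex) \<Rightarrow> ('g \<Rightarrow> complex) set" where
  "induced G H \<theta> =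
     {f. (\<forall>x. x \<notin> carrier G \<longrightarrow> f x = 0) \<and>
         (\<forall>h\<in>H. \<forall>g\<in>carrier G. f (h \<otimes>\<^bsub>G\<^esub> g) = \<theta> h * f g)}"


section \<open>Group algebras\<close>

text \<open>\<open>\<Sum>\<^sub>g c(g) g\<close> in the group algebra of a finite group is encoded by its coefficient
  function \<open>c\<close>, extended by 0 off the carrier.\<close>

definition group_algebra ::
  "('g, 'm) monoid_scheme \<Rightarrow> (complex, 'g \<Rightarrow> complex) module" where
  "group_algebra G =
     \<lparr>carrier = {c. \<forall>x. x \<notin> carrier G \<longrightarrow> c x = 0},
      mult = (\<lambda>c d x. if x \<in> carrier G
                then \<Sum>y\<in>carrier G. c y * d (inv\<^bsub>G\<^esub> y \<otimes>\<^bsub>G\<^esub> x) else 0),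
      one = (\<lambda>x. if x = \<one>\<^bsub>G\<^esub> then 1 else 0),
      zero = (\<lambda>x. 0),
      add = (\<lambda>c d x. c x + d x),
      module.smult = cscale\<rparr>"

definition group_elt :: "'g \<Rightarrow> 'g \<Rightarrow> complex" where
  "group_elt g = (\<lambda>x. if x = g then 1 else 0)"

text \<open>The algebra \<open>eAe\<close>, with unit \<open>e\<close>, for an idempotent \<open>e\<close>.\<close>

definition corner_algebra :: "(complex, 'v) module \<Rightarrow> 'v \<Rightarrow> (complex, 'v) module" where
  "corner_algebra A e =
     A\<lparr>carrier := {e \<otimes>\<^bsub>A\<^esub> c \<otimes>\<^bsub>A\<^esub> e | c. c \<in> carrier A}, one := e\<rparr>"

definition complex_algebra :: "(complex, complex) module" where
  "complex_algebra =
     \<lparr>carrier = UNIV, mult = (*), one = 1, zero = 0, add = (+), module.smult = (*)\<rparr>"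

definition alg_hom ::
  "(complex, 'v) module \<Rightarrow> (complex, 'w) module \<Rightarrow> ('v \<Rightarrow> 'w) set" where
  "alg_hom A B =
     {f \<in> ring_hom A B. \<forall>c. \<forall>x\<in>carrier A. f (c \<odot>\<^bsub>A\<^esub> x) = c \<odot>\<^bsub>B\<^esub> f x}"


section \<open>The general linear group over a finite field\<close>

text \<open>Matrix indices start at 0, so entry \<open>(i, j)\<close> of the literature is \<open>(i - 1, j - 1)\<close> here.\<close>

definition GL :: "nat \<Rightarrow> 'a::field mat monoid" where
  "GL n = units_of (ring_mat TYPE('a) n ())"

definition unipotent :: "nat \<Rightarrow> 'a::field mat set" where
  "unipotent n = {u \<in> carrier (GL n). upper_triangular u \<and> (\<forall>i<n. u $$ (i, i) = 1)}"

definition lower_borel :: "nat \<Rightarrow> 'a::field mat set" where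
  "lower_borel n = {b \<in> carrier (GL n). upper_triangular (transpose_mat b)}"

definition diag_torus :: "nat \<Rightarrow> 'a::field mat set" where
  "diag_torus n = {t \<in> carrier (GL n). diagonal_mat t}"

definition torus_group :: "nat \<Rightarrow> 'a::field mat monoid" where
  "torus_group n = (GL n)\<lparr>carrier := diag_torus n\<rparr>"

definition mat_trace :: "'a::comm_monoid_add mat \<Rightarrow> 'a" where
  "mat_trace A = (\<Sum>i<dim_row A. A $$ (i, i))"

text \<open>\<open>antidiag_block [(n\<^sub>1, c\<^sub>1), \<dots>, (n\<^sub>s, c\<^sub>s)]\<close> has the anti-diagonal blocks
  \<open>c\<^sub>1 I, \<dots>, c\<^sub>s I\<close> of sizes \<open>n\<^sub>1, \<dots>, n\<^sub>s\<close>, from top right to bottom left.\<close>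

fun antidiag_block :: "(nat \<times> 'a::field) list \<Rightarrow> 'a mat" where
  "antidiag_block [] = 0\<^sub>m 0 0"
| "antidiag_block ((k, c) # xs) =
     (let m = sum_list (map fst xs)
      in four_block_mat (0\<^sub>m k m) (c \<cdot>\<^sub>m 1\<^sub>m k) (antidiag_block xs) (0\<^sub>m m k))"

definition block_data :: "nat \<Rightarrow> (nat \<times> 'a::field) list set" where
  "block_data n =
     {xs. (\<forall>(k, c)\<in>set xs. k > 0 \<and> c \<noteq> 0) \<and> sum_list (map fst xs) = n}"


section \<open>Characters\<close>

definition additive_character :: "('a::field \<Rightarrow> complex) \<Rightarrow> bool" where
  "additive_character \<psi> \<longleftrightarrow> (\<forall>x. \<psi> x \<noteq> 0) \<and> (\<forall>x y. \<psi> (x + y) = \<psi> x * \<psi> y)"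

text \<open>The value of a multiplicative character at 0 is irrelevant.\<close>

definition multiplicative_character :: "('a::field \<Rightarrow> complex) \<Rightarrow> bool" where
  "multiplicative_character \<chi> \<longleftrightarrow>
     (\<forall>x. x \<noteq> 0 \<longrightarrow> \<chi> x \<noteq> 0) \<and>
     (\<forall>x y. x \<noteq> 0 \<longrightarrow> y \<noteq> 0 \<longrightarrow> \<chi> (x * y) = \<chi> x * \<chi> y)"

definition unipotent_char :: "('a::field \<Rightarrow> complex) \<Rightarrow> nat \<Rightarrow> 'a mat \<Rightarrow> complex" where
  "unipotent_char \<psi> n u = \<psi> (\<Sum>i<n - 1. u $$ (i, Suc i))"

text \<open>Used both for the character of the torus given by \<open>(\<chi>\<^sub>0, \<dots>, \<chi>\<^sub>n\<^sub>-\<^sub>1)\<close> and for its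
  extension to the lower Borel subgroup.\<close>

definition diag_char :: "(nat \<Rightarrow> 'a::field \<Rightarrow> complex) \<Rightarrow> nat \<Rightarrow> 'a mat \<Rightarrow> complex" where
  "diag_char \<chi> n b = (\<Prod>i<n. \<chi> i (b $$ (i, i)))"


section \<open>Generic representations and Bessel functions\<close>

definition gelfand_graev ::
  "('a::field \<Rightarrow> complex) \<Rightarrow> nat \<Rightarrow> ('a mat \<Rightarrow> complex) set" where
  "gelfand_graev \<psi> n = induced (GL n) (unipotent n) (unipotent_char \<psi> n)"

definition principal_series ::
  "(nat \<Rightarrow> 'a::field \<Rightarrow> complex) \<Rightarrow> nat \<Rightarrow> ('a mat \<Rightarrow> complex) set" where
  "principal_series \<chi> n = induced (GL n) (lower_borel n) (diag_char \<chi> n)"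

definition generic ::
  "('a::field \<Rightarrow> complex) \<Rightarrow> nat \<Rightarrow> ('x \<Rightarrow> complex) set \<Rightarrow>
   ('a mat \<Rightarrow> ('x \<Rightarrow> complex) \<Rightarrow> 'x \<Rightarrow> complex) \<Rightarrow> bool" where
  "generic \<psi> n V \<rho> \<longleftrightarrow>
     irreducible_rep (GL n) V \<rho> \<and>
     (\<exists>W. subrepresentation (GL n) (right_translation (GL n)) W (gelfand_graev \<psi> n) \<and>
          rep_iso (GL n) V \<rho> W (right_translation (GL n)))"

definition whittaker_model ::
  "('a::field \<Rightarrow> complex) \<Rightarrow> nat \<Rightarrow> ('x \<Rightarrow> complex) set \<Rightarrow>
   ('a mat \<Rightarrow> ('x \<Rightarrow> complex) \<Rightarrow> 'x \<Rightarrow> complex) \<Rightarrow> ('a mat \<Rightarrow> complex) set" where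
  "whittaker_model \<psi> n V \<rho> =
     (THE W. subrepresentation (GL n) (right_translation (GL n)) W (gelfand_graev \<psi> n) \<and>
             rep_iso (GL n) V \<rho> W (right_translation (GL n)))"

definition bessel_function ::
  "('a::field \<Rightarrow> complex) \<Rightarrow> nat \<Rightarrow> ('x \<Rightarrow> complex) set \<Rightarrow>
   ('a mat \<Rightarrow> ('x \<Rightarrow> complex) \<Rightarrow> 'x \<Rightarrow> complex) \<Rightarrow> 'a mat \<Rightarrow> complex" where
  "bessel_function \<psi> n V \<rho> =
     (THE J. J \<in> whittaker_model \<psi> n V \<rho> \<and> J (1\<^sub>m n) = 1 \<and>
             (\<forall>u\<^sub>1\<in>unipotent n. \<forall>u\<^sub>2\<in>unipotent n. \<forall>g\<in>carrier (GL n).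
                J (u\<^sub>1 * g * u\<^sub>2) = unipotent_char \<psi> n (u\<^sub>1 * u\<^sub>2) * J g))"

text \<open>The irreducible constituent that the principal series shares with the Gelfand-Graev
  representation. By complete reducibility, irreducible constituents are, up to isomorphism,
  the irreducible subrepresentations. The shared constituent occurs in the principal series
  with multiplicity one, so it is a unique subspace.\<close>

definition pi_S ::
  "('a::field \<Rightarrow> complex) \<Rightarrow> nat \<Rightarrow> (nat \<Rightarrow> 'a \<Rightarrow> complex) \<Rightarrow> ('a mat \<Rightarrow> complex) set" where
  "pi_S \<psi> n \<chi> =
     (THE P. subrepresentation (GL n) (right_translation (GL n)) P (principal_series \<chi> n) \<and>
             generic \<psi> n P (right_translation (GL n)))"


section \<open>The Curtis homomorphism\<close>

definition e_psi :: "('a::{finite,field} \<Rightarrow> complex) \<Rightarrow> nat \<Rightarrow> 'a mat \<Rightarrow> complex" where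
  "e_psi \<psi> n =
     (\<lambda>u. if u \<in> unipotent n
          then cnj (unipotent_char \<psi> n u) / of_nat (card (unipotent n :: 'a mat set)) else 0)"

definition hecke_algebra ::
  "('a::{finite,field} \<Rightarrow> complex) \<Rightarrow> nat \<Rightarrow> (complex, 'a mat \<Rightarrow> complex) module" where
  "hecke_algebra \<psi> n = corner_algebra (group_algebra (GL n)) (e_psi \<psi> n)"

text \<open>The element \<open>e g e\<close>.\<close>

definition hecke_elt ::
  "('a::{finite,field} \<Rightarrow> complex) \<Rightarrow> nat \<Rightarrow> 'a mat \<Rightarrow> 'a mat \<Rightarrow> complex" where
  "hecke_elt \<psi> n g =
     e_psi \<psi> n \<otimes>\<^bsub>group_algebra (GL n)\<^esub> group_elt g \<otimes>\<^bsub>group_algebra (GL n)\<^esub> e_psi \<psi> n"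

text \<open>The two homomorphisms below are unique as maps on the Hecke algebra. A HOL function is
  in addition arbitrary off the carrier, hence a Hilbert choice instead of a definite
  description.\<close>

definition f_T_chi ::
  "('a::{finite,field} \<Rightarrow> complex) \<Rightarrow> nat \<Rightarrow> (nat \<Rightarrow> 'a \<Rightarrow> complex) \<Rightarrow>
   ('a mat \<Rightarrow> complex) \<Rightarrow> complex" where
  "f_T_chi \<psi> n \<chi> =
     (SOME f. f \<in> alg_hom (hecke_algebra \<psi> n) complex_algebra \<and>
        (\<forall>xs\<in>block_data n.
           f (hecke_elt \<psi> n (antidiag_block xs)) =
           bessel_function \<psi> n (pi_S \<psi> n \<chi>) (right_translation (GL n)) (antidiag_block xs)))"

definition chi_hat ::
  "nat \<Rightarrow> (nat \<Rightarrow> 'a::{finite,field} \<Rightarrow> complex) \<Rightarrow> ('a mat \<Rightarrow> complex) \<Rightarrow> complex" where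
  "chi_hat n \<chi> c = (\<Sum>t\<in>diag_torus n. c t * diag_char \<chi> n t)"

definition curtis_hom ::
  "('a::{finite,field} \<Rightarrow> complex) \<Rightarrow> nat \<Rightarrow> ('a mat \<Rightarrow> complex) \<Rightarrow> 'a mat \<Rightarrow> complex" where
  "curtis_hom \<psi> n =
     (SOME F. F \<in> alg_hom (hecke_algebra \<psi> n) (group_algebra (torus_group n)) \<and>
        (\<forall>\<chi>. (\<forall>i<n. multiplicative_character (\<chi> i)) \<longrightarrow>
           (\<forall>c\<in>carrier (hecke_algebra \<psi> n). chi_hat n \<chi> (F c) = f_T_chi \<psi> n \<chi> c)))"


section \<open>The torus elements and the Gelfand-Tsetlin diagram\<close>

definition torus_param :: "nat \<Rightarrow> 'a::field \<Rightarrow> (nat \<Rightarrow> 'a) \<Rightarrow> 'a mat" where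
  "torus_param n a y =
     mat_diag n (\<lambda>i. if i = 0 then y 1 / 1
                     else if i = n - 1 then - (a / y (n - 1))
                     else - (y (i + 1) / y i))"

datatype 'a gt_arrow = Vertical 'a 'a | Horizontal 'a 'a

fun arrow_value :: "'a::field gt_arrow \<Rightarrow> 'a" where
  "arrow_value (Vertical x y) = x / y"
| "arrow_value (Horizontal x y) = - (x / y)"

text \<open>The vertical arrows join consecutive entries of \<open>a, y\<^sub>n\<^sub>-\<^sub>1, \<dots>, y\<^sub>1\<close>.\<close>

definition gt_diagram :: "nat \<Rightarrow> 'a::field \<Rightarrow> (nat \<Rightarrow> 'a) \<Rightarrow> 'a gt_arrow list" where
  "gt_diagram n a y =
     (let vs = a # map y (rev [1..<n])
      in map2 Vertical vs (tl vs) @ [Horizontal (y 1) 1])"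

end

(* A principal series contains, up to scalars, exactly one vector f0 on which the upper unipotent
   group acts through psi: it is supported on the open cell B^- U, where f0(bu) = chi(b) psi(u).
   Hence pi^S is the span of the translates of f0, its Bessel function is the psi-average
   g |-> |U|^(-1) sum_u conj(psi(u)) f0(ug), and a Hecke element c acts on f0 by the scalar
   sum_g c(g) f0(g), which gives the algebra homomorphism f_(T,chi). For g = g_(1,n-1)(a,1)
   the average collapses to unipotent matrices v with first row (1, x_1, ..., x_(n-1)) and
   trivial other rows. The product vg is a companion matrix with leading minors
   (-1)^(k-1) x_k, so its factorization in B^- U is explicit, and the sum over x becomes the
   character sum of chi against the claimed function on the torus. Orthogonality of characters
   of the torus turns this into the coefficients of the Curtis homomorphism, and also supplies
   the existence of the latter. *)

theory Submission
  imports Defs "HOL-Algebra.Multiplicative_Group"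
begin

section \<open>A multiplicity-one vector in an induced representation\<close>

text \<open>\<open>pi_S\<close>, \<open>whittaker_model\<close> and \<open>bessel_function\<close>
  are definite descriptions, so each of these objects has to be characterized up to equality, not
  just constructed. This is done for an abstract pair of subgroups \<open>B\<close>,
  \<open>U\<close>; the general linear group enters through the vanishing off \<open>BU\<close>.
  There elimination can only get stuck at a pivot to the right of the diagonal, and then some root
  subgroup acts on the value both through \<open>\<psi>\<close> and trivially, which is where
  nontriviality of \<open>\<psi>\<close> enters. Irreducibility comes from an inner product: the sum
  over the whole group is invariant under right translation, and up to a constant the Whittaker
  coefficients of a vector are its inner products with the translates of \<open>f0\<close>. A vector
  in the span of these translates whose coefficients all vanish is therefore 0. The constant
  q^(-(n-1)) is the inverse index in \<open>unipotent n\<close> of the subgroup that g conjugates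
  into \<open>unipotent n\<close> without changing the character; the averaged function is constant
  on its left cosets. The condition on the determinant appears because the last leading minor of vg
  is its determinant (-1)^(n-1) a.\<close>

lemma csubspace_iff:
  "csubspace V \<longleftrightarrow> 0 \<in> V \<and> (\<forall>v\<in>V. \<forall>w\<in>V. v + w \<in> V) \<and> (\<forall>c. \<forall>v\<in>V. cscale c v \<in> V)"
proof -
  have "Modules.module (cscale :: complex \<Rightarrow> ('b \<Rightarrow> complex) \<Rightarrow> _)"
    by unfold_locales (auto simp: cscale_def fun_eq_iff algebra_simps)
  then show ?thesis
    unfolding csubspace_def by (rule Modules.module.subspace_def)
qed

lemma sum_fun_apply: "(\<Sum>i\<in>A. f i) x = (\<Sum>i\<in>A. f i x :: 'b :: comm_monoid_add)"
  by (induction A rule: infinite_finite_induct) auto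

lemma csubspace_sum:
  assumes "csubspace V" "\<And>i. i \<in> A \<Longrightarrow> v i \<in> V"
  shows "(\<Sum>i\<in>A. cscale (c i) (v i)) \<in> V"
  using assms(2)
proof (induction A rule: infinite_finite_induct)
  case (insert x F)
  then have "cscale (c x) (v x) + (\<Sum>i\<in>F. cscale (c i) (v i)) \<in> V"
    using assms(1) unfolding csubspace_iff by blast
  then show ?case
    unfolding sum.insert[OF insert.hyps] .
qed (use assms(1) in \<open>auto simp: csubspace_iff\<close>)

lemma clinear_on_sum:
  assumes "csubspace V" "clinear_on V L" "\<And>i. i \<in> A \<Longrightarrow> v i \<in> V"
  shows "L (\<Sum>i\<in>A. cscale (c i) (v i)) = (\<Sum>i\<in>A. cscale (c i) (L (v i)))"
proof -
  have L0: "L 0 = 0"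
  proof -
    have "L (cscale 0 0) = cscale 0 (L 0)"
      using assms(1,2) unfolding csubspace_iff clinear_on_def by blast
    then show ?thesis
      by (simp add: cscale_def zero_fun_def)
  qed
  show ?thesis
    using assms(3)
  proof (induction A rule: infinite_finite_induct)
    case (insert x F)
    have "(\<Sum>i\<in>F. cscale (c i) (v i)) \<in> V" "cscale (c x) (v x) \<in> V"
      using insert.prems assms(1) by (auto intro!: csubspace_sum simp: csubspace_iff)
    then have "L (cscale (c x) (v x) + (\<Sum>i\<in>F. cscale (c i) (v i))) =
        cscale (c x) (L (v x)) + (\<Sum>i\<in>F. cscale (c i) (L (v i)))"
      using insert assms(2) unfolding clinear_on_def by simp
    then show ?case
      unfolding sum.insert[OF insert.hyps] .
  qed (auto simp: L0)
qed

lemma representation_subrepresentation: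
  assumes "group G" "subrepresentation G (right_translation G) W (induced G H \<theta>)"
  shows "representation G W (right_translation G)"
proof -
  interpret group G by fact
  show ?thesis
    unfolding representation_def
  proof (intro conjI ballI)
    show "csubspace W"
      using assms(2) by (simp add: subrepresentation_def)
    show "right_translation G g \<in> W \<rightarrow> W" if "g \<in> carrier G" for g
      using assms(2) that by (simp add: subrepresentation_def)
    show "clinear_on W (right_translation G g)" for g
      by (auto simp: clinear_on_def right_translation_def cscale_def fun_eq_iff)
    \<comment> \<open>\<open>right_translation\<close> cuts off outside the carrier, so the unit
      acts trivially because functions of the induced space vanish there.\<close>
    show "right_translation G \<one>\<^bsub>G\<^esub> v = v" if "v \<in> W" for v
      using assms(2) that
      by (auto simp: right_translation_def fun_eq_iff subrepresentation_def induced_def)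
    show "right_translation G (g \<otimes>\<^bsub>G\<^esub> h) v = right_translation G g (right_translation G h v)"
      if "g \<in> carrier G" "h \<in> carrier G" for g h v
      using that by (auto simp: right_translation_def fun_eq_iff m_assoc)
  qed
qed

lemma (in group) sum_mult_right:
  assumes "g \<in> carrier G"
  shows "(\<Sum>x\<in>carrier G. f (x \<otimes> g)) = (\<Sum>x\<in>carrier G. f x)"
  by (rule sum.reindex_bij_witness[of _ "\<lambda>x. x \<otimes> inv g" "\<lambda>x. x \<otimes> g"])
     (use assms in \<open>auto simp: m_assoc\<close>)

lemma (in group) sum_mult_left:
  assumes "g \<in> carrier G"
  shows "(\<Sum>x\<in>carrier G. f (g \<otimes> x)) = (\<Sum>x\<in>carrier G. f x)"
  by (rule sum.reindex_bij_witness[of _ "\<lambda>x. inv g \<otimes> x" "\<lambda>x. g \<otimes> x"])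
     (use assms in \<open>auto simp: m_assoc[symmetric]\<close>)

text \<open>The last assumption is Mackey's criterion in the form in which it is used: the induced
  representation contains at most one line on which \<open>U\<close> acts through \<open>\<psi>\<close>.\<close>

locale whittaker_data = group G + B: subgroup B G + U: subgroup U G
  for G :: "('g, 'm) monoid_scheme" (structure) and B U +
  fixes \<theta> \<psi> :: "'g \<Rightarrow> complex"
  assumes finite_carrier: "finite (carrier G)"
    and B_Int_U: "B \<inter> U \<subseteq> {\<one>}"
    and \<theta>_mult: "\<And>b c. b \<in> B \<Longrightarrow> c \<in> B \<Longrightarrow> \<theta> (b \<otimes> c) = \<theta> b * \<theta> c"
    and \<theta>_nz: "\<And>b. b \<in> B \<Longrightarrow> \<theta> b \<noteq> 0"
    and \<psi>_mult: "\<And>u v. u \<in> U \<Longrightarrow> v \<in> U \<Longrightarrow> \<psi> (u \<otimes> v) = \<psi> u * \<psi> v"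
    and \<psi>_norm: "\<And>u. u \<in> U \<Longrightarrow> norm (\<psi> u) = 1"
    and vanish: "\<And>v g. v \<in> induced G B \<theta> \<Longrightarrow>
      (\<And>g u. g \<in> carrier G \<Longrightarrow> u \<in> U \<Longrightarrow> v (g \<otimes> u) = \<psi> u * v g) \<Longrightarrow>
      g \<in> carrier G \<Longrightarrow> \<nexists>b u. b \<in> B \<and> u \<in> U \<and> g = b \<otimes> u \<Longrightarrow> v g = 0"
begin

abbreviation \<rho> where "\<rho> \<equiv> right_translation G"
abbreviation V where "V \<equiv> induced G B \<theta>"
abbreviation GG where "GG \<equiv> induced G U \<psi>"

text \<open>The description is legitimate because \<open>B\<close> and \<open>U\<close> meet
  trivially, so that a factorization in \<open>BU\<close> is unique
  (\<open>BU_unique\<close>).\<close>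

definition whittaker_vector :: "'g \<Rightarrow> complex" where
  "whittaker_vector g =
     (if \<exists>b u. b \<in> B \<and> u \<in> U \<and> g = b \<otimes> u
      then THE z. \<exists>b u. b \<in> B \<and> u \<in> U \<and> g = b \<otimes> u \<and> z = \<theta> b * \<psi> u else 0)"

abbreviation f0 where "f0 \<equiv> whittaker_vector"

text \<open>The projection onto vectors on which \<open>U\<close> acts through \<open>\<psi>\<close>
  by right translation, i.e. the operator of \<open>idem\<close> (\<open>act_idem\<close>). The
  conjugate is the inverse, since \<open>\<psi>\<close> has norm 1 on \<open>U\<close>.\<close>

definition average :: "('g \<Rightarrow> complex) \<Rightarrow> 'g \<Rightarrow> complex" where
  "average v = (\<lambda>x. if x \<in> carrier G then (\<Sum>u\<in>U. cnj (\<psi> u) * v (x \<otimes> u)) / of_nat (card U) else 0)"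

text \<open>Averaging on the left, which commutes with right translation: this is the intertwiner
  from the principal series to the Gelfand-Graev representation, and its value at \<open>f0\<close>
  will be the Bessel function.\<close>

definition wt :: "('g \<Rightarrow> complex) \<Rightarrow> 'g \<Rightarrow> complex" where
  "wt v = (\<lambda>g. if g \<in> carrier G then (\<Sum>u\<in>U. cnj (\<psi> u) * v (u \<otimes> g)) / of_nat (card U) else 0)"

text \<open>The subrepresentation generated by \<open>f0\<close>, given as the orbit of
  \<open>f0\<close> under the group algebra, so that each member comes with explicit
  coefficients.\<close>

definition whittaker_span :: "('g \<Rightarrow> complex) set" where
  "whittaker_span = range (\<lambda>c x. if x \<in> carrier G then \<Sum>g\<in>carrier G. c g * f0 (x \<otimes> g) else 0)"

lemma finite_U: "finite U"
  using U.subset finite_carrier finite_subset by blast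

lemma card_U: "of_nat (card U) \<noteq> (0::complex)"
proof -
  have "U \<noteq> {}"
    using U.one_closed by blast
  then show ?thesis
    using finite_U by simp
qed

lemma \<theta>_one: "\<theta> \<one> = 1"
  using \<theta>_mult[of \<one> \<one>] \<theta>_nz[of \<one>] by simp

lemma \<psi>_nz: "u \<in> U \<Longrightarrow> \<psi> u \<noteq> 0"
  using \<psi>_norm by fastforce

lemma \<psi>_one: "\<psi> \<one> = 1"
  using \<psi>_mult[of \<one> \<one>] \<psi>_nz[of \<one>] by simp

lemma cnj_\<psi>: "u \<in> U \<Longrightarrow> cnj (\<psi> u) * \<psi> u = 1"
  using \<psi>_norm[of u] complex_norm_square[of "\<psi> u"] by (simp add: mult.commute)

lemma \<psi>_inv: "u \<in> U \<Longrightarrow> \<psi> (inv u) = cnj (\<psi> u)"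
proof -
  assume u: "u \<in> U"
  then have "\<psi> (inv u) * \<psi> u = 1"
    using \<psi>_mult[of "inv u" u] \<psi>_one by simp
  with cnj_\<psi>[OF u] \<psi>_nz[OF u] show ?thesis
    by (metis mult_right_cancel)
qed

lemma sum_U_right: "a \<in> U \<Longrightarrow> (\<Sum>u\<in>U. f (u \<otimes> a)) = (\<Sum>u\<in>U. f u)"
  by (rule sum.reindex_bij_witness[of _ "\<lambda>x. x \<otimes> inv a" "\<lambda>x. x \<otimes> a"]) (auto simp: m_assoc)

lemma sum_U_left: "a \<in> U \<Longrightarrow> (\<Sum>u\<in>U. f (a \<otimes> u)) = (\<Sum>u\<in>U. f u)"
  by (rule sum.reindex_bij_witness[of _ "\<lambda>x. inv a \<otimes> x" "\<lambda>x. a \<otimes> x"])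
     (auto simp: m_assoc[symmetric])

text \<open>The element \<open>inv b' \<otimes> b = u' \<otimes> inv u\<close> lies in both
  subgroups.\<close>

lemma BU_unique:
  assumes "b \<in> B" "b' \<in> B" "u \<in> U" "u' \<in> U" "b \<otimes> u = b' \<otimes> u'"
  shows "b = b'" "u = u'"
proof -
  have "inv b' \<otimes> b = u' \<otimes> inv u"
    using assms by (metis B.mem_carrier U.mem_carrier inv_closed inv_solve_left inv_solve_right m_assoc m_closed)
  moreover have "inv b' \<otimes> b \<in> B" "u' \<otimes> inv u \<in> U"
    using assms by auto
  ultimately have "inv b' \<otimes> b = \<one>" "u' \<otimes> inv u = \<one>"
    using B_Int_U by auto
  with assms show "b = b'" "u = u'"
    by (metis B.mem_carrier inv_closed inv_equality inv_inv,
        metis U.mem_carrier inv_closed inv_equality inv_inv)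
qed

lemma f0_BU: "b \<in> B \<Longrightarrow> u \<in> U \<Longrightarrow> f0 (b \<otimes> u) = \<theta> b * \<psi> u"
  unfolding whittaker_vector_def
  by (auto intro!: the_equality dest: BU_unique)

lemma f0_off: "\<nexists>b u. b \<in> B \<and> u \<in> U \<and> g = b \<otimes> u \<Longrightarrow> f0 g = 0"
  unfolding whittaker_vector_def by (rule if_not_P)

lemma f0_one: "f0 \<one> = 1"
  using f0_BU[of \<one> \<one>] \<theta>_one \<psi>_one by simp

lemma f0_equiv:
  assumes "b \<in> B" "u \<in> U" "g \<in> carrier G"
  shows "f0 (b \<otimes> g \<otimes> u) = \<theta> b * \<psi> u * f0 g"
proof (cases "\<exists>c v. c \<in> B \<and> v \<in> U \<and> g = c \<otimes> v")
  case True
  then obtain c v where cv: "c \<in> B" "v \<in> U" "g = c \<otimes> v" by blast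
  then have "b \<otimes> g \<otimes> u = (b \<otimes> c) \<otimes> (v \<otimes> u)"
    using assms by (simp add: m_assoc)
  moreover have "f0 ((b \<otimes> c) \<otimes> (v \<otimes> u)) = \<theta> (b \<otimes> c) * \<psi> (v \<otimes> u)"
    using assms cv by (intro f0_BU) auto
  ultimately show ?thesis
    using cv assms by (simp add: \<theta>_mult \<psi>_mult f0_BU)
next
  case False
  have "\<nexists>c v. c \<in> B \<and> v \<in> U \<and> b \<otimes> g \<otimes> u = c \<otimes> v"
  proof
    assume "\<exists>c v. c \<in> B \<and> v \<in> U \<and> b \<otimes> g \<otimes> u = c \<otimes> v"
    then obtain c v where cv: "c \<in> B" "v \<in> U" "b \<otimes> g \<otimes> u = c \<otimes> v" by blast
    have "g = inv b \<otimes> (b \<otimes> g \<otimes> u) \<otimes> inv u"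
      using assms by (simp add: m_assoc) (simp add: m_assoc[symmetric])
    also have "\<dots> = (inv b \<otimes> c) \<otimes> (v \<otimes> inv u)"
      using assms cv by (simp add: m_assoc)
    finally have "g = (inv b \<otimes> c) \<otimes> (v \<otimes> inv u)" .
    moreover have "inv b \<otimes> c \<in> B" "v \<otimes> inv u \<in> U"
      using assms cv by auto
    ultimately show False
      using False by blast
  qed
  with False show ?thesis
    by (simp add: f0_off)
qed

lemma f0_right: "u \<in> U \<Longrightarrow> g \<in> carrier G \<Longrightarrow> f0 (g \<otimes> u) = \<psi> u * f0 g"
  using f0_equiv[of \<one> u g] \<theta>_one by simp

lemma f0_left: "b \<in> B \<Longrightarrow> g \<in> carrier G \<Longrightarrow> f0 (b \<otimes> g) = \<theta> b * f0 g"
  using f0_equiv[of b \<one> g] \<psi>_one by simp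

lemma f0_outside: "x \<notin> carrier G \<Longrightarrow> f0 x = 0"
  by (rule f0_off) auto

lemma f0_in_V: "f0 \<in> V"
  by (simp add: induced_def f0_left f0_outside)

lemma V_outside: "v \<in> V \<Longrightarrow> x \<notin> carrier G \<Longrightarrow> v x = 0"
  by (simp add: induced_def)

lemma V_left: "v \<in> V \<Longrightarrow> b \<in> B \<Longrightarrow> x \<in> carrier G \<Longrightarrow> v (b \<otimes> x) = \<theta> b * v x"
  by (simp add: induced_def)

text \<open>Multiplicity one: on \<open>BU\<close> the two equivariances determine every value from
  the one at the unit, and elsewhere \<open>vanish\<close> applies.\<close>

lemma equivariant_line:
  assumes v: "v \<in> V"
    and eq: "\<And>g u. g \<in> carrier G \<Longrightarrow> u \<in> U \<Longrightarrow> v (g \<otimes> u) = \<psi> u * v g"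
  shows "v = cscale (v \<one>) f0"
proof
  fix x
  show "v x = cscale (v \<one>) f0 x"
  proof (cases "\<exists>b u. b \<in> B \<and> u \<in> U \<and> x = b \<otimes> u")
    case True
    then obtain b u where bu: "b \<in> B" "u \<in> U" "x = b \<otimes> u" by blast
    have "v (b \<otimes> u) = \<theta> b * v (\<one> \<otimes> u)"
      using V_left[OF v bu(1)] bu by simp
    also have "\<dots> = \<theta> b * \<psi> u * v \<one>"
      using eq[of \<one> u] bu by simp
    finally show ?thesis
      using bu f0_BU by (simp add: cscale_def)
  next
    case False
    then show ?thesis
      using vanish[OF v eq, of x] f0_off[of x] V_outside[OF v, of x] by (auto simp: cscale_def)
  qed
qed

section \<open>Projection onto the Whittaker line\<close>

lemma average_eq_sum: 
  "average v = (\<Sum>u\<in>U. cscale (cnj (\<psi> u) / of_nat (card U)) (\<rho> u v))"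
  by (auto simp: average_def fun_eq_iff sum_fun_apply cscale_def right_translation_def sum_divide_distrib)

lemma subrep_average:
  "subrepresentation G \<rho> W X \<Longrightarrow> v \<in> W \<Longrightarrow> average v \<in> W"
  unfolding average_eq_sum subrepresentation_def by (intro csubspace_sum) auto

lemma subrepresentation_induced:
  "subgroup H G \<Longrightarrow> subrepresentation G \<rho> (induced G H \<eta>) (induced G H \<eta>)"
  unfolding subrepresentation_def csubspace_iff
  by (auto simp: induced_def cscale_def right_translation_def algebra_simps m_assoc
        subgroup.mem_carrier)

lemma subrep_V: "subrepresentation G \<rho> V V"
  by (rule subrepresentation_induced) (rule B.subgroup_axioms)

lemma average_right:
  assumes "a \<in> U" "g \<in> carrier G"
  shows "average v (g \<otimes> a) = \<psi> a * average v g"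
proof -
  have "(\<Sum>u\<in>U. cnj (\<psi> u) * v (g \<otimes> a \<otimes> u)) = (\<Sum>u\<in>U. \<psi> a * (cnj (\<psi> (a \<otimes> u)) * v (g \<otimes> (a \<otimes> u))))"
  proof (rule sum.cong)
    fix u assume u: "u \<in> U"
    \<comment> \<open>The factor \<open>cnj (\<psi> a) * \<psi> a = 1\<close> is split off to
      prepare the substitution of \<open>a \<otimes> u\<close> for \<open>u\<close>.\<close>
    have "\<psi> a * cnj (\<psi> (a \<otimes> u)) = (cnj (\<psi> a) * \<psi> a) * cnj (\<psi> u)"
      using assms u by (simp add: \<psi>_mult)
    then show "cnj (\<psi> u) * v (g \<otimes> a \<otimes> u) = \<psi> a * (cnj (\<psi> (a \<otimes> u)) * v (g \<otimes> (a \<otimes> u)))"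
      using assms u cnj_\<psi>[of a] by (simp add: m_assoc mult.assoc[symmetric])
  qed simp
  also have "\<dots> = \<psi> a * (\<Sum>u\<in>U. cnj (\<psi> u) * v (g \<otimes> u))"
    using sum_U_left[OF assms(1), of "\<lambda>u. cnj (\<psi> u) * v (g \<otimes> u)"]
    by (simp add: sum_distrib_left[symmetric])
  finally show ?thesis
    using assms by (simp add: average_def)
qed

text \<open>Stated at a single point, because elements of \<open>GG\<close> are right equivariant
  only at the unit in general (\<open>GG_average_one\<close>).\<close>

lemma average_equivariant:
  assumes "\<And>u. u \<in> U \<Longrightarrow> v (g \<otimes> u) = \<psi> u * v g" "g \<in> carrier G"
  shows "average v g = v g"
proof -
  have "(\<Sum>u\<in>U. cnj (\<psi> u) * v (g \<otimes> u)) = (\<Sum>u\<in>U. v g)"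
    using assms cnj_\<psi> by (intro sum.cong) (auto simp: mult.assoc[symmetric])
  then show ?thesis
    using assms card_U by (simp add: average_def)
qed

lemma average_V:
  assumes "v \<in> V"
  shows "average v = cscale (average v \<one>) f0"
  by (rule equivariant_line) (use subrep_average[OF subrep_V assms] average_right in auto)

lemma average_f0: "average f0 = f0"
proof
  fix x
  show "average f0 x = f0 x"
  proof (cases "x \<in> carrier G")
    case True
    then show ?thesis
      by (intro average_equivariant) (simp_all add: f0_right)
  next
    case False
    then show ?thesis
      by (simp add: average_def f0_outside)
  qed
qed

text \<open>At the unit left and right averages coincide; this turns statements about
  \<open>wt\<close> into statements about the projection \<open>average\<close>.\<close>

lemma wt_eq: "g \<in> carrier G \<Longrightarrow> wt v g = average (\<rho> g v) \<one>"
  by (simp add: wt_def average_def right_translation_def)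

lemma translate_in_V: "v \<in> V \<Longrightarrow> g \<in> carrier G \<Longrightarrow> \<rho> g v \<in> V"
  using subrep_V by (auto simp: subrepresentation_def)

text \<open>So \<open>wt v g\<close> is the coordinate on the line of \<open>f0\<close> of the
  projected translate, which is why it detects whether a subrepresentation contains
  \<open>f0\<close>.\<close>

lemma average_translate: "v \<in> V \<Longrightarrow> g \<in> carrier G \<Longrightarrow> average (\<rho> g v) = cscale (wt v g) f0"
  by (simp add: wt_eq average_V[OF translate_in_V, symmetric])

section \<open>The subrepresentation generated by the Whittaker vector\<close>

lemma whittaker_span_subrep: "subrepresentation G \<rho> whittaker_span V"
proof -
  let ?F = "\<lambda>c x. if x \<in> carrier G then \<Sum>g\<in>carrier G. c g * f0 (x \<otimes> g) else 0"
  have P: "?F c \<in> whittaker_span" for c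
    by (simp add: whittaker_span_def)
  have "0 \<in> whittaker_span"
    using P[of "\<lambda>_. 0"] by (simp add: zero_fun_def cong: if_cong)
  moreover have "v + w \<in> whittaker_span" if "v \<in> whittaker_span" "w \<in> whittaker_span" for v w
  proof -
    from that obtain c d where "v = ?F c" "w = ?F d" by (auto simp: whittaker_span_def)
    then have "v + w = ?F (\<lambda>g. c g + d g)"
      by (auto simp: fun_eq_iff sum.distrib algebra_simps)
    then show ?thesis using P by simp
  qed
  moreover have "cscale a v \<in> whittaker_span" if "v \<in> whittaker_span" for a v
  proof -
    from that obtain c where "v = ?F c" by (auto simp: whittaker_span_def)
    then have "cscale a v = ?F (\<lambda>g. a * c g)"
      by (auto simp: fun_eq_iff cscale_def sum_distrib_left algebra_simps)
    then show ?thesis using P by simp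
  qed
  moreover have "\<rho> h v \<in> whittaker_span" if "v \<in> whittaker_span" and h: "h \<in> carrier G" for h v
  proof -
    from that obtain c where c: "v = ?F c" by (auto simp: whittaker_span_def)
    have "\<rho> h v = ?F (\<lambda>g. c (inv h \<otimes> g))"
    proof
      fix x
      show "\<rho> h v x = ?F (\<lambda>g. c (inv h \<otimes> g)) x"
        using h sum_mult_left[OF h, of "\<lambda>g. c (inv h \<otimes> g) * f0 (x \<otimes> g)"]
        by (auto simp: right_translation_def c m_assoc simp flip: m_assoc[of "inv h" h] cong: sum.cong)
    qed
    then show ?thesis using P by simp
  qed
  moreover have "?F c \<in> V" for c
    using f0_left by (auto simp: induced_def sum_distrib_left m_assoc intro!: sum.cong)
  ultimately show ?thesis
    unfolding subrepresentation_def csubspace_iff by (auto simp: whittaker_span_def)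
qed

lemma f0_in_whittaker_span: "f0 \<in> whittaker_span"
proof -
  define F where "F = (\<lambda>c x. if x \<in> carrier G then \<Sum>g\<in>carrier G. c g * f0 (x \<otimes> g) else 0)"
  have "F (\<lambda>g. if g = \<one> then 1 else 0) = f0"
    unfolding F_def using finite_carrier
    by (auto simp: fun_eq_iff f0_outside if_distrib[of "\<lambda>y. y * _"] sum.delta cong: if_cong)
  moreover have "F (\<lambda>g. if g = \<one> then 1 else 0) \<in> whittaker_span"
    by (simp add: whittaker_span_def F_def)
  ultimately show ?thesis by simp
qed

lemma whittaker_span_minimal:
  assumes "subrepresentation G \<rho> W V" "f0 \<in> W"
  shows "whittaker_span \<subseteq> W"
proof
  fix v assume "v \<in> whittaker_span"
  then obtain c where "v = (\<lambda>x. if x \<in> carrier G then \<Sum>g\<in>carrier G. c g * f0 (x \<otimes> g) else 0)"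
    by (auto simp: whittaker_span_def)
  then have "v = (\<Sum>g\<in>carrier G. cscale (c g) (\<rho> g f0))"
    by (auto simp: fun_eq_iff sum_fun_apply cscale_def right_translation_def)
  also have "\<dots> \<in> W"
    using assms by (intro csubspace_sum) (auto simp: subrepresentation_def)
  finally show "v \<in> W" .
qed

lemma whittaker_span_V: "v \<in> whittaker_span \<Longrightarrow> v \<in> V"
  using whittaker_span_subrep by (auto simp: subrepresentation_def)

text \<open>The projection \<open>average\<close> is self-adjoint for the inner product summed over
  the group, and it fixes \<open>f0\<close>.\<close>

lemma inner_f0:
  assumes "v \<in> V"
  shows "(\<Sum>x\<in>carrier G. v x * cnj (f0 x)) = (\<Sum>x\<in>carrier G. average v x * cnj (f0 x))"
proof -
  have eq: "(\<Sum>x\<in>carrier G. cnj (\<psi> u) * v (x \<otimes> u) * cnj (f0 x)) = (\<Sum>x\<in>carrier G. v x * cnj (f0 x))"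
    if u: "u \<in> U" for u
  proof -
    have "(\<Sum>x\<in>carrier G. cnj (\<psi> u) * v (x \<otimes> u) * cnj (f0 x)) =
        (\<Sum>x\<in>carrier G. v (x \<otimes> u) * cnj (f0 (x \<otimes> u)))"
      using u by (intro sum.cong) (auto simp: f0_right)
    then show ?thesis
      using sum_mult_right[of u "\<lambda>x. v x * cnj (f0 x)"] u by simp
  qed
  have "(\<Sum>x\<in>carrier G. average v x * cnj (f0 x)) =
      (\<Sum>x\<in>carrier G. \<Sum>u\<in>U. cnj (\<psi> u) * v (x \<otimes> u) * cnj (f0 x)) / of_nat (card U)"
    by (simp add: average_def sum_divide_distrib sum_distrib_right)
  also have "\<dots> = (\<Sum>u\<in>U. \<Sum>x\<in>carrier G. cnj (\<psi> u) * v (x \<otimes> u) * cnj (f0 x)) / of_nat (card U)"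
    by (subst sum.swap) simp
  also have "\<dots> = (\<Sum>x\<in>carrier G. v x * cnj (f0 x))"
    using card_U by (simp add: eq)
  finally show ?thesis ..
qed

text \<open>If \<open>v\<close> has no Whittaker coefficient, then \<open>v\<close> is orthogonal to all translates of
  \<open>f0\<close>, hence to itself.\<close>

lemma wt_zero_imp_zero:
  assumes v: "v \<in> whittaker_span" and wt: "\<And>g. g \<in> carrier G \<Longrightarrow> wt v g = 0"
  shows "v = 0"
proof -
  have vV: "v \<in> V" using v by (rule whittaker_span_V)
  obtain c where c: "v = (\<lambda>x. if x \<in> carrier G then \<Sum>g\<in>carrier G. c g * f0 (x \<otimes> g) else 0)"
    using v by (auto simp: whittaker_span_def)
  have orth: "(\<Sum>x\<in>carrier G. v x * cnj (f0 (x \<otimes> g))) = 0" if g: "g \<in> carrier G" for g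
  proof -
    \<comment> \<open>Right invariance of the sum moves the translation from \<open>f0\<close> to
      \<open>v\<close>; there \<open>inner_f0\<close> replaces the translate by its projection,
      whose coordinate is a value of \<open>wt v\<close>.\<close>
    have "(\<Sum>x\<in>carrier G. v x * cnj (f0 (x \<otimes> g))) =
        (\<Sum>x\<in>carrier G. v (x \<otimes> g \<otimes> inv g) * cnj (f0 (x \<otimes> g)))"
      using g by (intro sum.cong) (auto simp: m_assoc)
    also have "\<dots> = (\<Sum>x\<in>carrier G. v (x \<otimes> inv g) * cnj (f0 x))"
      using sum_mult_right[OF g, of "\<lambda>x. v (x \<otimes> inv g) * cnj (f0 x)"] by simp
    also have "\<dots> = (\<Sum>x\<in>carrier G. \<rho> (inv g) v x * cnj (f0 x))"
      by (simp add: right_translation_def)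
    also have "\<dots> = (\<Sum>x\<in>carrier G. average (\<rho> (inv g) v) x * cnj (f0 x))"
      using g vV by (intro inner_f0 translate_in_V) auto
    also have "\<dots> = 0"
      using g vV wt by (simp add: average_translate cscale_def)
    finally show ?thesis .
  qed
  have "(\<Sum>x\<in>carrier G. v x * cnj (v x)) = (\<Sum>x\<in>carrier G. \<Sum>g\<in>carrier G. cnj (c g) * (v x * cnj (f0 (x \<otimes> g))))"
  proof (rule sum.cong)
    fix x assume x: "x \<in> carrier G"
    have "cnj (v x) = (\<Sum>g\<in>carrier G. cnj (c g) * cnj (f0 (x \<otimes> g)))"
      using x by (subst c) simp
    then show "v x * cnj (v x) = (\<Sum>g\<in>carrier G. cnj (c g) * (v x * cnj (f0 (x \<otimes> g))))"
      by (simp add: sum_distrib_left algebra_simps)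
  qed simp
  also have "\<dots> = (\<Sum>g\<in>carrier G. cnj (c g) * (\<Sum>x\<in>carrier G. v x * cnj (f0 (x \<otimes> g))))"
    by (subst sum.swap) (simp add: sum_distrib_left)
  also have "\<dots> = 0"
    by (simp add: orth)
  finally have "of_real (\<Sum>x\<in>carrier G. (norm (v x))\<^sup>2) = (0 :: complex)"
    by (simp add: complex_norm_square del: of_real_power)
  then have "(\<Sum>x\<in>carrier G. (norm (v x))\<^sup>2) = 0"
    by (simp only: of_real_eq_0_iff)
  then have "\<forall>x\<in>carrier G. v x = 0"
    using finite_carrier by (simp add: sum_nonneg_eq_0_iff)
  then show ?thesis
    using V_outside[OF vV] by (auto simp: fun_eq_iff)
qed

lemma csubspace_scale_nz:
  assumes "csubspace W" "cscale a f \<in> W" "a \<noteq> 0"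
  shows "f \<in> W"
proof -
  have "cscale (inverse a) (cscale a f) \<in> W"
    using assms(1,2) by (simp add: csubspace_iff)
  moreover have "cscale (inverse a) (cscale a f) = f"
    using assms(3) by (simp add: cscale_def fun_eq_iff)
  ultimately show ?thesis by simp
qed

text \<open>If some vector of \<open>W\<close> has a nonzero Whittaker coefficient, projecting a
  translate of it puts a nonzero multiple of \<open>f0\<close> into \<open>W\<close>, which
  generates everything. Otherwise \<open>wt_zero_imp_zero\<close> leaves only 0.\<close>

lemma whittaker_span_irreducible: "irreducible_rep G whittaker_span \<rho>"
  unfolding irreducible_rep_def
proof (intro conjI allI impI)
  show "representation G whittaker_span \<rho>"
    using whittaker_span_subrep group_axioms by (rule representation_subrepresentation[rotated])
  show "whittaker_span \<noteq> {0}"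
    using f0_in_whittaker_span f0_one by (metis singletonD zero_fun_apply zero_neq_one)
  fix W assume W: "subrepresentation G \<rho> W whittaker_span"
  then have WV: "subrepresentation G \<rho> W V"
    using whittaker_span_subrep by (auto simp: subrepresentation_def)
  show "W = {0} \<or> W = whittaker_span"
  proof (cases "\<exists>w\<in>W. \<exists>g\<in>carrier G. wt w g \<noteq> 0")
    case True
    then obtain w g where wg: "w \<in> W" "g \<in> carrier G" "wt w g \<noteq> 0" by blast
    then have "average (\<rho> g w) \<in> W"
      using W by (intro subrep_average[OF W]) (auto simp: subrepresentation_def)
    then have "cscale (wt w g) f0 \<in> W"
      using average_translate[of w g] wg WV by (auto simp: subrepresentation_def)
    then have "f0 \<in> W"
      using W wg by (auto simp: subrepresentation_def intro: csubspace_scale_nz)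
    then show ?thesis
      using whittaker_span_minimal[OF WV] W by (auto simp: subrepresentation_def)
  next
    case False
    then have "W \<subseteq> {0}"
      using W wt_zero_imp_zero by (auto simp: subrepresentation_def)
    then show ?thesis
      using W by (auto simp: subrepresentation_def csubspace_iff)
  qed
qed

section \<open>The Whittaker model of the generated subrepresentation\<close>

lemma wt_linear: "clinear_on X wt"
  by (auto simp: clinear_on_def wt_def cscale_def fun_eq_iff sum.distrib algebra_simps
        add_divide_distrib sum_distrib_left)

lemma wt_translate: "h \<in> carrier G \<Longrightarrow> wt (\<rho> h v) = \<rho> h (wt v)"
  by (auto simp: wt_def right_translation_def fun_eq_iff m_assoc intro!: sum.cong)

lemma wt_in_GG: "wt v \<in> GG"
proof -
  have "(\<Sum>u\<in>U. cnj (\<psi> u) * v (u \<otimes> (a \<otimes> g))) = \<psi> a * (\<Sum>u\<in>U. cnj (\<psi> u) * v (u \<otimes> g))"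
    if a: "a \<in> U" and g: "g \<in> carrier G" for a g
  proof -
    have "(\<Sum>u\<in>U. cnj (\<psi> u) * v (u \<otimes> (a \<otimes> g))) =
        (\<Sum>u\<in>U. \<psi> a * (cnj (\<psi> (u \<otimes> a)) * v (u \<otimes> a \<otimes> g)))"
    proof (rule sum.cong)
      fix u assume u: "u \<in> U"
      have "\<psi> a * cnj (\<psi> (u \<otimes> a)) = (cnj (\<psi> a) * \<psi> a) * cnj (\<psi> u)"
        using a u by (simp add: \<psi>_mult)
      then show "cnj (\<psi> u) * v (u \<otimes> (a \<otimes> g)) = \<psi> a * (cnj (\<psi> (u \<otimes> a)) * v (u \<otimes> a \<otimes> g))"
        using a g u cnj_\<psi>[of a] by (simp add: m_assoc mult.assoc[symmetric])
    qed simp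
    also have "\<dots> = \<psi> a * (\<Sum>u\<in>U. cnj (\<psi> u) * v (u \<otimes> g))"
      using sum_U_right[OF a, of "\<lambda>u. cnj (\<psi> u) * v (u \<otimes> g)"]
      by (simp add: sum_distrib_left[symmetric])
    finally show ?thesis .
  qed
  then show ?thesis
    by (auto simp: induced_def wt_def)
qed

lemma wt_subrep: "subrepresentation G \<rho> (wt ` whittaker_span) GG"
  unfolding subrepresentation_def csubspace_iff
proof (intro conjI)
  have P: "csubspace whittaker_span" using whittaker_span_subrep by (simp add: subrepresentation_def)
  note lin = wt_linear[of whittaker_span, unfolded clinear_on_def]
  show "0 \<in> wt ` whittaker_span"
    using P by (intro image_eqI[of _ _ 0]) (auto simp: wt_def fun_eq_iff csubspace_iff)
  show "\<forall>v\<in>wt ` whittaker_span. \<forall>w\<in>wt ` whittaker_span. v + w \<in> wt ` whittaker_span"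
  proof clarify
    fix v w assume "v \<in> whittaker_span" "w \<in> whittaker_span"
    then have "wt (v + w) = wt v + wt w" "v + w \<in> whittaker_span"
      using lin P by (auto simp: csubspace_iff)
    then show "wt v + wt w \<in> wt ` whittaker_span" by (metis image_eqI)
  qed
  show "\<forall>c. \<forall>v\<in>wt ` whittaker_span. cscale c v \<in> wt ` whittaker_span"
  proof clarify
    fix c v assume "v \<in> whittaker_span"
    then have "wt (cscale c v) = cscale c (wt v)" "cscale c v \<in> whittaker_span"
      using lin P by (auto simp: csubspace_iff)
    then show "cscale c (wt v) \<in> wt ` whittaker_span" by (metis image_eqI)
  qed
  show "wt ` whittaker_span \<subseteq> GG"
    using wt_in_GG by blast
  show "\<forall>g\<in>carrier G. \<rho> g \<in> wt ` whittaker_span \<rightarrow> wt ` whittaker_span"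
  proof clarify
    fix g v assume "g \<in> carrier G" "v \<in> whittaker_span"
    then have "wt (\<rho> g v) = \<rho> g (wt v)" "\<rho> g v \<in> whittaker_span"
      using wt_translate whittaker_span_subrep by (auto simp: subrepresentation_def)
    then show "\<rho> g (wt v) \<in> wt ` whittaker_span" by (metis image_eqI)
  qed
qed

text \<open>Injectivity is \<open>wt_zero_imp_zero\<close> for the difference of two vectors,
  written with \<open>cscale (-1)\<close> because \<open>csubspace\<close> and
  \<open>clinear_on\<close> speak of sums and multiples.\<close>

lemma wt_iso: "rep_iso G whittaker_span \<rho> (wt ` whittaker_span) \<rho>"
  unfolding rep_iso_def
proof (intro exI conjI ballI)
  have P: "csubspace whittaker_span" using whittaker_span_subrep by (simp add: subrepresentation_def)
  have "inj_on wt whittaker_span"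
  proof (rule inj_onI)
    fix v w assume vw: "v \<in> whittaker_span" "w \<in> whittaker_span" "wt v = wt w"
    then have m: "cscale (-1) w \<in> whittaker_span" using P by (simp add: csubspace_iff)
    then have d: "v + cscale (-1) w \<in> whittaker_span" using vw P by (simp add: csubspace_iff)
    have "wt (v + cscale (-1) w) = wt v + cscale (-1) (wt w)"
      using wt_linear[of whittaker_span] vw m by (simp add: clinear_on_def)
    then have "wt (v + cscale (-1) w) g = 0" for g
      using vw(3) by (simp add: cscale_def)
    then have "v + cscale (-1) w = 0"
      using d by (intro wt_zero_imp_zero) auto
    then show "v = w"
      by (simp add: fun_eq_iff cscale_def)
  qed
  then show "bij_betw wt whittaker_span (wt ` whittaker_span)"
    by (simp add: bij_betw_def)
qed (use wt_linear wt_translate in auto)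

section \<open>Uniqueness of the generic constituent, its model and its Bessel function\<close>

lemma linear_average:
  assumes "subrepresentation G \<rho> P X" "clinear_on P L"
    and "\<And>g v. g \<in> carrier G \<Longrightarrow> v \<in> P \<Longrightarrow> L (\<rho> g v) = \<rho> g (L v)" and "v \<in> P"
  shows "L (average v) = average (L v)"
  unfolding average_eq_sum using assms
  by (subst clinear_on_sum[where V = P]) (auto simp: subrepresentation_def intro!: sum.cong)

text \<open>Functions in \<open>GG\<close> are equivariant on the left, and at the unit left and
  right multiplication by \<open>u\<close> agree.\<close>

lemma GG_average_one: "w \<in> GG \<Longrightarrow> average w \<one> = w \<one>"
proof (rule average_equivariant)
  fix u assume "w \<in> GG" "u \<in> U"
  then have "w (u \<otimes> \<one>) = \<psi> u * w \<one>"
    unfolding induced_def by blast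
  with \<open>u \<in> U\<close> show "w (\<one> \<otimes> u) = \<psi> u * w \<one>" by simp
qed simp

text \<open>Frobenius reciprocity made concrete by evaluation at the unit. Translating makes
  \<open>L v'\<close> nonzero there; averaging preserves this value, so the average of
  \<open>v'\<close> is nonzero. It is a multiple of \<open>f0\<close>, hence \<open>f0\<close> lies
  in \<open>P\<close>.\<close>

lemma generic_imp_whittaker_span:
  assumes P: "subrepresentation G \<rho> P V" "irreducible_rep G P \<rho>"
    and W: "subrepresentation G \<rho> W GG" "rep_iso G P \<rho> W \<rho>"
  shows "P = whittaker_span"
proof -
  obtain L where L: "bij_betw L P W" "clinear_on P L"
    "\<And>g v. g \<in> carrier G \<Longrightarrow> v \<in> P \<Longrightarrow> L (\<rho> g v) = \<rho> g (L v)"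
    using W(2) unfolding rep_iso_def by blast
  have subP: "csubspace P" using P by (simp add: subrepresentation_def)
  have L0: "L 0 = 0"
    using clinear_on_sum[OF subP L(2), of "{}"] by simp
  obtain v where v: "v \<in> P" "v \<noteq> 0"
    using P(2) subP by (auto simp: irreducible_rep_def csubspace_iff)
  have "L v \<noteq> 0"
    using L(1) L0 v subP by (auto simp: bij_betw_def inj_on_def csubspace_iff)
  moreover have LW: "L w \<in> GG" if "w \<in> P" for w
    using L(1) W(1) that by (auto simp: bij_betw_def subrepresentation_def)
  moreover have "L v g = 0" if "g \<notin> carrier G" for g
    using LW[OF v(1)] that by (simp add: induced_def)
  ultimately obtain g where g: "g \<in> carrier G" "L v g \<noteq> 0"
    unfolding fun_eq_iff zero_fun_apply by blast
  define v' where "v' = \<rho> g v"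
  have v': "v' \<in> P"
    using P(1) g v by (auto simp: v'_def subrepresentation_def)
  have "L v' \<one> \<noteq> 0"
    using g v L(3)[of g v] by (simp add: v'_def right_translation_def)
  moreover have "L (average v') \<one> = L v' \<one>"
    using linear_average[OF P(1) L(2,3) v'] GG_average_one[OF LW[OF v']] by simp
  ultimately have nz: "average v' \<noteq> 0"
    using L0 by auto
  have vV: "v' \<in> V" using v' P(1) by (auto simp: subrepresentation_def)
  from nz have "average v' \<one> \<noteq> 0"
    using average_V[OF vV] by (auto simp: cscale_def zero_fun_def)
  moreover have "cscale (average v' \<one>) f0 \<in> P"
    using subrep_average[OF P(1) v'] average_V[OF vV] by simp
  ultimately have "f0 \<in> P"
    using subP csubspace_scale_nz by blast
  then have "whittaker_span \<subseteq> P"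
    using whittaker_span_minimal P(1) by blast
  then have "subrepresentation G \<rho> whittaker_span P"
    using whittaker_span_subrep by (simp add: subrepresentation_def)
  then show ?thesis
    using P(2) whittaker_span_irreducible by (auto simp: irreducible_rep_def)
qed

text \<open>Every intertwiner \<open>L\<close> into \<open>GG\<close> is a multiple of
  \<open>wt\<close>: the value of \<open>L v\<close> at \<open>g\<close> is that of the averaged
  translate at the unit, and this average is \<open>wt v g\<close> times \<open>f0\<close>. The
  factor is therefore \<open>L f0 \<one>\<close>.\<close>

lemma whittaker_unique:
  assumes W: "subrepresentation G \<rho> W GG" "rep_iso G whittaker_span \<rho> W \<rho>"
  shows "W = wt ` whittaker_span"
proof -
  obtain L where L: "bij_betw L whittaker_span W" "clinear_on whittaker_span L"
    "\<And>g v. g \<in> carrier G \<Longrightarrow> v \<in> whittaker_span \<Longrightarrow> L (\<rho> g v) = \<rho> g (L v)"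
    using W(2) unfolding rep_iso_def by blast
  have subP: "csubspace whittaker_span" using whittaker_span_subrep by (simp add: subrepresentation_def)
  have LW: "L w \<in> GG" if "w \<in> whittaker_span" for w
    using L(1) W(1) that by (auto simp: bij_betw_def subrepresentation_def)
  define c where "c = L f0 \<one>"
  have Lv: "L v = cscale c (wt v)" if v: "v \<in> whittaker_span" for v
  proof
    fix g
    show "L v g = cscale c (wt v) g"
    proof (cases "g \<in> carrier G")
      case True
      have gv: "\<rho> g v \<in> whittaker_span"
        using whittaker_span_subrep True v by (auto simp: subrepresentation_def)
      have "L v g = L (\<rho> g v) \<one>"
        using True L(3)[OF True v] by (simp add: right_translation_def)
      also have "\<dots> = L (average (\<rho> g v)) \<one>"
        using linear_average[OF whittaker_span_subrep L(2,3) gv] GG_average_one[OF LW[OF gv]] by simp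
      also have "\<dots> = L (cscale (wt v g) f0) \<one>"
        using average_translate[OF whittaker_span_V[OF v] True] by simp
      also have "\<dots> = cscale c (wt v) g"
        using L(2) f0_in_whittaker_span by (simp add: clinear_on_def c_def cscale_def)
      finally show ?thesis .
    next
      case False
      then show ?thesis
        using LW[OF v] by (simp add: induced_def cscale_def wt_def)
    qed
  qed
  have L0: "L 0 = 0"
    using clinear_on_sum[OF subP L(2), of "{}"] by simp
  have "L f0 \<noteq> 0"
    using L(1) L0 f0_in_whittaker_span f0_one subP
    by (metis bij_betw_def csubspace_iff inj_on_contraD zero_fun_apply zero_neq_one)
  then have c: "c \<noteq> 0"
    using Lv[OF f0_in_whittaker_span] by (auto simp: cscale_def zero_fun_def)
  have S: "csubspace (wt ` whittaker_span)" using wt_subrep by (simp add: subrepresentation_def)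
  have "W = L ` whittaker_span"
    using L(1) by (simp add: bij_betw_def)
  also have "\<dots> = cscale c ` (wt ` whittaker_span)"
    using Lv by (auto simp: image_image intro!: image_cong)
  also have "\<dots> = wt ` whittaker_span"
  proof
    show "cscale c ` (wt ` whittaker_span) \<subseteq> wt ` whittaker_span"
      using S by (auto simp: csubspace_iff)
    show "wt ` whittaker_span \<subseteq> cscale c ` (wt ` whittaker_span)"
    proof
      fix w assume "w \<in> wt ` whittaker_span"
      then have "cscale (inverse c) w \<in> wt ` whittaker_span" using S unfolding csubspace_iff by blast
      moreover have "w = cscale c (cscale (inverse c) w)"
        using c by (simp add: cscale_def fun_eq_iff)
      ultimately show "w \<in> cscale c ` (wt ` whittaker_span)" by blast
    qed
  qed
  finally show ?thesis .
qed

lemma wt_f0_one: "wt f0 \<one> = 1"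
proof -
  have "\<rho> \<one> f0 = f0"
    by (auto simp: right_translation_def fun_eq_iff f0_outside)
  then show ?thesis
    by (simp add: wt_eq average_f0 f0_one)
qed

lemma wt_f0_right:
  assumes "u \<in> U" "g \<in> carrier G"
  shows "wt f0 (g \<otimes> u) = \<psi> u * wt f0 g"
proof -
  have "(\<Sum>a\<in>U. cnj (\<psi> a) * f0 (a \<otimes> (g \<otimes> u))) = \<psi> u * (\<Sum>a\<in>U. cnj (\<psi> a) * f0 (a \<otimes> g))"
    unfolding sum_distrib_left
    using assms by (intro sum.cong) (auto simp: f0_right m_assoc[symmetric])
  then show ?thesis
    using assms by (simp add: wt_def)
qed

text \<open>Right equivariance gives \<open>J = average J\<close>. For \<open>J = wt v\<close> the
  average passes inside \<open>wt\<close> and makes \<open>v\<close> a multiple of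
  \<open>f0\<close>; the normalization at the unit fixes the factor. As an equivalence this
  evaluates the description in \<open>bessel_function\<close> directly.\<close>

lemma bessel_iff:
  "J \<in> wt ` whittaker_span \<and> J \<one> = 1 \<and>
     (\<forall>u1\<in>U. \<forall>u2\<in>U. \<forall>g\<in>carrier G. J (u1 \<otimes> g \<otimes> u2) = \<psi> (u1 \<otimes> u2) * J g) \<longleftrightarrow> J = wt f0"
proof
  assume "J = wt f0"
  moreover have "wt f0 (u1 \<otimes> g \<otimes> u2) = \<psi> (u1 \<otimes> u2) * wt f0 g"
    if "u1 \<in> U" "u2 \<in> U" "g \<in> carrier G" for u1 u2 g
    using that wt_f0_right[of u2 "u1 \<otimes> g"] wt_in_GG[of f0]
    by (simp add: induced_def \<psi>_mult)
  ultimately show "J \<in> wt ` whittaker_span \<and> J \<one> = 1 \<and>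
     (\<forall>u1\<in>U. \<forall>u2\<in>U. \<forall>g\<in>carrier G. J (u1 \<otimes> g \<otimes> u2) = \<psi> (u1 \<otimes> u2) * J g)"
    using wt_f0_one f0_in_whittaker_span by auto
next
  assume J: "J \<in> wt ` whittaker_span \<and> J \<one> = 1 \<and>
     (\<forall>u1\<in>U. \<forall>u2\<in>U. \<forall>g\<in>carrier G. J (u1 \<otimes> g \<otimes> u2) = \<psi> (u1 \<otimes> u2) * J g)"
  then obtain v where v: "v \<in> whittaker_span" "J = wt v" by blast
  have eq: "J (g \<otimes> u) = \<psi> u * J g" if "g \<in> carrier G" "u \<in> U" for g u
    using J that by (metis U.mem_carrier U.one_closed l_one)
  have "average J = J"
  proof
    fix g
    show "average J g = J g"
    proof (cases "g \<in> carrier G")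
      case True
      then show ?thesis
        by (intro average_equivariant) (simp_all add: eq)
    next
      case False
      then show ?thesis
        by (simp add: v(2) average_def wt_def)
    qed
  qed
  then have "J = wt (average v)"
    using linear_average[OF whittaker_span_subrep wt_linear wt_translate v(1)] v(2) by simp
  also have "average v = cscale (average v \<one>) f0"
    by (rule average_V) (rule whittaker_span_V[OF v(1)])
  finally have Jeq: "J = cscale (average v \<one>) (wt f0)"
    using wt_linear[of UNIV] by (simp add: clinear_on_def)
  then have "average v \<one> = 1"
    using J wt_f0_one by (auto simp: cscale_def)
  with Jeq show "J = wt f0"
    by (simp add: cscale_def)
qed

section \<open>The action of the Hecke algebra on the Whittaker line\<close>

definition idem :: "'g \<Rightarrow> complex" where
  "idem = (\<lambda>u. if u \<in> U then cnj (\<psi> u) / of_nat (card U) else 0)"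

definition act :: "('g \<Rightarrow> complex) \<Rightarrow> ('g \<Rightarrow> complex) \<Rightarrow> 'g \<Rightarrow> complex" where
  "act c v = (\<lambda>x. if x \<in> carrier G then \<Sum>g\<in>carrier G. c g * v (x \<otimes> g) else 0)"

text \<open>The value of \<open>act c f0\<close> at the unit. As \<open>f0\<close> is 1 there, this
  is the eigenvalue of \<open>c\<close> whenever \<open>f0\<close> is an eigenvector.\<close>

definition hecke_char :: "('g \<Rightarrow> complex) \<Rightarrow> complex" where
  "hecke_char c = (\<Sum>g\<in>carrier G. c g * f0 g)"

lemma act_mult:
  "act (c \<otimes>\<^bsub>group_algebra G\<^esub> d) v = act c (act d v)"
proof
  fix x
  show "act (c \<otimes>\<^bsub>group_algebra G\<^esub> d) v x = act c (act d v) x"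
  proof (cases "x \<in> carrier G")
    case x: True
    have "act (c \<otimes>\<^bsub>group_algebra G\<^esub> d) v x =
        (\<Sum>g\<in>carrier G. \<Sum>y\<in>carrier G. c y * d (inv y \<otimes> g) * v (x \<otimes> g))"
      using x by (simp add: act_def group_algebra_def sum_distrib_right)
    also have "\<dots> = (\<Sum>y\<in>carrier G. \<Sum>g\<in>carrier G. c y * d (inv y \<otimes> g) * v (x \<otimes> g))"
      by (rule sum.swap)
    \<comment> \<open>In the inner sum \<open>y \<otimes> g\<close> is substituted for
      \<open>g\<close>, which undoes the inverse in the convolution.\<close>
    also have "\<dots> = (\<Sum>y\<in>carrier G. c y * (\<Sum>g\<in>carrier G. d g * v (x \<otimes> y \<otimes> g)))"
    proof (rule sum.cong)
      fix y assume y: "y \<in> carrier G"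
      have "(\<Sum>g\<in>carrier G. c y * d (inv y \<otimes> g) * v (x \<otimes> g)) =
          (\<Sum>g\<in>carrier G. c y * d (inv y \<otimes> (y \<otimes> g)) * v (x \<otimes> (y \<otimes> g)))"
        using sum_mult_left[OF y, of "\<lambda>g. c y * d (inv y \<otimes> g) * v (x \<otimes> g)"] by simp
      also have "\<dots> = c y * (\<Sum>g\<in>carrier G. d g * v (x \<otimes> y \<otimes> g))"
        using x y by (auto simp: sum_distrib_left m_assoc mult.assoc simp flip: m_assoc[of "inv y" y] intro!: sum.cong)
      finally show "(\<Sum>g\<in>carrier G. c y * d (inv y \<otimes> g) * v (x \<otimes> g)) =
          c y * (\<Sum>g\<in>carrier G. d g * v (x \<otimes> y \<otimes> g))" .
    qed simp
    also have "\<dots> = act c (act d v) x"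
      using x by (simp add: act_def)
    finally show ?thesis .
  qed (simp add: act_def)
qed

lemma act_idem: "act idem v = average v"
proof
  fix x
  have "(\<Sum>g\<in>carrier G. idem g * v (x \<otimes> g)) = (\<Sum>u\<in>U. idem u * v (x \<otimes> u))"
    using finite_carrier U.subset by (intro sum.mono_neutral_right) (auto simp: idem_def)
  then show "act idem v x = average v x"
    by (simp add: act_def average_def idem_def sum_divide_distrib)
qed

lemma act_in_V: "v \<in> V \<Longrightarrow> act c v \<in> V"
  by (auto simp: induced_def act_def sum_distrib_left m_assoc algebra_simps intro!: sum.cong)

lemma hecke_char_act: "hecke_char c = act c f0 \<one>"
  by (simp add: hecke_char_def act_def)

text \<open>With c = e c' e, the right factor fixes \<open>f0\<close> and the left factor projects
  the result back to the line of \<open>f0\<close>.\<close>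

lemma act_corner:
  assumes "c \<in> carrier (corner_algebra (group_algebra G) idem)"
  shows "act c f0 = cscale (hecke_char c) f0"
proof -
  obtain c' where c: "c = idem \<otimes>\<^bsub>group_algebra G\<^esub> c' \<otimes>\<^bsub>group_algebra G\<^esub> idem"
    using assms by (auto simp: corner_algebra_def)
  have "act c f0 = average (act c' f0)"
    by (simp add: c act_mult act_idem average_f0)
  also have "\<dots> = cscale (average (act c' f0) \<one>) f0"
    by (intro average_V act_in_V f0_in_V)
  finally have *: "act c f0 = cscale (average (act c' f0) \<one>) f0" .
  then have "hecke_char c = average (act c' f0) \<one>"
    by (simp add: hecke_char_act cscale_def f0_one)
  with * show ?thesis by simp
qed

text \<open>The eigenvalues on a common eigenvector are multiplicative in the operator; the unit of
  the corner algebra is \<open>idem\<close>, which fixes \<open>f0\<close>.\<close>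

lemma hecke_char_alg_hom:
  "hecke_char \<in> alg_hom (corner_algebra (group_algebra G) idem) complex_algebra"
proof -
  let ?H = "corner_algebra (group_algebra G) idem"
  have "hecke_char (c \<otimes>\<^bsub>?H\<^esub> d) = hecke_char c \<otimes>\<^bsub>complex_algebra\<^esub> hecke_char d"
    if "d \<in> carrier ?H" for c d
  proof -
    have "act (c \<otimes>\<^bsub>group_algebra G\<^esub> d) f0 \<one> = act c (cscale (hecke_char d) f0) \<one>"
      by (simp add: act_mult act_corner[OF that])
    also have "\<dots> = hecke_char c * hecke_char d"
      by (simp add: act_def hecke_char_def cscale_def sum_distrib_right algebra_simps)
    finally show ?thesis
      by (simp add: hecke_char_act corner_algebra_def complex_algebra_def)
  qed
  moreover have "hecke_char (c \<oplus>\<^bsub>?H\<^esub> d) = hecke_char c \<oplus>\<^bsub>complex_algebra\<^esub> hecke_char d" for c d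
    by (simp add: hecke_char_def corner_algebra_def complex_algebra_def group_algebra_def
        sum.distrib algebra_simps)
  moreover have "hecke_char \<one>\<^bsub>?H\<^esub> = \<one>\<^bsub>complex_algebra\<^esub>"
    by (simp add: hecke_char_act corner_algebra_def complex_algebra_def act_idem average_f0 f0_one)
  moreover have "hecke_char (a \<odot>\<^bsub>?H\<^esub> c) = a \<odot>\<^bsub>complex_algebra\<^esub> hecke_char c" for a c
    by (simp add: hecke_char_def corner_algebra_def complex_algebra_def group_algebra_def
        cscale_def sum_distrib_left mult.assoc)
  ultimately show ?thesis
    unfolding alg_hom_def ring_hom_def by (simp add: complex_algebra_def)
qed

lemma act_group_elt:
  assumes "g \<in> carrier G"
  shows "act (group_elt g) v = \<rho> g v"
  using assms finite_carrier
  by (auto simp: act_def group_elt_def right_translation_def fun_eq_iff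
       if_distrib[of "\<lambda>y. y * _"] sum.delta cong: if_cong)

text \<open>Since e fixes \<open>f0\<close>, the element e g e sends it to the projection of its
  translate by \<open>g\<close>. Outside the carrier both sides are 0; covering that case lets
  \<open>f_T_chi_props\<close> treat every \<open>antidiag_block xs\<close> without a proof of
  invertibility.\<close>

lemma hecke_char_elt:
  "hecke_char (idem \<otimes>\<^bsub>group_algebra G\<^esub> group_elt g \<otimes>\<^bsub>group_algebra G\<^esub> idem) = wt f0 g"
proof (cases "g \<in> carrier G")
  case True
  then show ?thesis
    by (simp add: hecke_char_act act_mult act_idem average_f0 act_group_elt wt_eq)
next
  case False
  then have "act (group_elt g) f0 = 0"
    by (auto simp: act_def group_elt_def fun_eq_iff intro!: sum.neutral)
  then have "hecke_char (idem \<otimes>\<^bsub>group_algebra G\<^esub> group_elt g \<otimes>\<^bsub>group_algebra G\<^esub> idem) = average 0 \<one>"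
    by (simp add: hecke_char_act act_mult act_idem average_f0)
  with False show ?thesis
    by (simp add: wt_def average_def)
qed

end

section \<open>Subgroups of the general linear group\<close>

text \<open>Right multiplication by \<open>x\<close> is an injective self-map of a finite set, hence
  hits the unit. This spares the computation of inverses of triangular matrices.\<close>

lemma (in group) finite_subgroupI:
  assumes "finite H" "H \<subseteq> carrier G" and one: "\<one> \<in> H"
    and m: "\<And>x y. x \<in> H \<Longrightarrow> y \<in> H \<Longrightarrow> x \<otimes> y \<in> H"
  shows "subgroup H G"
proof (rule subgroupI)
  show "inv x \<in> H" if x: "x \<in> H" for x
  proof -
    have "inj_on (\<lambda>y. y \<otimes> x) H"
      using assms(2) x by (intro inj_onI) (metis right_cancel subsetD)
    then have "(\<lambda>y. y \<otimes> x) ` H = H"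
      using assms(1) m x by (intro endo_inj_surj) auto
    with one obtain y where "y \<in> H" "y \<otimes> x = \<one>"
      by (metis imageE)
    then show ?thesis
      using assms(2) x inv_equality by (metis subsetD)
  qed
qed (use assms in auto)

lemma mat_mult_entry:
  assumes "A \<in> carrier_mat n n" "B \<in> carrier_mat n n" "i < n" "j < n"
  shows "(A * B) $$ (i, j) = (\<Sum>k<n. A $$ (i, k) * B $$ (k, j))"
  using assms by (simp add: scalar_prod_def lessThan_atLeast0)

lemma carrier_GL: "carrier (GL n) = {A \<in> carrier_mat n n. det A \<noteq> 0}"
proof -
  have "A \<in> carrier_mat n n" if "A \<in> Units (ring_mat TYPE('a) n ())" for A :: "'a mat"
    using that by (simp add: Units_def ring_mat_def)
  then show ?thesis
    using det_non_zero_imp_unit[where b = "()" and n = n and ?'a = 'a]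
      unit_imp_det_non_zero[where b = "()" and n = n and ?'a = 'a]
    by (auto simp: GL_def units_of_carrier)
qed

lemma mult_GL [simp]: "A \<otimes>\<^bsub>GL n\<^esub> B = A * B"
  by (simp add: GL_def units_of_mult ring_mat_def)

lemma one_GL [simp]: "\<one>\<^bsub>GL n\<^esub> = 1\<^sub>m n"
  by (simp add: GL_def units_of_one ring_mat_def)

lemma group_GL: "group (GL n)"
proof -
  interpret ring "ring_mat TYPE('a) n ()" by (rule ring_mat)
  show ?thesis
    unfolding GL_def by (rule units_group)
qed

lemma finite_carrier_mat: "finite (carrier_mat m n :: 'a::finite mat set)"
proof -
  let ?F = "{0..<m} \<times> {0..<n} \<rightarrow>\<^sub>E (UNIV :: 'a set)"
  have "A \<in> (\<lambda>f. mat m n f) ` ?F" if A: "A \<in> carrier_mat m n" for A :: "'a mat"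
    by (rule image_eqI[of _ _ "restrict (\<lambda>ij. A $$ ij) ({0..<m} \<times> {0..<n})"]) (use A in auto)
  then have "carrier_mat m n \<subseteq> (\<lambda>f. mat m n f) ` ?F"
    by blast
  then show ?thesis
    by (rule finite_subset) (intro finite_imageI finite_PiE; simp)
qed

lemma finite_GL: "finite (carrier (GL n :: 'a::{finite,field} mat monoid))"
  by (rule finite_subset[OF _ finite_carrier_mat[of n n]]) (auto simp: carrier_GL)

lemma det_upper_triangular_prod:
  assumes "A \<in> carrier_mat n n" "\<And>i j. i < n \<Longrightarrow> j < i \<Longrightarrow> A $$ (i, j) = 0"
  shows "det A = (\<Prod>i<n. A $$ (i, i))"
proof -
  have "det A = prod_list (diag_mat A)"
    using assms by (intro det_upper_triangular[of _ n]) (auto simp: upper_triangular_def)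
  also have "\<dots> = (\<Prod>i<n. A $$ (i, i))"
    using assms(1) by (simp add: diag_mat_def prod.list_conv_set_nth lessThan_atLeast0)
  finally show ?thesis .
qed

lemma det_lower_triangular_prod:
  assumes "A \<in> carrier_mat n n" "\<And>i j. i < j \<Longrightarrow> j < n \<Longrightarrow> A $$ (i, j) = 0"
  shows "det A = (\<Prod>i<n. A $$ (i, i))"
  using assms det_upper_triangular_prod[of "transpose_mat A" n] det_transpose[OF assms(1)] by simp

lemma unipotent_iff:
  "u \<in> unipotent n \<longleftrightarrow> u \<in> carrier_mat n n \<and> (\<forall>i<n. \<forall>j<i. u $$ (i, j) = 0) \<and> (\<forall>i<n. u $$ (i, i) = 1)"
  using det_upper_triangular_prod[of u n]
  by (auto simp: unipotent_def carrier_GL upper_triangular_def)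

lemma lower_borel_iff:
  "b \<in> lower_borel n \<longleftrightarrow>
     b \<in> carrier_mat n n \<and> (\<forall>j<n. \<forall>i<j. b $$ (i, j) = 0) \<and> (\<forall>i<n. b $$ (i, i) \<noteq> 0)"
proof (cases "b \<in> carrier_mat n n \<and> (\<forall>j<n. \<forall>i<j. b $$ (i, j) = 0)")
  case True
  then have "det b = (\<Prod>i<n. b $$ (i, i))"
    by (intro det_lower_triangular_prod) auto
  with True show ?thesis
    by (auto simp: lower_borel_def carrier_GL upper_triangular_def)
qed (auto simp: lower_borel_def carrier_GL upper_triangular_def)

lemma diag_torus_iff:
  "t \<in> diag_torus n \<longleftrightarrow>
     t \<in> carrier_mat n n \<and> (\<forall>i<n. \<forall>j<n. i \<noteq> j \<longrightarrow> t $$ (i, j) = 0) \<and> (\<forall>i<n. t $$ (i, i) \<noteq> 0)"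
proof (cases "t \<in> carrier_mat n n \<and> (\<forall>i<n. \<forall>j<n. i \<noteq> j \<longrightarrow> t $$ (i, j) = 0)")
  case True
  then have "det t = (\<Prod>i<n. t $$ (i, i))"
    by (intro det_lower_triangular_prod) auto
  with True show ?thesis
    by (auto simp: diag_torus_def carrier_GL diagonal_mat_def)
qed (auto simp: diag_torus_def carrier_GL diagonal_mat_def)

lemma lower_mult_entry:
  assumes A: "A \<in> carrier_mat n n" and B: "B \<in> carrier_mat n n" and "j < n" "i \<le> j"
    and a: "\<And>k. i < k \<Longrightarrow> k < n \<Longrightarrow> A $$ (i, k) = 0"
    and b: "\<And>k. k < j \<Longrightarrow> B $$ (k, j) = 0"
  shows "(A * B) $$ (i, j) = (if i = j then A $$ (i, i) * B $$ (i, i) else 0)"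
proof -
  have "(A * B) $$ (i, j) = (\<Sum>k<n. A $$ (i, k) * B $$ (k, j))"
    using assms by (intro mat_mult_entry) auto
  also have "\<dots> = (\<Sum>k<n. if k = i then (if i = j then A $$ (i, i) * B $$ (i, i) else 0) else 0)"
    using assms by (intro sum.cong) (auto simp: not_less linorder_neq_iff)
  finally show ?thesis
    using assms by simp
qed

lemma lower_borel_mult:
  assumes "b \<in> lower_borel n" "c \<in> lower_borel n"
  shows "b * c \<in> lower_borel n" "\<And>i. i < n \<Longrightarrow> (b * c) $$ (i, i) = b $$ (i, i) * c $$ (i, i)"
proof -
  have *: "(b * c) $$ (i, j) = (if i = j then b $$ (i, i) * c $$ (i, i) else 0)" if "i \<le> j" "j < n" for i j
    using assms that by (intro lower_mult_entry[where n = n]) (auto simp: lower_borel_iff)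
  then show "\<And>i. i < n \<Longrightarrow> (b * c) $$ (i, i) = b $$ (i, i) * c $$ (i, i)" by simp
  show "b * c \<in> lower_borel n"
    using assms * by (auto simp: lower_borel_iff)
qed

text \<open>Additivity of the superdiagonal is what makes \<open>unipotent_char\<close> a
  character.\<close>

lemma unipotent_mult:
  assumes u: "u \<in> unipotent n" and v: "v \<in> unipotent n"
  shows "u * v \<in> unipotent n"
    and "\<And>i. Suc i < n \<Longrightarrow> (u * v) $$ (i, Suc i) = u $$ (i, Suc i) + v $$ (i, Suc i)"
proof -
  have uc: "u \<in> carrier_mat n n" "v \<in> carrier_mat n n"
    using u v by (auto simp: unipotent_iff)
  have low: "(u * v) $$ (i, j) = (if i = j then 1 else 0)" if "j \<le> i" "i < n" for i j
  proof -
    have "(u * v) $$ (i, j) = (\<Sum>k<n. u $$ (i, k) * v $$ (k, j))"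
      using uc that by (intro mat_mult_entry) auto
    also have "\<dots> = (\<Sum>k<n. if k = i then (if i = j then 1 else 0) else 0)"
      using u v that by (intro sum.cong) (auto simp: unipotent_iff linorder_neq_iff)
    finally show ?thesis using that by simp
  qed
  then show "u * v \<in> unipotent n"
    using uc by (auto simp: unipotent_iff)
  fix i assume i: "Suc i < n"
  have "(u * v) $$ (i, Suc i) = (\<Sum>k<n. u $$ (i, k) * v $$ (k, Suc i))"
    using uc i by (intro mat_mult_entry) auto
  also have "\<dots> = (\<Sum>k\<in>{i, Suc i}. u $$ (i, k) * v $$ (k, Suc i))"
  proof (rule sum.mono_neutral_right)
    show "\<forall>k\<in>{..<n} - {i, Suc i}. u $$ (i, k) * v $$ (k, Suc i) = 0"
    proof
      fix k assume "k \<in> {..<n} - {i, Suc i}"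
      then have "k < n" "k < i \<or> Suc i < k" by auto
      then show "u $$ (i, k) * v $$ (k, Suc i) = 0"
        using u v i by (auto simp: unipotent_iff)
    qed
  qed (use i in auto)
  also have "\<dots> = u $$ (i, Suc i) + v $$ (i, Suc i)"
    using u v i by (simp add: unipotent_iff)
  finally show "(u * v) $$ (i, Suc i) = u $$ (i, Suc i) + v $$ (i, Suc i)" .
qed

lemma one_mem: "1\<^sub>m n \<in> unipotent n" "1\<^sub>m n \<in> lower_borel n" "1\<^sub>m n \<in> diag_torus n"
  by (auto simp: unipotent_iff lower_borel_iff diag_torus_iff)

lemma subgroup_unipotent: "subgroup (unipotent n :: 'a::{finite,field} mat set) (GL n)"
proof (rule group.finite_subgroupI[OF group_GL])
  show "unipotent n \<subseteq> carrier (GL n)" by (auto simp: unipotent_def)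
  then show "finite (unipotent n :: 'a mat set)" using finite_GL by (rule finite_subset)
qed (simp_all add: one_mem unipotent_mult)

lemma subgroup_lower_borel: "subgroup (lower_borel n :: 'a::{finite,field} mat set) (GL n)"
proof (rule group.finite_subgroupI[OF group_GL])
  show "lower_borel n \<subseteq> carrier (GL n)" by (auto simp: lower_borel_def)
  then show "finite (lower_borel n :: 'a mat set)" using finite_GL by (rule finite_subset)
qed (simp_all add: one_mem lower_borel_mult)

lemma diag_torus_subset: "diag_torus n \<subseteq> lower_borel n"
  by (auto simp: diag_torus_iff lower_borel_iff)

lemma diag_torus_mult:
  assumes "s \<in> diag_torus n" "t \<in> diag_torus n"
  shows "s * t \<in> diag_torus n"
proof -
  have "(s * t) $$ (i, j) = 0" if "i < n" "j < n" "i \<noteq> j" for i j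
  proof -
    have "(s * t) $$ (i, j) = (\<Sum>k<n. s $$ (i, k) * t $$ (k, j))"
      using assms that by (intro mat_mult_entry) (auto simp: diag_torus_iff)
    also have "\<dots> = 0"
      using assms that by (intro sum.neutral) (metis diag_torus_iff lessThan_iff mult_eq_0_iff)
    finally show ?thesis .
  qed
  moreover have "s * t \<in> lower_borel n"
    using assms diag_torus_subset by (intro lower_borel_mult) auto
  ultimately show ?thesis
    by (auto simp: diag_torus_iff lower_borel_iff)
qed

lemma subgroup_diag_torus: "subgroup (diag_torus n :: 'a::{finite,field} mat set) (GL n)"
proof (rule group.finite_subgroupI[OF group_GL])
  show "diag_torus n \<subseteq> carrier (GL n)" by (auto simp: diag_torus_def)
  then show "finite (diag_torus n :: 'a mat set)" using finite_GL by (rule finite_subset)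
qed (simp_all add: one_mem diag_torus_mult)

section \<open>Characters of the lower Borel and the unipotent subgroup\<close>

lemma multiplicative_character_one:
  assumes "multiplicative_character \<chi>" shows "\<chi> 1 = 1"
proof -
  have "\<chi> (1 * 1) = \<chi> 1 * \<chi> 1" "\<chi> 1 \<noteq> 0"
    using assms unfolding multiplicative_character_def by (metis zero_neq_one)+
  then show ?thesis by simp
qed

lemma diag_char_mult:
  assumes "\<And>i. i < n \<Longrightarrow> multiplicative_character (\<chi> i)" "b \<in> lower_borel n" "c \<in> lower_borel n"
  shows "diag_char \<chi> n (b * c) = diag_char \<chi> n b * diag_char \<chi> n c"
  using assms lower_borel_mult[OF assms(2,3)]
  by (auto simp: diag_char_def prod.distrib[symmetric] multiplicative_character_def lower_borel_iff intro!: prod.cong)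

lemma diag_char_nz:
  assumes "\<And>i. i < n \<Longrightarrow> multiplicative_character (\<chi> i)" "b \<in> lower_borel n"
  shows "diag_char \<chi> n b \<noteq> 0"
  using assms by (auto simp: diag_char_def multiplicative_character_def lower_borel_iff)

lemma additive_character_zero:
  assumes "additive_character \<psi>" shows "\<psi> 0 = 1"
proof -
  have "\<psi> (0 + 0) = \<psi> 0 * \<psi> 0" "\<psi> 0 \<noteq> 0"
    using assms unfolding additive_character_def by blast+
  then show ?thesis by simp
qed

lemma unipotent_char_mult:
  assumes "additive_character \<psi>" "u \<in> unipotent n" "v \<in> unipotent n"
  shows "unipotent_char \<psi> n (u * v) = unipotent_char \<psi> n u * unipotent_char \<psi> n v"
proof -
  have "(\<Sum>i<n - 1. (u * v) $$ (i, Suc i)) = (\<Sum>i<n - 1. u $$ (i, Suc i)) + (\<Sum>i<n - 1. v $$ (i, Suc i))"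
    using unipotent_mult(2)[OF assms(2,3)] by (simp add: sum.distrib[symmetric])
  then show ?thesis
    using assms(1) by (simp add: unipotent_char_def additive_character_def)
qed

text \<open>In a finite field two natural numbers \<open>k < l\<close> have the same image, so
  \<open>\<psi> x\<close> is a root of unity of order dividing \<open>l - k\<close>.\<close>

lemma norm_additive_character:
  fixes \<psi> :: "'a::{finite,field} \<Rightarrow> complex"
  assumes "additive_character \<psi>"
  shows "norm (\<psi> x) = 1"
proof -
  have "\<not> inj (of_nat :: nat \<Rightarrow> 'a)"
    using finite_imageD[of "of_nat :: nat \<Rightarrow> 'a" UNIV] by auto
  then obtain k l :: nat where kl: "(of_nat k :: 'a) = of_nat l" "k < l"
    unfolding inj_def by (metis nat_neq_iff)
  have pow: "\<psi> (of_nat m * x) = \<psi> x ^ m" for m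
    using assms additive_character_zero[OF assms]
    by (induction m) (auto simp: additive_character_def algebra_simps)
  have "\<psi> x ^ k = \<psi> x ^ k * \<psi> x ^ (l - k)"
    using pow[of k] pow[of l] kl by (simp add: power_add[symmetric])
  then have "\<psi> x ^ (l - k) = 1"
    using assms by (simp add: additive_character_def)
  then show ?thesis
    using kl(2) power_eq_1_iff[of "\<psi> x" "l - k"] by simp
qed

lemma lower_borel_Int_unipotent: "lower_borel n \<inter> unipotent n \<subseteq> {1\<^sub>m n}"
proof
  fix g :: "'a mat" assume "g \<in> lower_borel n \<inter> unipotent n"
  then have "g = 1\<^sub>m n"
    by (intro eq_matI) (auto simp: lower_borel_iff unipotent_iff linorder_neq_iff)
  then show "g \<in> {1\<^sub>m n}" by simp
qed

section \<open>Vanishing of Whittaker vectors off the open cell\<close>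

lemma GL_carrier_mat: "g \<in> carrier (GL n) \<Longrightarrow> g \<in> carrier_mat n n"
  by (simp add: carrier_GL)

text \<open>If the first \<open>k\<close> rows of \<open>g\<close> are standard unit vectors and row \<open>k\<close> is the \<open>j\<close>-th unit
  vector with \<open>j > k\<close>, then \<open>g\<close> conjugates the root subgroup of position \<open>(j - 1, j)\<close> into the
  lower unipotent matrices, on which \<open>\<chi>\<close> is trivial.\<close>

lemma root_subgroup_vanish:
  fixes \<psi> :: "'a::{finite,field} \<Rightarrow> complex"
  assumes \<psi>: "additive_character \<psi>" "\<psi> x \<noteq> 1"
    and \<chi>: "\<And>i. i < n \<Longrightarrow> multiplicative_character (\<chi> i)"
    and left: "\<And>b g. b \<in> lower_borel n \<Longrightarrow> g \<in> carrier (GL n) \<Longrightarrow> v (b * g) = diag_char \<chi> n b * v g"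
    and right: "\<And>g u. g \<in> carrier (GL n) \<Longrightarrow> u \<in> unipotent n \<Longrightarrow> v (g * u) = unipotent_char \<psi> n u * v g"
    and g: "g \<in> carrier (GL n)"
    and rows: "\<And>i m. i < k \<Longrightarrow> m < n \<Longrightarrow> g $$ (i, m) = (if m = i then 1 else 0)"
    and row: "\<And>m. m < n \<Longrightarrow> g $$ (k, m) = (if m = j then 1 else 0)"
    and kj: "k < j" "j < n"
  shows "v g = 0"
proof -
  have gc: "g \<in> carrier_mat n n" using g by (rule GL_carrier_mat)
  \<comment> \<open>Multiplying \<open>g\<close> by \<open>u\<close> on the right adds
    \<open>x\<close> times column \<open>j - 1\<close> to column \<open>j\<close>. As row
    \<open>k\<close> of \<open>g\<close> is the \<open>j\<close>-th unit vector, the same change is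
    made by adding multiples of row \<open>k\<close> to the rows, which is \<open>w\<close>. Its
    column \<open>k\<close> vanishes above the diagonal, and has no extra term on it, because
    \<open>g $$ (i, j - 1) = 0\<close> for \<open>i \<le> k\<close>.\<close>
  define u where "u = mat n n (\<lambda>(i, m). (if i = m then 1 else 0) + (if i = j - 1 \<and> m = j then x else 0))"
  define w where "w = mat n n (\<lambda>(i, m). (if i = m then 1 else 0) + (if m = k then x * g $$ (i, j - 1) else 0))"
  have u: "u \<in> unipotent n"
    using kj by (auto simp: unipotent_iff u_def)
  have w: "w \<in> lower_borel n" and wd: "\<And>i. i < n \<Longrightarrow> w $$ (i, i) = 1"
    using kj rows row by (auto simp: lower_borel_iff w_def)
  have "g * u = w * g"
  proof (rule eq_matI)
    fix i m assume "i < dim_row (w * g)" "m < dim_col (w * g)"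
    then have im: "i < n" "m < n" using gc by (auto simp: w_def)
    have "(g * u) $$ (i, m) = (\<Sum>l<n. g $$ (i, l) * u $$ (l, m))"
      using gc im by (intro mat_mult_entry) (auto simp: u_def)
    also have "\<dots> = (\<Sum>l<n. (if l = m then g $$ (i, m) else 0) + (if l = j - 1 then (if m = j then g $$ (i, j - 1) * x else 0) else 0))"
      using im kj by (intro sum.cong) (auto simp: u_def)
    also have "\<dots> = g $$ (i, m) + (if m = j then g $$ (i, j - 1) * x else 0)"
      using im kj less_imp_diff_less[of j n 1] by (simp add: sum.distrib)
    finally have 1: "(g * u) $$ (i, m) = g $$ (i, m) + (if m = j then g $$ (i, j - 1) * x else 0)" .
    have "(w * g) $$ (i, m) = (\<Sum>l<n. w $$ (i, l) * g $$ (l, m))"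
      using gc im by (intro mat_mult_entry) (auto simp: w_def)
    also have "\<dots> = (\<Sum>l<n. (if l = i then g $$ (i, m) else 0) + (if l = k then x * g $$ (i, j - 1) * g $$ (k, m) else 0))"
      using im by (intro sum.cong) (auto simp: w_def algebra_simps)
    also have "\<dots> = g $$ (i, m) + x * g $$ (i, j - 1) * g $$ (k, m)"
      using im kj by (simp add: sum.distrib)
    finally show "(g * u) $$ (i, m) = (w * g) $$ (i, m)"
      using 1 row im by simp
  qed (use gc in \<open>auto simp: u_def w_def\<close>)
  moreover have "diag_char \<chi> n w = 1"
    using wd \<chi> by (simp add: diag_char_def multiplicative_character_one)
  moreover have "unipotent_char \<psi> n u = \<psi> x"
  proof -
    have "(\<Sum>i<n - 1. u $$ (i, Suc i)) = (\<Sum>i<n - 1. if i = j - 1 then x else 0)"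
      using kj by (intro sum.cong) (auto simp: u_def)
    also have "\<dots> = x" using kj by simp
    finally show ?thesis by (simp add: unipotent_char_def)
  qed
  ultimately have "\<psi> x * v g = v g"
    using left[OF w g] right[OF g u] by simp
  then show ?thesis
    using \<psi>(2) by simp
qed

text \<open>Gaussian elimination with lower triangular matrices on the left and upper unipotent ones
  on the right, where \<open>k\<close> counts the rows already reduced to unit vectors. Each step
  changes the value of \<open>v\<close> by a nonzero factor. A pivot on the diagonal lets
  elimination continue; a pivot to the right of it forces \<open>v g = 0\<close> by
  \<open>root_subgroup_vanish\<close>. The application has \<open>k = 0\<close>.\<close>

lemma GL_vanish:
  fixes \<psi> :: "'a::{finite,field} \<Rightarrow> complex"
  assumes \<psi>: "additive_character \<psi>" "\<psi> x \<noteq> 1"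
    and \<chi>: "\<And>i. i < n \<Longrightarrow> multiplicative_character (\<chi> i)"
    and left: "\<And>b g. b \<in> lower_borel n \<Longrightarrow> g \<in> carrier (GL n) \<Longrightarrow> v (b * g) = diag_char \<chi> n b * v g"
    and right: "\<And>g u. g \<in> carrier (GL n) \<Longrightarrow> u \<in> unipotent n \<Longrightarrow> v (g * u) = unipotent_char \<psi> n u * v g"
    and g: "g \<in> carrier (GL n)"
    and "k \<le> n"
    and rows: "\<And>i m. i < k \<Longrightarrow> m < n \<Longrightarrow> g $$ (i, m) = (if m = i then 1 else 0)"
  shows "v g = 0 \<or> (\<exists>b u. b \<in> lower_borel n \<and> u \<in> unipotent n \<and> g = b * u)"
  using \<open>k \<le> n\<close> g rows
proof (induction k arbitrary: g rule: inc_induct)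
  case base
  then have "g = 1\<^sub>m n"
    by (intro eq_matI) (auto simp: carrier_GL)
  moreover have "1\<^sub>m n = 1\<^sub>m n * (1\<^sub>m n :: 'a mat)" by simp
  ultimately show ?case using one_mem by blast
next
  case (step k)
  interpret group "GL n :: 'a mat monoid" by (rule group_GL)
  interpret B: subgroup "lower_borel n" "GL n :: 'a mat monoid" by (rule subgroup_lower_borel)
  interpret U: subgroup "unipotent n" "GL n :: 'a mat monoid" by (rule subgroup_unipotent)
  note g = \<open>g \<in> carrier (GL n)\<close> and k = \<open>k < n\<close>
  have gc: "g \<in> carrier_mat n n" using g by (rule GL_carrier_mat)
  have rows: "g $$ (i, m) = (if m = i then 1 else 0)" if "i < k" "m < n" for i m
    using step.prems that by blast
  \<comment> \<open>Otherwise row \<open>k\<close> is supported left of the diagonal. The unit rows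
    above show that column \<open>k\<close> of the inverse vanishes in its first \<open>k\<close>
    entries, so the diagonal entry of the product would be 0 instead of 1.\<close>
  have "\<exists>j. k \<le> j \<and> j < n \<and> g $$ (k, j) \<noteq> 0"
  proof (rule ccontr)
    assume no: "\<not> ?thesis"
    have ic: "inv\<^bsub>GL n\<^esub> g \<in> carrier_mat n n" using g GL_carrier_mat by blast
    have ginv: "g * inv\<^bsub>GL n\<^esub> g = 1\<^sub>m n" using r_inv[OF g] by simp
    have e: "(\<Sum>l<n. g $$ (i, l) * (inv\<^bsub>GL n\<^esub> g) $$ (l, k)) = (if i = k then 1 else 0)" if "i < n" for i
      using mat_mult_entry[OF gc ic that k] ginv that k by simp
    have "(inv\<^bsub>GL n\<^esub> g) $$ (i, k) = 0" if "i < k" for i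
    proof -
      have "(\<Sum>l<n. g $$ (i, l) * (inv\<^bsub>GL n\<^esub> g) $$ (l, k)) = (\<Sum>l<n. if l = i then (inv\<^bsub>GL n\<^esub> g) $$ (i, k) else 0)"
        using rows that by (intro sum.cong) auto
      then show ?thesis
        using e[of i] that k by simp
    qed
    then have "(\<Sum>l<n. g $$ (k, l) * (inv\<^bsub>GL n\<^esub> g) $$ (l, k)) = 0"
      using no by (intro sum.neutral) (metis lessThan_iff mult_eq_0_iff not_less)
    then show False using e[OF k] by simp
  qed
  \<comment> \<open>With the leftmost admissible pivot, the rest of row \<open>k\<close> beyond
    column \<open>k - 1\<close> lies right of column \<open>j\<close> and can be cleared by upper
    unipotent column operations.\<close>
  define j where "j = (LEAST j. k \<le> j \<and> j < n \<and> g $$ (k, j) \<noteq> 0)"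
  have j: "k \<le> j" "j < n" "g $$ (k, j) \<noteq> 0"
    using LeastI_ex[OF \<open>\<exists>j. k \<le> j \<and> j < n \<and> g $$ (k, j) \<noteq> 0\<close>] by (auto simp: j_def)
  have jl: "g $$ (k, m) = 0" if "k \<le> m" "m < j" for m
    using not_less_Least[of m "\<lambda>j. k \<le> j \<and> j < n \<and> g $$ (k, j) \<noteq> 0"] that j by (auto simp: j_def)
  define c where "c = g $$ (k, j)"
  have c: "c \<noteq> 0" using j by (simp add: c_def)
  \<comment> \<open>\<open>u\<close> clears row \<open>k\<close> to the right of the pivot.
    \<open>b\<close> divides that row by \<open>c\<close> and uses the unit rows above it to clear
    the entries left of the diagonal.\<close>
  define u where "u = mat n n (\<lambda>(i, m). (if i = m then 1 else 0) - (if i = j \<and> m > j then g $$ (k, m) / c else 0))"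
  define b where "b = mat n n (\<lambda>(i, m). if i = m then (if i = k then 1 / c else 1) else if i = k \<and> m < k then - g $$ (k, m) / c else 0)"
  have u: "u \<in> unipotent n"
    by (auto simp: unipotent_iff u_def)
  have b: "b \<in> lower_borel n"
    using c by (auto simp: lower_borel_iff b_def)
  have guc: "g * u \<in> carrier_mat n n" using gc by (simp add: u_def)
  have gu: "(g * u) $$ (i, m) = g $$ (i, m) - (if m > j then g $$ (i, j) * g $$ (k, m) / c else 0)"
    if "i < n" "m < n" for i m
  proof -
    have "(g * u) $$ (i, m) = (\<Sum>l<n. g $$ (i, l) * u $$ (l, m))"
      using gc that by (intro mat_mult_entry) (auto simp: u_def)
    also have "\<dots> = (\<Sum>l<n. (if l = m then g $$ (i, m) else 0) - (if l = j then (if m > j then g $$ (i, j) * g $$ (k, m) / c else 0) else 0))"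
      using that by (intro sum.cong) (auto simp: u_def)
    also have "\<dots> = g $$ (i, m) - (if m > j then g $$ (i, j) * g $$ (k, m) / c else 0)"
      using that j by (simp add: sum_subtractf)
    finally show ?thesis .
  qed
  \<comment> \<open>The first \<open>k\<close> rows are unit vectors with a 0 in the pivot column
    \<open>j \<ge> k\<close>, so the column operations do not touch them.\<close>
  have gurows: "(g * u) $$ (i, m) = (if m = i then 1 else 0)" if "i < k" "m < n" for i m
    using that k j by (subst gu) (auto simp: rows)
  have gurow: "(g * u) $$ (k, m) = (if m = j then c else if m < k then g $$ (k, m) else 0)" if "m < n" for m
    using that k j c jl[of m] by (subst gu) (auto simp: c_def)
  define h where "h = b * (g * u)"
  have hij: "h $$ (i, m) = (\<Sum>l<n. b $$ (i, l) * (g * u) $$ (l, m))" if "i < n" "m < n" for i m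
    unfolding h_def using guc that by (intro mat_mult_entry) (auto simp: b_def)
  have hrows: "h $$ (i, m) = (if m = i then 1 else 0)" if "i < k" "m < n" for i m
  proof -
    have "h $$ (i, m) = (\<Sum>l<n. if l = i then (g * u) $$ (i, m) else 0)"
      unfolding hij[OF less_trans[OF that(1) k] that(2)]
      using that k by (intro sum.cong) (auto simp: b_def)
    then show ?thesis using that k gurows by simp
  qed
  have hrow: "h $$ (k, m) = (if m = j then 1 else 0)" if m: "m < n" for m
  proof -
    have "h $$ (k, m) = (\<Sum>l<n. (if l = k then (g * u) $$ (k, m) / c else 0) +
        (if l = m then (if m < k then - g $$ (k, m) / c else 0) else 0))"
      unfolding hij[OF k m]
      using m k gurows by (intro sum.cong) (auto simp: b_def)
    also have "\<dots> = (g * u) $$ (k, m) / c + (if m < k then - g $$ (k, m) / c else 0)"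
      using m k by (simp add: sum.distrib)
    also have "\<dots> = (if m = j then 1 else 0)"
      using m k j c gurow by auto
    finally show ?thesis .
  qed
  have uG: "u \<in> carrier (GL n)" and bG: "b \<in> carrier (GL n)"
    using u b by auto
  have guG: "g * u \<in> carrier (GL n)"
    using m_closed[OF g uG] by simp
  have hG: "h \<in> carrier (GL n)"
    using m_closed[OF bG guG] by (simp add: h_def)
  have "v h = diag_char \<chi> n b * (unipotent_char \<psi> n u * v g)"
    using left[OF b guG] right[OF g u] by (simp add: h_def)
  moreover have "diag_char \<chi> n b \<noteq> 0"
    using \<chi> b by (rule diag_char_nz)
  moreover have "unipotent_char \<psi> n u \<noteq> 0"
    using \<psi> by (simp add: unipotent_char_def additive_character_def)
  ultimately have vh: "v g = 0" if "v h = 0"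
    using that by simp
  show ?case
  proof (cases "j = k")
    case True
    have "v h = 0 \<or> (\<exists>b u. b \<in> lower_borel n \<and> u \<in> unipotent n \<and> h = b * u)"
    proof (rule step.IH[OF hG])
      fix i m assume "i < Suc k" "m < n"
      then show "h $$ (i, m) = (if m = i then 1 else 0)"
        using hrows hrow True by (cases "i = k") auto
    qed
    then show ?thesis
    proof
      assume "\<exists>b u. b \<in> lower_borel n \<and> u \<in> unipotent n \<and> h = b * u"
      then obtain b' u' where b'u': "b' \<in> lower_borel n" "u' \<in> unipotent n" "h = b' * u'" by blast
      have eq: "b \<otimes>\<^bsub>GL n\<^esub> (g \<otimes>\<^bsub>GL n\<^esub> u) = b' \<otimes>\<^bsub>GL n\<^esub> u'"
        using b'u' by (simp add: h_def)
      have "g = inv\<^bsub>GL n\<^esub> b \<otimes>\<^bsub>GL n\<^esub> (b \<otimes>\<^bsub>GL n\<^esub> (g \<otimes>\<^bsub>GL n\<^esub> u)) \<otimes>\<^bsub>GL n\<^esub> inv\<^bsub>GL n\<^esub> u"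
        using bG g uG by (simp del: mult_GL one_GL add: m_assoc inv_solve_left inv_solve_right)
      also have "\<dots> = (inv\<^bsub>GL n\<^esub> b \<otimes>\<^bsub>GL n\<^esub> b') \<otimes>\<^bsub>GL n\<^esub> (u' \<otimes>\<^bsub>GL n\<^esub> inv\<^bsub>GL n\<^esub> u)"
        unfolding eq using bG uG b'u' B.mem_carrier U.mem_carrier by (simp del: mult_GL one_GL add: m_assoc)
      finally have "g = (inv\<^bsub>GL n\<^esub> b * b') * (u' * inv\<^bsub>GL n\<^esub> u)" by simp
      moreover have "inv\<^bsub>GL n\<^esub> b * b' \<in> lower_borel n"
        using B.m_closed[OF B.m_inv_closed[OF b] b'u'(1)] by simp
      moreover have "u' * inv\<^bsub>GL n\<^esub> u \<in> unipotent n"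
        using U.m_closed[OF b'u'(2) U.m_inv_closed[OF u]] by simp
      ultimately show ?thesis by blast
    qed (use vh in blast)
  next
    case False
    then have "k < j" using j by simp
    then have "v h = 0"
      using root_subgroup_vanish[OF \<psi> \<chi> left right hG hrows hrow _ j(2)] by blast
    then show ?thesis using vh by blast
  qed
qed

lemma whittaker_data_GL:
  fixes \<psi> :: "'a::{finite,field} \<Rightarrow> complex"
  assumes \<psi>: "additive_character \<psi>" "\<exists>x. \<psi> x \<noteq> 1"
    and \<chi>: "\<And>i. i < n \<Longrightarrow> multiplicative_character (\<chi> i)"
  shows "whittaker_data (GL n) (lower_borel n) (unipotent n) (diag_char \<chi> n) (unipotent_char \<psi> n)"
proof -
  interpret group "GL n :: 'a mat monoid" by (rule group_GL)
  interpret B: subgroup "lower_borel n" "GL n :: 'a mat monoid" by (rule subgroup_lower_borel)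
  interpret U: subgroup "unipotent n" "GL n :: 'a mat monoid" by (rule subgroup_unipotent)
  obtain x where x: "\<psi> x \<noteq> 1" using \<psi> by blast
  show ?thesis
  proof unfold_locales
    show "lower_borel n \<inter> unipotent n \<subseteq> {\<one>\<^bsub>GL n\<^esub> :: 'a mat}"
      using lower_borel_Int_unipotent by simp
    fix v and g :: "'a mat"
    assume v: "v \<in> induced (GL n) (lower_borel n) (diag_char \<chi> n)"
      and r: "\<And>g u. g \<in> carrier (GL n) \<Longrightarrow> u \<in> unipotent n \<Longrightarrow> v (g \<otimes>\<^bsub>GL n\<^esub> u) = unipotent_char \<psi> n u * v g"
      and g: "g \<in> carrier (GL n)"
      and no: "\<nexists>b u. b \<in> lower_borel n \<and> u \<in> unipotent n \<and> g = b \<otimes>\<^bsub>GL n\<^esub> u"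
    show "v g = 0"
      using GL_vanish[where v = v and k = 0 and \<chi> = \<chi>, OF \<psi>(1) x \<chi> _ _ g] v r no
      by (auto simp: induced_def)
  qed (use finite_GL diag_char_mult[OF \<chi>] diag_char_nz[OF \<chi>] unipotent_char_mult[OF \<psi>(1)]
        norm_additive_character[OF \<psi>(1)] in \<open>auto simp: unipotent_char_def\<close>)
qed

section \<open>The Bessel function of the principal series\<close>

text \<open>A global name for \<open>f0\<close>: the interpretation of \<open>whittaker_data\<close>
  below is local to its context block.\<close>

definition bessel_vector ::
  "('a::{finite,field} \<Rightarrow> complex) \<Rightarrow> nat \<Rightarrow> (nat \<Rightarrow> 'a \<Rightarrow> complex) \<Rightarrow> 'a mat \<Rightarrow> complex" where
  "bessel_vector \<psi> n \<chi> =
     whittaker_data.whittaker_vector (GL n) (lower_borel n) (unipotent n) (diag_char \<chi> n) (unipotent_char \<psi> n)"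

context
  fixes \<psi> :: "'a::{finite,field} \<Rightarrow> complex" and n :: nat and \<chi> :: "nat \<Rightarrow> 'a \<Rightarrow> complex"
  assumes \<psi>: "additive_character \<psi>" "\<exists>x. \<psi> x \<noteq> 1"
    and \<chi>: "\<And>i. i < n \<Longrightarrow> multiplicative_character (\<chi> i)"
begin

interpretation W: whittaker_data "GL n :: 'a mat monoid" "lower_borel n" "unipotent n"
    "diag_char \<chi> n" "unipotent_char \<psi> n"
  by (rule whittaker_data_GL[OF \<psi> \<chi>])

lemma pi_S_eq: "pi_S \<psi> n \<chi> = W.whittaker_span"
proof -
  have "subrepresentation (GL n) (right_translation (GL n)) P (principal_series \<chi> n) \<and>
      generic \<psi> n P (right_translation (GL n)) \<longleftrightarrow> P = W.whittaker_span" for P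
  proof
    assume "P = W.whittaker_span"
    then show "subrepresentation (GL n) (right_translation (GL n)) P (principal_series \<chi> n) \<and>
        generic \<psi> n P (right_translation (GL n))"
      using W.whittaker_span_subrep W.whittaker_span_irreducible W.wt_subrep W.wt_iso
      unfolding generic_def gelfand_graev_def principal_series_def by blast
  next
    assume "subrepresentation (GL n) (right_translation (GL n)) P (principal_series \<chi> n) \<and>
        generic \<psi> n P (right_translation (GL n))"
    then obtain X where "subrepresentation (GL n) (right_translation (GL n)) P W.V"
      "irreducible_rep (GL n) P (right_translation (GL n))"
      "subrepresentation (GL n) (right_translation (GL n)) X W.GG"
      "rep_iso (GL n) P (right_translation (GL n)) X (right_translation (GL n))"
      unfolding generic_def gelfand_graev_def principal_series_def by blast
    then show "P = W.whittaker_span"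
      by (rule W.generic_imp_whittaker_span)
  qed
  then show ?thesis
    by (simp add: pi_S_def)
qed

lemma whittaker_model_eq:
  "whittaker_model \<psi> n (pi_S \<psi> n \<chi>) (right_translation (GL n)) = W.wt ` W.whittaker_span"
  unfolding whittaker_model_def pi_S_eq gelfand_graev_def
proof (rule the_equality)
  show "subrepresentation (GL n) (right_translation (GL n)) (W.wt ` W.whittaker_span) W.GG \<and>
      rep_iso (GL n) W.whittaker_span (right_translation (GL n)) (W.wt ` W.whittaker_span) (right_translation (GL n))"
    by (intro conjI W.wt_subrep W.wt_iso)
qed (elim conjE, rule W.whittaker_unique)

lemma bessel_function_eq:
  "bessel_function \<psi> n (pi_S \<psi> n \<chi>) (right_translation (GL n)) = W.wt W.whittaker_vector"
  unfolding bessel_function_def whittaker_model_eq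
  using W.bessel_iff by simp

lemma bessel_function_sum:
  assumes "g \<in> carrier (GL n)"
  shows "bessel_function \<psi> n (pi_S \<psi> n \<chi>) (right_translation (GL n)) g =
    (\<Sum>u\<in>unipotent n. cnj (unipotent_char \<psi> n u) * bessel_vector \<psi> n \<chi> (u * g)) / of_nat (card (unipotent n :: 'a mat set))"
  using assms by (simp add: bessel_function_eq W.wt_def bessel_vector_def)

lemma hecke_algebra_eq: "hecke_algebra \<psi> n = corner_algebra (group_algebra (GL n)) W.idem"
  by (simp add: hecke_algebra_def e_psi_def W.idem_def)

lemma f_T_chi_props:
  "f_T_chi \<psi> n \<chi> \<in> alg_hom (hecke_algebra \<psi> n) complex_algebra \<and>
   (\<forall>xs\<in>block_data n.
      f_T_chi \<psi> n \<chi> (hecke_elt \<psi> n (antidiag_block xs)) =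
      bessel_function \<psi> n (pi_S \<psi> n \<chi>) (right_translation (GL n)) (antidiag_block xs))"
  unfolding f_T_chi_def
proof (rule someI[of _ W.hecke_char], intro conjI ballI)
  show "W.hecke_char \<in> alg_hom (hecke_algebra \<psi> n) complex_algebra"
    unfolding hecke_algebra_eq by (rule W.hecke_char_alg_hom)
  have "e_psi \<psi> n = W.idem"
    by (simp add: e_psi_def W.idem_def)
  then show "W.hecke_char (hecke_elt \<psi> n (antidiag_block xs)) =
      bessel_function \<psi> n (pi_S \<psi> n \<chi>) (right_translation (GL n)) (antidiag_block xs)" for xs
    using W.hecke_char_elt by (simp add: hecke_elt_def bessel_function_eq)
qed

lemma bessel_vector_mult:
  assumes "b \<in> lower_borel n" "u \<in> unipotent n"
  shows "bessel_vector \<psi> n \<chi> (b * u) = diag_char \<chi> n b * unipotent_char \<psi> n u"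
  using W.f0_BU[OF assms] by (simp add: bessel_vector_def)

lemma bessel_vector_off:
  assumes "\<And>b u. b \<in> lower_borel n \<Longrightarrow> u \<in> unipotent n \<Longrightarrow> g \<noteq> b * u"
  shows "bessel_vector \<psi> n \<chi> g = 0"
  using assms W.f0_off[of g] by (auto simp: bessel_vector_def)

lemma bessel_vector_right:
  assumes "g \<in> carrier (GL n)" "u \<in> unipotent n"
  shows "bessel_vector \<psi> n \<chi> (g * u) = unipotent_char \<psi> n u * bessel_vector \<psi> n \<chi> g"
  using W.f0_right[of u g] assms by (simp add: bessel_vector_def)

end

text \<open>The induced space sees the family only through values at nonzero elements and indices
  below \<open>n\<close>. Hence \<open>f_T_chi\<close> is a function of the actual torus character,
  as \<open>chi_hat_interpolate\<close> demands.\<close>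

lemma f_T_chi_cong:
  assumes "\<And>i x. i < n \<Longrightarrow> x \<noteq> 0 \<Longrightarrow> \<chi> i x = \<chi>' i x"
  shows "f_T_chi \<psi> n \<chi> = f_T_chi \<psi> n \<chi>'"
proof -
  have "diag_char \<chi> n b = diag_char \<chi>' n b" if "b \<in> lower_borel n" for b :: "'a mat"
    using that assms by (auto simp: diag_char_def lower_borel_iff intro!: prod.cong)
  then have "principal_series \<chi> n = principal_series \<chi>' n"
    by (simp add: principal_series_def induced_def)
  then show ?thesis
    by (simp add: f_T_chi_def pi_S_def)
qed

section \<open>The Bessel function at the weighted cyclic shift\<close>

definition shift_mat :: "nat \<Rightarrow> 'a \<Rightarrow> 'a::field mat" where
  "shift_mat n a = mat n n (\<lambda>(i, j). if i = 0 then (if j = n - 1 then a else 0) else if i = Suc j then 1 else 0)"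

lemma antidiag_block_shift:
  assumes "n \<ge> 2"
  shows "antidiag_block [(1, a), (n - 1, 1)] = shift_mat n a"
proof -
  obtain m where "n = Suc m" using assms by (cases n) auto
  then show ?thesis
    by (intro eq_matI) (auto simp: shift_mat_def Let_def)
qed

lemma mult_shift:
  assumes "A \<in> carrier_mat n n" "i < n" "j < n"
  shows "(A * shift_mat n a) $$ (i, j) = (if j = n - 1 then A $$ (i, 0) * a else A $$ (i, Suc j))"
proof -
  have "(A * shift_mat n a) $$ (i, j) = (\<Sum>k<n. A $$ (i, k) * shift_mat n a $$ (k, j))"
    using assms by (intro mat_mult_entry) (auto simp: shift_mat_def)
  also have "\<dots> = (\<Sum>k<n. if k = (if j = n - 1 then 0 else Suc j)
      then (if j = n - 1 then A $$ (i, 0) * a else A $$ (i, Suc j)) else 0)"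
    using assms by (intro sum.cong) (auto simp: shift_mat_def)
  finally show ?thesis
    using assms by (auto simp: sum.delta)
qed

lemma shift_mult:
  assumes "A \<in> carrier_mat n n" "i < n" "j < n"
  shows "(shift_mat n a * A) $$ (i, j) = (if i = 0 then a * A $$ (n - 1, j) else A $$ (i - 1, j))"
proof -
  have "(shift_mat n a * A) $$ (i, j) = (\<Sum>k<n. shift_mat n a $$ (i, k) * A $$ (k, j))"
    using assms by (intro mat_mult_entry) (auto simp: shift_mat_def)
  also have "\<dots> = (\<Sum>k<n. if k = (if i = 0 then n - 1 else i - 1)
      then (if i = 0 then a * A $$ (n - 1, j) else A $$ (i - 1, j)) else 0)"
    using assms by (intro sum.cong) (auto simp: shift_mat_def)
  finally show ?thesis
    using assms by (auto simp: sum.delta)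
qed

lemma shift_mat_carrier [simp]: "shift_mat n a \<in> carrier_mat n n"
  by (simp add: shift_mat_def)

lemma det_mult_GL:
  assumes "A * B = 1\<^sub>m n" "A \<in> carrier_mat n n" "B \<in> carrier_mat n n"
  shows "A \<in> carrier (GL n)"
proof -
  have "det A * det B = 1"
    using assms det_mult[of A n B] by simp
  then show ?thesis
    using assms by (auto simp: carrier_GL)
qed

lemma shift_mat_GL:
  assumes "a \<noteq> 0" "n \<ge> 2"
  shows "shift_mat n a \<in> carrier (GL n)"
proof (rule det_mult_GL)
  let ?B = "mat n n (\<lambda>(i, j). if i = n - 1 then (if j = 0 then 1 / a else 0) else if j = Suc i then 1 else 0)"
  show "?B \<in> carrier_mat n n" by simp
  show "shift_mat n a * ?B = 1\<^sub>m n"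
  proof (rule eq_matI)
    fix i j assume "i < dim_row (1\<^sub>m n)" "j < dim_col (1\<^sub>m n)"
    then have ij: "i < n" "j < n" by auto
    show "(shift_mat n a * ?B) $$ (i, j) = (1\<^sub>m n) $$ (i, j)"
      unfolding shift_mult[OF \<open>?B \<in> carrier_mat n n\<close> ij] using assms ij by auto
  qed (auto simp: shift_mat_def)
qed simp

text \<open>The first-row unipotent matrices form a complement in \<open>unipotent n\<close> to the subgroup
  \<open>stable_unipotent n\<close> of matrices that the shift conjugates into \<open>unipotent n\<close>.\<close>

definition row_unipotent :: "nat \<Rightarrow> (nat \<Rightarrow> 'a) \<Rightarrow> 'a::field mat" where
  "row_unipotent n x = mat n n (\<lambda>(i, j). if i = j then 1 else if i = 0 then x j else 0)"

definition stable_unipotent :: "nat \<Rightarrow> 'a::field mat set" where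
  "stable_unipotent n = {u \<in> unipotent n. \<forall>j<n. j > 0 \<longrightarrow> u $$ (0, j) = 0}"

lemma row_unipotent_mem: "row_unipotent n x \<in> unipotent n"
  by (auto simp: unipotent_iff row_unipotent_def)

lemma row_unipotent_mult:
  assumes "A \<in> carrier_mat n n" "0 < i" "i < n" "j < n"
  shows "(row_unipotent n x * A) $$ (i, j) = A $$ (i, j)"
proof -
  have "(row_unipotent n x * A) $$ (i, j) = (\<Sum>k<n. row_unipotent n x $$ (i, k) * A $$ (k, j))"
    using assms by (intro mat_mult_entry) (auto simp: row_unipotent_def)
  also have "\<dots> = (\<Sum>k<n. if k = i then A $$ (i, j) else 0)"
    using assms by (intro sum.cong) (auto simp: row_unipotent_def)
  finally show ?thesis
    using assms by simp
qed

text \<open>Left multiplication by a first-row unipotent changes row 0 only, so the other rows of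
  the product determine \<open>u\<close>, and cancelling \<open>u\<close> then determines
  \<open>x\<close>. The extensional function space makes the parameter \<open>x\<close> unique as a
  function.\<close>

lemma unipotent_decomposition:
  "bij_betw (\<lambda>(x, u). row_unipotent n x * u)
     (({1..n - 1} \<rightarrow>\<^sub>E UNIV) \<times> stable_unipotent n) (unipotent n :: 'a::{finite,field} mat set)"
  unfolding bij_betw_def
proof
  interpret group "GL n :: 'a mat monoid" by (rule group_GL)
  interpret U: subgroup "unipotent n" "GL n :: 'a mat monoid" by (rule subgroup_unipotent)
  let ?S = "({1..n - 1} \<rightarrow>\<^sub>E (UNIV :: 'a set)) \<times> stable_unipotent n"
  show "inj_on (\<lambda>(x, u). row_unipotent n x * u) ?S"
  proof (rule inj_onI, clarify)
    fix x x' :: "nat \<Rightarrow> 'a" and u u'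
    assume x: "x \<in> {1..n - 1} \<rightarrow>\<^sub>E UNIV" "x' \<in> {1..n - 1} \<rightarrow>\<^sub>E UNIV"
      and u: "u \<in> stable_unipotent n" "u' \<in> stable_unipotent n"
      and eq: "row_unipotent n x * u = row_unipotent n x' * u'"
    have uc: "u \<in> carrier_mat n n" "u' \<in> carrier_mat n n" and uU: "u \<in> unipotent n" "u' \<in> unipotent n"
      using u by (auto simp: stable_unipotent_def unipotent_iff)
    have "u = u'"
    proof (rule eq_matI)
      fix i j assume "i < dim_row u'" "j < dim_col u'"
      then have ij: "i < n" "j < n" using uc by auto
      show "u $$ (i, j) = u' $$ (i, j)"
      proof (cases "i = 0")
        case True
        then show ?thesis
          using u ij by (cases "j = 0") (auto simp: stable_unipotent_def unipotent_iff)
      next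
        case False
        then show ?thesis
          using row_unipotent_mult[OF uc(1) _ ij] row_unipotent_mult[OF uc(2) _ ij] eq by (metis neq0_conv)
      qed
    qed (use uc in auto)
    moreover have "row_unipotent n x = row_unipotent n x'"
      using eq right_cancel[of "u'" "row_unipotent n x" "row_unipotent n x'"]
        U.mem_carrier[OF row_unipotent_mem] U.mem_carrier[OF uU(2)] \<open>u = u'\<close> by simp
    moreover have "x j = x' j" if "j \<in> {1..n - 1}" for j
    proof -
      have "row_unipotent n x $$ (0, j) = x j" "row_unipotent n x' $$ (0, j) = x' j"
        using that by (auto simp: row_unipotent_def)
      then show ?thesis
        using \<open>row_unipotent n x = row_unipotent n x'\<close> by simp
    qed
    ultimately show "x = x' \<and> u = u'"
      using PiE_ext[OF x] by blast
  qed
  show "(\<lambda>(x, u). row_unipotent n x * u) ` ?S = unipotent n"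
  proof
    show "(\<lambda>(x, u). row_unipotent n x * u) ` ?S \<subseteq> unipotent n"
      by (auto simp: stable_unipotent_def intro!: row_unipotent_mem unipotent_mult(1))
    show "unipotent n \<subseteq> (\<lambda>(x, u). row_unipotent n x * u) ` ?S"
    proof
      fix u :: "'a mat" assume u: "u \<in> unipotent n"
      \<comment> \<open>Replacing row 0 by a unit vector gives the stable factor: below row 0 it
        agrees with \<open>u\<close>, so \<open>u\<close> times its inverse has unit rows
        there.\<close>
      define v where "v = mat n n (\<lambda>(i, j). if i = 0 then (if j = 0 then 1 else 0) else u $$ (i, j))"
      have v: "v \<in> unipotent n" "v \<in> stable_unipotent n"
        using u by (auto simp: v_def unipotent_iff stable_unipotent_def)
      define w where "w = u * inv\<^bsub>GL n\<^esub> v"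
      have w: "w \<in> unipotent n"
        using U.m_closed[OF u U.m_inv_closed[OF v(1)]] by (simp add: w_def)
      have vw: "w * v = u"
        using inv_solve_right'[of w u v] U.mem_carrier[OF u] U.mem_carrier[OF v(1)] U.mem_carrier[OF w]
        by (simp add: w_def)
      have ic: "inv\<^bsub>GL n\<^esub> v \<in> carrier_mat n n"
        using U.m_inv_closed[OF v(1)] by (simp add: unipotent_iff)
      have uc: "u \<in> carrier_mat n n" "v \<in> carrier_mat n n"
        using u v by (auto simp: unipotent_iff)
      have vv: "v * inv\<^bsub>GL n\<^esub> v = 1\<^sub>m n"
        using r_inv[OF U.mem_carrier[OF v(1)]] by simp
      have wij: "w $$ (i, j) = (if i = j then 1 else 0)" if "0 < i" "i < n" "j < n" for i j
      proof -
        have "w $$ (i, j) = (\<Sum>k<n. u $$ (i, k) * (inv\<^bsub>GL n\<^esub> v) $$ (k, j))"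
          unfolding w_def by (rule mat_mult_entry) (use uc ic that in auto)
        also have "\<dots> = (\<Sum>k<n. v $$ (i, k) * (inv\<^bsub>GL n\<^esub> v) $$ (k, j))"
          using that by (intro sum.cong) (auto simp: v_def)
        also have "\<dots> = (v * inv\<^bsub>GL n\<^esub> v) $$ (i, j)"
          by (rule mat_mult_entry[symmetric]) (use uc ic that in auto)
        finally show ?thesis
          using that vv by simp
      qed
      have "w = row_unipotent n (restrict (\<lambda>j. w $$ (0, j)) {1..n - 1})"
      proof (rule eq_matI)
        fix i j
        assume "i < dim_row (row_unipotent n (restrict (\<lambda>j. w $$ (0, j)) {1..n - 1}))"
          "j < dim_col (row_unipotent n (restrict (\<lambda>j. w $$ (0, j)) {1..n - 1}))"
        then have "i < n" "j < n" by (auto simp: row_unipotent_def)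
        then show "w $$ (i, j) = row_unipotent n (restrict (\<lambda>j. w $$ (0, j)) {1..n - 1}) $$ (i, j)"
          using w wij by (cases "i = 0") (auto simp: row_unipotent_def unipotent_iff)
      qed (use w in \<open>auto simp: row_unipotent_def unipotent_iff\<close>)
      then have "u = row_unipotent n (restrict (\<lambda>j. w $$ (0, j)) {1..n - 1}) * v"
        using vw by simp
      then show "u \<in> (\<lambda>(x, u). row_unipotent n x * u) ` ?S"
        using v(2) by (intro image_eqI[of _ _ "(restrict (\<lambda>j. w $$ (0, j)) {1..n - 1}, v)"]) auto
    qed
  qed
qed

text \<open>Here \<open>u\<close> is block diagonal diag(1, u0), and the shift conjugates it to
  diag(u0, 1). In both matrices the superdiagonal entry outside u0 is 0, so the characters
  agree.\<close>

lemma stable_unipotent_shift: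
  fixes u :: "'a::field mat"
  assumes u: "u \<in> stable_unipotent n" and n: "n \<ge> 2"
  obtains u' where "u' \<in> unipotent n" "u * shift_mat n a = shift_mat n a * u'"
    "unipotent_char \<psi> n u' = unipotent_char \<psi> n u"
proof
  define u' where "u' = mat n n (\<lambda>(i, j). if i = j then 1 else if i < n - 1 \<and> j < n - 1 then u $$ (Suc i, Suc j) else 0)"
  have uU: "u \<in> unipotent n" and uc: "u \<in> carrier_mat n n"
    using u by (auto simp: stable_unipotent_def unipotent_iff)
  have u'c: "u' \<in> carrier_mat n n" by (simp add: u'_def)
  show "u' \<in> unipotent n"
    using uU by (auto simp: unipotent_iff u'_def)
  show "u * shift_mat n a = shift_mat n a * u'"
  proof (rule eq_matI)
    fix i j assume "i < dim_row (shift_mat n a * u')" "j < dim_col (shift_mat n a * u')"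
    then have ij: "i < n" "j < n" by (auto simp: shift_mat_def u'_def)
    show "(u * shift_mat n a) $$ (i, j) = (shift_mat n a * u') $$ (i, j)"
      unfolding mult_shift[OF uc ij] shift_mult[OF u'c ij]
      using u ij n by (cases i) (auto simp: u'_def stable_unipotent_def unipotent_iff)
  qed (use uc u'c in \<open>auto simp: shift_mat_def\<close>)
  obtain m where m: "n = Suc (Suc m)"
    using n by (metis Suc_le_D numeral_2_eq_2 Suc_le_mono)
  have "(\<Sum>i<n - 1. u' $$ (i, Suc i)) = (\<Sum>i<m. u $$ (Suc i, Suc (Suc i)))"
    by (simp add: m u'_def)
  moreover have "(\<Sum>i<n - 1. u $$ (i, Suc i)) = (\<Sum>i<m. u $$ (Suc i, Suc (Suc i)))"
    using u by (simp add: m sum.lessThan_Suc_shift stable_unipotent_def del: sum.lessThan_Suc)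
  ultimately show "unipotent_char \<psi> n u' = unipotent_char \<psi> n u"
    by (simp add: unipotent_char_def)
qed

lemma cnj_additive_character:
  fixes \<psi> :: "'a::{finite,field} \<Rightarrow> complex"
  assumes "additive_character \<psi>"
  shows "cnj (\<psi> x) = \<psi> (- x)"
proof -
  have "\<psi> (- x) * \<psi> x = 1"
    using assms additive_character_zero[OF assms] unfolding additive_character_def
    by (metis add.left_inverse)
  moreover have "cnj (\<psi> x) * \<psi> x = 1"
    using norm_additive_character[OF assms, of x] complex_norm_square[of "\<psi> x"] by (simp add: mult.commute)
  ultimately show ?thesis
    by (metis mult_right_cancel mult_zero_right zero_neq_one)
qed

text \<open>A companion matrix. The update \<open>x(n := a)\<close> makes \<open>a\<close> the
  \<open>n\<close>-th coordinate, so that the last column needs no separate treatment here and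
  below.\<close>

lemma row_unipotent_shift_entry:
  assumes "n \<ge> 2" "i < n" "j < n"
  shows "(row_unipotent n x * shift_mat n a) $$ (i, j) =
    (if i = 0 then (x(n := a)) (Suc j) else if i = Suc j then 1 else 0)"
proof -
  have "row_unipotent n x \<in> carrier_mat n n" by (simp add: row_unipotent_def)
  then show ?thesis
    using assms by (subst mult_shift) (auto simp: row_unipotent_def)
qed

text \<open>The torus part of \<open>row_unipotent n x * shift_mat n a\<close> has the quotients of consecutive
  leading principal minors \<open>(-1)\<^sup>k\<^sup>-\<^sup>1 x\<^sub>k\<close> on its diagonal.\<close>

lemma row_unipotent_shift_factor:
  fixes a :: "'a::field"
  assumes n: "n \<ge> 2" and a: "a \<noteq> 0" and x: "\<And>k. k \<in> {1..n - 1} \<Longrightarrow> x k \<noteq> 0"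
  obtains b u where "b \<in> lower_borel n" "u \<in> unipotent n"
    "row_unipotent n x * shift_mat n a = b * u"
    "diag_char \<chi> n b = diag_char \<chi> n (torus_param n a x)"
    "- x 1 + (\<Sum>i<n - 1. u $$ (i, Suc i)) = - mat_trace (torus_param n a x)"
proof
  define X where "X = x(n := a)"
  have X: "X (Suc k) \<noteq> 0" if "k < n" for k
    using that x[of "Suc k"] a by (auto simp: X_def)
  \<comment> \<open>Row 0 of the product, divided by its pivot, is row 0 of \<open>u\<close>. Each
    later row of \<open>b * u\<close> is the preceding row of \<open>u\<close> plus a multiple of
    the current one, chosen to cancel everything right of the subdiagonal 1.\<close>
  define b where "b = mat n n (\<lambda>(i, j). if i = j then (if i = 0 then X 1 else - (X (Suc i) / X i))
      else if i = Suc j then 1 else 0)"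
  define u where "u = mat n n (\<lambda>(i, j). if i \<le> j then X (Suc j) / X (Suc i) else 0)"
  have Xi: "X i \<noteq> 0" if "0 < i" "i < n" for i
    using X[of "i - 1"] that by simp
  show "b \<in> lower_borel n"
    using X X[of 0] Xi n by (auto simp: lower_borel_iff b_def)
  show "u \<in> unipotent n"
    using X by (auto simp: unipotent_iff u_def)
  show "row_unipotent n x * shift_mat n a = b * u"
  proof (rule eq_matI)
    fix i j assume "i < dim_row (b * u)" "j < dim_col (b * u)"
    then have ij: "i < n" "j < n" by (auto simp: b_def u_def)
    have bu: "(b * u) $$ (i, j) = (\<Sum>k<n. b $$ (i, k) * u $$ (k, j))"
      using ij by (intro mat_mult_entry) (auto simp: b_def u_def)
    have "(b * u) $$ (i, j) = (if i = 0 then X (Suc j) else if i = Suc j then 1 else 0)"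
    proof (cases i)
      case 0
      have "(b * u) $$ (i, j) = (\<Sum>k<n. if k = 0 then X (Suc j) else 0)"
        unfolding bu using 0 ij X[of 0] by (intro sum.cong) (auto simp: b_def u_def)
      then show ?thesis using 0 ij by simp
    next
      case (Suc l)
      have "(b * u) $$ (i, j) = (\<Sum>k<n. (if k = l then (if l \<le> j then X (Suc j) / X (Suc l) else 0) else 0) +
          (if k = i then (if i \<le> j then - (X (Suc i) / X i) * (X (Suc j) / X (Suc i)) else 0) else 0))"
        unfolding bu using Suc ij by (intro sum.cong) (auto simp: b_def u_def)
      also have "\<dots> = (if l \<le> j then X (Suc j) / X (Suc l) else 0) +
          (if i \<le> j then - (X (Suc i) / X i) * (X (Suc j) / X (Suc i)) else 0)"
        using Suc ij by (simp add: sum.distrib)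
      also have "\<dots> = (if i = Suc j then 1 else 0)"
        using Suc ij X[of i] X[of l] by (auto simp: le_Suc_eq not_le)
      finally show ?thesis using Suc by simp
    qed
    then show "(row_unipotent n x * shift_mat n a) $$ (i, j) = (b * u) $$ (i, j)"
      by (simp add: row_unipotent_shift_entry[OF n ij] X_def)
  qed (auto simp: row_unipotent_def shift_mat_def b_def u_def)
  have diag: "torus_param n a x $$ (i, i) = (if i = 0 then X 1 else - (X (Suc i) / X i))" if "i < n" for i
    using n that by (auto simp: torus_param_def mat_diag_def X_def)
  then show "diag_char \<chi> n b = diag_char \<chi> n (torus_param n a x)"
    by (auto simp: diag_char_def b_def intro!: prod.cong)
  obtain m where m: "n = Suc m" using n by (cases n) auto
  have "mat_trace (torus_param n a x) = (\<Sum>i<n. if i = 0 then X 1 else - (X (Suc i) / X i))"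
    using diag by (simp add: mat_trace_def torus_param_def mat_diag_def)
  also have "\<dots> = X 1 - (\<Sum>i<m. X (Suc (Suc i)) / X (Suc i))"
    by (simp add: m sum.lessThan_Suc_shift sum_negf del: sum.lessThan_Suc)
  also have "X 1 = x 1" using n by (simp add: X_def)
  \<comment> \<open>The superdiagonal entries of \<open>u\<close> are the negatives of the later
    diagonal entries of \<open>b\<close>; the term \<open>- x 1\<close> will come from the
    conjugated character of \<open>row_unipotent n x\<close>.\<close>
  finally show "- x 1 + (\<Sum>i<n - 1. u $$ (i, Suc i)) = - mat_trace (torus_param n a x)"
    by (simp add: m u_def)
qed

text \<open>A direct form of the vanishing of the \<open>k\<close>-th leading minor. For
  \<open>x k = 0\<close> column \<open>k - 1\<close> has its only nonzero entry in row
  \<open>k\<close>, just below the diagonal. Solving for \<open>u\<close> by the lower triangular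
  inverse of \<open>b\<close> then gives 0 at \<open>(k - 1, k - 1)\<close>, where \<open>u\<close>
  has 1.\<close>

lemma row_unipotent_shift_off:
  fixes a :: "'a::{finite,field}"
  assumes n: "n \<ge> 2" and k: "k \<in> {1..n - 1}" "x k = 0"
    and b: "b \<in> lower_borel n" and u: "u \<in> unipotent n"
  shows "row_unipotent n x * shift_mat n a \<noteq> b * u"
proof
  interpret group "GL n :: 'a mat monoid" by (rule group_GL)
  interpret B: subgroup "lower_borel n" "GL n :: 'a mat monoid" by (rule subgroup_lower_borel)
  let ?M = "row_unipotent n x * shift_mat n a"
  assume M: "?M = b * u"
  define c where "c = inv\<^bsub>GL n\<^esub> b"
  have c: "c \<in> lower_borel n"
    using B.m_inv_closed[OF b] by (simp add: c_def)
  have cb: "c * b = 1\<^sub>m n"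
    using l_inv[OF B.mem_carrier[OF b]] by (simp add: c_def)
  have cc: "c \<in> carrier_mat n n" "b \<in> carrier_mat n n" "u \<in> carrier_mat n n"
    using b c u by (auto simp: lower_borel_iff unipotent_iff)
  have "c * ?M = (c * b) * u"
    unfolding M by (rule assoc_mult_mat[symmetric]) (use cc in auto)
  then have "u = c * ?M"
    using cb cc by simp
  then have "u $$ (k - 1, k - 1) = (\<Sum>l<n. c $$ (k - 1, l) * ?M $$ (l, k - 1))"
    using k cc by (simp only:, intro mat_mult_entry) (auto simp: row_unipotent_def shift_mat_def)
  also have "\<dots> = 0"
  proof (rule sum.neutral, rule ballI)
    fix l assume l: "l \<in> {..<n}"
    have "?M $$ (l, k - 1) = (if l = k then 1 else 0)"
      using row_unipotent_shift_entry[of n l "k - 1" x a] n k l by auto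
    moreover have "c $$ (k - 1, k) = 0"
      using c k by (auto simp: lower_borel_iff)
    ultimately show "c $$ (k - 1, l) * ?M $$ (l, k - 1) = 0" by simp
  qed
  finally show False
    using u k by (auto simp: unipotent_iff)
qed

lemma bessel_function_shift:
  fixes \<psi> :: "'a::{finite,field} \<Rightarrow> complex"
  assumes \<psi>: "additive_character \<psi>" "\<exists>x. \<psi> x \<noteq> 1"
    and \<chi>: "\<And>i. i < n \<Longrightarrow> multiplicative_character (\<chi> i)"
    and n: "n \<ge> 2" and a: "a \<noteq> 0"
  shows "bessel_function \<psi> n (pi_S \<psi> n \<chi>) (right_translation (GL n)) (shift_mat n a) =
    (\<Sum>y\<in>{1..n - 1} \<rightarrow>\<^sub>E {x. x \<noteq> 0}.
       \<psi> (- mat_trace (torus_param n a y)) * diag_char \<chi> n (torus_param n a y)) / of_nat CARD('a) ^ (n - 1)"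
proof -
  interpret group "GL n :: 'a mat monoid" by (rule group_GL)
  interpret U: subgroup "unipotent n" "GL n :: 'a mat monoid" by (rule subgroup_unipotent)
  let ?g = "shift_mat n a"
  let ?X = "{1..n - 1} \<rightarrow>\<^sub>E (UNIV :: 'a set)"
  let ?f = "bessel_vector \<psi> n \<chi>"
  let ?h = "\<lambda>u. cnj (unipotent_char \<psi> n u) * ?f (u * ?g)"
  let ?S = "stable_unipotent n :: 'a mat set"
  have gG: "?g \<in> carrier (GL n)" using a n by (rule shift_mat_GL)
  have unit: "cnj (unipotent_char \<psi> n u) * unipotent_char \<psi> n u = 1" for u
    using norm_additive_character[OF \<psi>(1)] complex_norm_square[of "unipotent_char \<psi> n u"]
    by (simp add: unipotent_char_def mult.commute)
  \<comment> \<open>A stable factor \<open>u\<close> can be pulled through the shift to the right,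
    where it contributes \<open>unipotent_char \<psi> n u\<close>; the conjugate character cancels
    this.\<close>
  have inv: "?h (v * u) = ?h v" if v: "v \<in> unipotent n" and u: "u \<in> ?S" for u v
  proof -
    have uU: "u \<in> unipotent n" using u by (simp add: stable_unipotent_def)
    obtain u' where u': "u' \<in> unipotent n" "u * ?g = ?g * u'" "unipotent_char \<psi> n u' = unipotent_char \<psi> n u"
      using stable_unipotent_shift[OF u n] by blast
    have vg: "v * ?g \<in> carrier (GL n)"
      using m_closed[OF U.mem_carrier[OF v] gG] by simp
    have "v * u * ?g = v * (u * ?g)"
      using v uU by (intro assoc_mult_mat[of _ n n _ n _ n]) (auto simp: unipotent_iff)
    also have "\<dots> = v * ?g * u'"
      unfolding u'(2) using v u' by (intro assoc_mult_mat[of _ n n _ n _ n, symmetric]) (auto simp: unipotent_iff)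
    finally have "?f (v * u * ?g) = unipotent_char \<psi> n u * ?f (v * ?g)"
      using bessel_vector_right[OF \<psi> \<chi> vg u'(1)] u'(3) by simp
    then have "?h (v * u) = cnj (unipotent_char \<psi> n v) * (cnj (unipotent_char \<psi> n u) * unipotent_char \<psi> n u) * ?f (v * ?g)"
      by (simp add: unipotent_char_mult[OF \<psi>(1) v uU])
    then show ?thesis by (simp add: unit)
  qed
  have fin: "finite (unipotent n :: 'a mat set)"
    using finite_subset[OF U.subset finite_GL] .
  have Ssub: "?S \<subseteq> unipotent n" by (auto simp: stable_unipotent_def)
  have "1\<^sub>m n \<in> ?S" by (auto simp: stable_unipotent_def one_mem)
  then have cS: "of_nat (card ?S) \<noteq> (0::complex)"
    using finite_subset[OF Ssub fin] by auto
  have cX: "card ?X = CARD('a) ^ (n - 1)"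
    by (simp add: card_PiE)
  \<comment> \<open>Origin of q^(n-1): the stable part cancels against the sum, and the number of
    first rows remains in the denominator.\<close>
  have cU: "card (unipotent n :: 'a mat set) = CARD('a) ^ (n - 1) * card ?S"
    using bij_betw_same_card[OF unipotent_decomposition[of n, where ?'a = 'a]] cX
    by (simp add: card_cartesian_product)
  have "(\<Sum>u\<in>unipotent n. ?h u) = (\<Sum>(x, u)\<in>?X \<times> ?S. ?h (row_unipotent n x * u))"
    using sum.reindex_bij_betw[OF unipotent_decomposition, of ?h] by (simp add: case_prod_unfold)
  also have "\<dots> = (\<Sum>x\<in>?X. \<Sum>u\<in>?S. ?h (row_unipotent n x))"
    unfolding sum.cartesian_product[symmetric]
    by (intro sum.cong refl inv row_unipotent_mem)
  also have "\<dots> = of_nat (card ?S) * (\<Sum>x\<in>?X. ?h (row_unipotent n x))"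
    by (simp add: sum_distrib_left)
  also have "(\<Sum>x\<in>?X. ?h (row_unipotent n x)) = (\<Sum>x\<in>{1..n - 1} \<rightarrow>\<^sub>E {x. x \<noteq> 0}. ?h (row_unipotent n x))"
  proof (rule sum.mono_neutral_right)
    show "finite ?X" by (intro finite_PiE) auto
    show "{1..n - 1} \<rightarrow>\<^sub>E {x. x \<noteq> 0} \<subseteq> ?X" by (rule PiE_mono) simp
    show "\<forall>x\<in>?X - ({1..n - 1} \<rightarrow>\<^sub>E {x. x \<noteq> 0}). ?h (row_unipotent n x) = 0"
    proof
      fix x assume x: "x \<in> ?X - ({1..n - 1} \<rightarrow>\<^sub>E {x. x \<noteq> 0})"
      then obtain k where "k \<in> {1..n - 1}" "x k = 0"
        by (auto simp: PiE_iff)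
      then have "?f (row_unipotent n x * ?g) = 0"
        using row_unipotent_shift_off[OF n, of k x] by (intro bessel_vector_off[OF \<psi> \<chi>]) blast+
      then show "?h (row_unipotent n x) = 0" by simp
    qed
  qed
  also have "\<dots> = (\<Sum>y\<in>{1..n - 1} \<rightarrow>\<^sub>E {x. x \<noteq> 0}.
       \<psi> (- mat_trace (torus_param n a y)) * diag_char \<chi> n (torus_param n a y))"
  proof (rule sum.cong)
    fix x assume "x \<in> {1..n - 1} \<rightarrow>\<^sub>E {x::'a. x \<noteq> 0}"
    then have "x k \<noteq> 0" if "k \<in> {1..n - 1}" for k
      using that by (auto simp: PiE_iff)
    then obtain b u where bu: "b \<in> lower_borel n" "u \<in> unipotent n"
      "row_unipotent n x * ?g = b * u"
      "diag_char \<chi> n b = diag_char \<chi> n (torus_param n a x)"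
      "- x 1 + (\<Sum>i<n - 1. u $$ (i, Suc i)) = - mat_trace (torus_param n a x)"
      using row_unipotent_shift_factor[OF n a] by blast
    have "(\<Sum>i<n - 1. row_unipotent n x $$ (i, Suc i)) = (\<Sum>i<n - 1. if i = 0 then x 1 else 0)"
      by (intro sum.cong) (auto simp: row_unipotent_def)
    also have "\<dots> = x 1" using n by simp
    finally have "cnj (unipotent_char \<psi> n (row_unipotent n x)) = \<psi> (- x 1)"
      by (simp add: unipotent_char_def cnj_additive_character[OF \<psi>(1)])
    moreover have "?f (row_unipotent n x * ?g) = diag_char \<chi> n (torus_param n a x) * unipotent_char \<psi> n u"
      using bessel_vector_mult[OF \<psi> \<chi> bu(1,2)] bu(3,4) by simp
    moreover have "\<psi> (- x 1) * unipotent_char \<psi> n u = \<psi> (- mat_trace (torus_param n a x))"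
      using \<psi>(1) unfolding unipotent_char_def additive_character_def bu(5)[symmetric] by metis
    ultimately show "?h (row_unipotent n x) =
        \<psi> (- mat_trace (torus_param n a x)) * diag_char \<chi> n (torus_param n a x)"
      by (simp add: mult.assoc mult.left_commute)
  qed simp
  finally show ?thesis
    using cS by (simp add: bessel_function_sum[OF \<psi> \<chi> gG] cU)
qed

section \<open>Characters of the torus and the Curtis homomorphism\<close>

text \<open>Cyclicity of the multiplicative group of a finite field, transferred from record-based
  algebra by putting the type-class operations into a ring record.\<close>

lemma field_generator:
  obtains \<gamma> :: "'a::{finite,field}" where "\<gamma> \<noteq> 0" "\<And>x. x \<noteq> 0 \<Longrightarrow> \<exists>i::nat. x = \<gamma> ^ i"
proof -
  let ?R = "\<lparr>carrier = UNIV, mult = (*), one = 1, zero = 0, add = (+)\<rparr> :: 'a ring"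
  interpret R: cring ?R
  proof (rule cringI)
    show "abelian_group ?R"
      by (rule abelian_groupI) (auto simp: algebra_simps intro: exI[of _ "- x" for x])
    show "Group.comm_monoid ?R"
      by (rule comm_monoidI) (auto simp: algebra_simps)
  qed (auto simp: algebra_simps)
  have "Ring.field ?R"
    by (rule R.cring_fieldI2) (auto, metis right_inverse)
  then obtain \<gamma> :: 'a where \<gamma>: "\<gamma> \<in> carrier (Multiplicative_Group.mult_of ?R)"
    "carrier (Multiplicative_Group.mult_of ?R) = {\<gamma> [^]\<^bsub>?R\<^esub> i | i::nat. i \<in> UNIV}"
    using field.finite_field_mult_group_has_gen[of ?R] by auto
  have "\<gamma> [^]\<^bsub>?R\<^esub> i = \<gamma> ^ i" for i :: nat
    by (induction i) (auto simp: power_commutes)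
  with \<gamma> have nz: "\<gamma> \<noteq> 0" and gen: "UNIV - {0} = {\<gamma> ^ i | i::nat. i \<in> UNIV}"
    by simp_all
  show ?thesis
  proof (rule that[OF nz])
    fix x :: 'a assume "x \<noteq> 0"
    then have "x \<in> UNIV - {0}" by simp
    then show "\<exists>i::nat. x = \<gamma> ^ i"
      unfolding gen by blast
  qed
qed

text \<open>\<open>N\<close> is the order of the generator, found as its least positive period; the
  bijection makes discrete logarithms available.\<close>

lemma field_generator_bij:
  obtains \<gamma> :: "'a::{finite,field}" and N :: nat where "\<gamma> \<noteq> 0" "N > 0" "\<gamma> ^ N = 1"
    "bij_betw (\<lambda>i. \<gamma> ^ i) {..<N} {x. x \<noteq> 0}"
proof -
  obtain \<gamma> :: 'a where \<gamma>: "\<gamma> \<noteq> 0" "\<And>x. x \<noteq> 0 \<Longrightarrow> \<exists>i::nat. x = \<gamma> ^ i"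
    by (rule field_generator) blast
  have "\<not> inj (\<lambda>i::nat. \<gamma> ^ i)"
    using finite_imageD[of "\<lambda>i::nat. \<gamma> ^ i" UNIV] by auto
  then obtain k l :: nat where "\<gamma> ^ k = \<gamma> ^ l" "k < l"
    unfolding inj_def by (metis nat_neq_iff)
  then have "\<gamma> ^ (l - k) = 1" "l - k > 0"
    using \<gamma>(1) by (auto simp: power_diff)
  then have ex: "\<exists>d::nat. d > 0 \<and> \<gamma> ^ d = 1" by blast
  define N where "N = (LEAST d::nat. d > 0 \<and> \<gamma> ^ d = 1)"
  have N: "N > 0" "\<gamma> ^ N = 1"
    using LeastI_ex[OF ex] by (auto simp: N_def)
  have min: "\<gamma> ^ d \<noteq> 1" if "0 < d" "d < N" for d
    using not_less_Least[of d "\<lambda>d. d > 0 \<and> \<gamma> ^ d = 1"] that by (auto simp: N_def)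
  have ne: "\<gamma> ^ i \<noteq> \<gamma> ^ j" if "i < j" "j < N" for i j
    using min[of "j - i"] that \<gamma>(1) less_imp_diff_less[of j N i] by (auto simp: power_diff)
  have "inj_on (\<lambda>i. \<gamma> ^ i) {..<N}"
    by (rule inj_onI) (metis lessThan_iff ne nat_neq_iff)
  moreover have "(\<lambda>i. \<gamma> ^ i) ` {..<N} = {x. x \<noteq> 0}"
  proof
    show "{x. x \<noteq> 0} \<subseteq> (\<lambda>i. \<gamma> ^ i) ` {..<N}"
    proof
      fix x :: 'a assume "x \<in> {x. x \<noteq> 0}"
      then obtain i :: nat where "x = \<gamma> ^ i" using \<gamma>(2) by auto
      also have "\<dots> = \<gamma> ^ (N * (i div N) + i mod N)" by simp
      also have "\<dots> = \<gamma> ^ (i mod N)"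
        using N by (simp only: power_add power_mult) simp
      finally show "x \<in> (\<lambda>i. \<gamma> ^ i) ` {..<N}"
        using N by simp
    qed
  qed (use \<gamma> in auto)
  ultimately show ?thesis
    using that[OF \<gamma>(1) N] by (simp add: bij_betw_def)
qed

text \<open>\<open>ch k\<close> sends the \<open>i\<close>-th power of the generator to the power
  \<open>k * i\<close> of a primitive \<open>N\<close>-th root of unity. This is symmetric in
  \<open>k\<close> and \<open>i\<close>, so both orthogonality relations are the same geometric sum.
  A character is determined by its value at the generator, which is an \<open>N\<close>-th root of
  unity; hence the list is complete.\<close>

lemma character_family:
  obtains N :: nat and ch :: "nat \<Rightarrow> 'a::{finite,field} \<Rightarrow> complex"
  where "N > 0" "\<And>k. multiplicative_character (ch k)"
    "\<And>x y. x \<noteq> 0 \<Longrightarrow> y \<noteq> 0 \<Longrightarrow> (\<Sum>k<N. ch k x * cnj (ch k y)) = (if x = y then of_nat N else 0)"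
    "\<And>k l. k < N \<Longrightarrow> l < N \<Longrightarrow>
       (\<Sum>x\<in>{x. x \<noteq> 0}. ch k x * cnj (ch l x)) = (if k = l then of_nat N else 0)"
    "\<And>\<chi>. multiplicative_character \<chi> \<Longrightarrow> \<exists>k<N. \<forall>x. x \<noteq> 0 \<longrightarrow> \<chi> x = ch k x"
proof -
  obtain \<gamma> :: 'a and N :: nat where \<gamma>: "\<gamma> \<noteq> 0" "N > 0" "\<gamma> ^ N = 1"
    and bij: "bij_betw (\<lambda>i. \<gamma> ^ i) {..<N} {x. x \<noteq> 0}"
    by (rule field_generator_bij)
  define \<zeta> where "\<zeta> = cis (2 * pi / real N)"
  have \<zeta>_pow: "\<zeta> ^ k = cis (2 * pi * real k / real N)" for k
    by (simp add: \<zeta>_def DeMoivre mult_ac)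
  have roots: "bij_betw (\<lambda>k. \<zeta> ^ k) {..<N} {z. z ^ N = 1}"
    unfolding \<zeta>_pow by (rule bij_betw_roots_unity[OF \<gamma>(2)])
  have \<zeta>N: "\<zeta> ^ N = 1"
    unfolding \<zeta>_pow using \<gamma>(2) by simp
  have \<zeta>cnj: "\<zeta> ^ k * cnj (\<zeta> ^ k) = 1" for k
    using complex_norm_square[of "\<zeta> ^ k"] by (simp add: \<zeta>_def norm_power)
  have orth: "(\<Sum>i<N. (\<zeta> ^ k * cnj (\<zeta> ^ l)) ^ i) = (if k = l then of_nat N else 0)"
    if kl: "k < N" "l < N" for k l
  proof (cases "k = l")
    case True
    then show ?thesis by (simp add: \<zeta>cnj del: complex_cnj_power)
  next
    case False
    define w where "w = \<zeta> ^ k * cnj (\<zeta> ^ l)"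
    have "w \<noteq> 1"
    proof
      assume "w = 1"
      then have "\<zeta> ^ k * (\<zeta> ^ l * cnj (\<zeta> ^ l)) = \<zeta> ^ l"
        by (simp add: w_def mult_ac)
      then have "\<zeta> ^ k = \<zeta> ^ l"
        by (simp only: \<zeta>cnj mult_1_right)
      then show False
        using roots kl False by (auto simp: bij_betw_def inj_on_def)
    qed
    moreover have "w ^ N = 1"
    proof -
      have "w ^ N = (\<zeta> ^ N) ^ k * cnj ((\<zeta> ^ N) ^ l)"
        by (simp add: w_def power_mult_distrib power_mult[symmetric] mult.commute)
      then show ?thesis by (simp add: \<zeta>N)
    qed
    ultimately have "(\<Sum>i<N. w ^ i) = 0"
      by (simp add: sum_gp_strict)
    then show ?thesis
      using False by (simp only: w_def if_False)
  qed
  define dlog where "dlog = the_inv_into {..<N} (\<lambda>i. \<gamma> ^ i)"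
  have dlog: "dlog x < N" "\<gamma> ^ dlog x = x" if "x \<noteq> 0" for x
  proof -
    have "dlog x \<in> {..<N}"
      unfolding dlog_def using bij that
      by (intro the_inv_into_into[OF bij_betw_imp_inj_on[OF bij]]) (auto simp: bij_betw_def)
    then show "dlog x < N" by simp
    show "\<gamma> ^ dlog x = x"
      unfolding dlog_def using bij that by (intro f_the_inv_into_f_bij_betw) auto
  qed
  have dlog_pow: "dlog (\<gamma> ^ i) = i" if "i < N" for i
    unfolding dlog_def using bij that by (intro the_inv_into_f_f) (auto simp: bij_betw_def)
  define ch where "ch k x = \<zeta> ^ (k * dlog x)" for k x
  have period: "z ^ (i mod N) = z ^ i" if "z ^ N = 1" for z :: "'b::monoid_mult" and i
    using that by (metis mult_1_left mult_div_mod_eq power_add power_mult power_one)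
  show ?thesis
  proof
    show "N > 0" by fact
    show "multiplicative_character (ch k)" for k
      unfolding multiplicative_character_def
    proof (intro conjI allI impI)
      show "ch k x \<noteq> 0" for x
        by (simp add: ch_def \<zeta>_def)
      fix x y :: 'a assume xy: "x \<noteq> 0" "y \<noteq> 0"
      \<comment> \<open>Discrete logarithms add only modulo \<open>N\<close>; the order of the root
        of unity absorbs the reduction.\<close>
      have "\<gamma> ^ ((dlog x + dlog y) mod N) = x * y"
        using xy by (simp add: period[OF \<gamma>(3)] power_add dlog)
      then have "dlog (x * y) = (dlog x + dlog y) mod N"
        using dlog_pow[of "(dlog x + dlog y) mod N"] \<gamma>(2) by simp
      moreover have "(\<zeta> ^ k) ^ N = 1"
        by (metis \<zeta>N mult.commute power_mult power_one)
      ultimately show "ch k (x * y) = ch k x * ch k y"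
        by (simp add: ch_def power_mult period power_add)
    qed
    show "(\<Sum>k<N. ch k x * cnj (ch k y)) = (if x = y then of_nat N else 0)" if "x \<noteq> 0" "y \<noteq> 0" for x y
    proof -
      have "(\<Sum>k<N. ch k x * cnj (ch k y)) = (\<Sum>k<N. (\<zeta> ^ dlog x * cnj (\<zeta> ^ dlog y)) ^ k)"
        by (simp add: ch_def power_mult_distrib power_mult[symmetric] mult.commute)
      also have "\<dots> = (if dlog x = dlog y then of_nat N else 0)"
        using dlog that by (intro orth)
      also have "dlog x = dlog y \<longleftrightarrow> x = y"
        using dlog that by metis
      finally show ?thesis .
    qed
    show "(\<Sum>x\<in>{x. x \<noteq> 0}. ch k x * cnj (ch l x)) = (if k = l then of_nat N else 0)"
      if "k < N" "l < N" for k l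
    proof -
      have "(\<Sum>x\<in>{x. x \<noteq> 0}. ch k x * cnj (ch l x)) = (\<Sum>i<N. ch k (\<gamma> ^ i) * cnj (ch l (\<gamma> ^ i)))"
        using sum.reindex_bij_betw[OF bij, of "\<lambda>x. ch k x * cnj (ch l x)"] by simp
      also have "\<dots> = (\<Sum>i<N. (\<zeta> ^ k * cnj (\<zeta> ^ l)) ^ i)"
        by (intro sum.cong) (auto simp: ch_def dlog_pow power_mult_distrib power_mult)
      finally show ?thesis
        using orth[OF that] by simp
    qed
    show "\<exists>k<N. \<forall>x. x \<noteq> 0 \<longrightarrow> \<chi> x = ch k x" if \<chi>: "multiplicative_character \<chi>" for \<chi>
    proof -
      have pow: "\<chi> (\<gamma> ^ i) = \<chi> \<gamma> ^ i" for i :: nat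
        using \<chi> \<gamma>(1) by (induction i) (auto simp: multiplicative_character_one multiplicative_character_def)
      have "\<chi> \<gamma> ^ N = 1"
        using pow[of N] \<gamma>(3) \<chi> by (simp add: multiplicative_character_one)
      then have "\<chi> \<gamma> \<in> (\<lambda>k. \<zeta> ^ k) ` {..<N}"
        using bij_betw_imp_surj_on[OF roots] by simp
      then obtain k where k: "k < N" "\<chi> \<gamma> = \<zeta> ^ k"
        by blast
      have "\<chi> x = ch k x" if "x \<noteq> 0" for x
        using pow[of "dlog x"] dlog[OF that] k by (simp add: ch_def power_mult)
      with k show ?thesis by blast
    qed
  qed
qed

lemma sum_diag_torus:
  fixes h :: "nat \<Rightarrow> 'a::{finite,field} \<Rightarrow> complex"
  shows "(\<Sum>t\<in>diag_torus n. \<Prod>i<n. h i (t $$ (i, i))) = (\<Prod>i<n. \<Sum>x\<in>{x. x \<noteq> 0}. h i x)"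
proof -
  have "(\<Prod>i<n. \<Sum>x\<in>{x. x \<noteq> 0}. h i x) = (\<Sum>f\<in>{..<n} \<rightarrow>\<^sub>E {x. x \<noteq> 0}. \<Prod>i<n. h i (f i))"
    by (rule prod_sum_PiE) auto
  also have "\<dots> = (\<Sum>t\<in>diag_torus n. \<Prod>i<n. h i (t $$ (i, i)))"
  proof (rule sum.reindex_bij_witness[of _ "\<lambda>t. restrict (\<lambda>i. t $$ (i, i)) {..<n}" "mat_diag n"])
    fix f assume "f \<in> {..<n} \<rightarrow>\<^sub>E {x::'a. x \<noteq> 0}"
    then show "restrict (\<lambda>i. mat_diag n f $$ (i, i)) {..<n} = f"
      by (auto simp: fun_eq_iff mat_diag_def PiE_def extensional_def)
  next
    fix t :: "'a mat" assume "t \<in> diag_torus n"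
    then show "mat_diag n (restrict (\<lambda>i. t $$ (i, i)) {..<n}) = t"
      by (intro eq_matI) (auto simp: mat_diag_def diag_torus_iff)
  qed (auto simp: mat_diag_def diag_torus_iff PiE_iff)
  finally show ?thesis ..
qed

lemma torus_eqI:
  assumes "s \<in> diag_torus n" "t \<in> diag_torus n" "\<And>i. i < n \<Longrightarrow> s $$ (i, i) = t $$ (i, i)"
  shows "s = t"
  using assms by (intro eq_matI) (auto simp: diag_torus_iff, metis)

lemma finite_diag_torus: "finite (diag_torus n :: 'a::{finite,field} mat set)"
  using finite_subset[OF subgroup.subset[OF subgroup_diag_torus] finite_GL] .

text \<open>Multiplicative characters have an arbitrary value at 0, so \<open>C\<close> indexes one representative
  of each character of the torus.\<close>

lemma torus_orthogonality:
  obtains M :: complex and C :: "(nat \<Rightarrow> nat) set" and X :: "(nat \<Rightarrow> nat) \<Rightarrow> nat \<Rightarrow> 'a::{finite,field} \<Rightarrow> complex"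
  where "M \<noteq> 0" "finite C" "\<And>K i. multiplicative_character (X K i)"
    "\<And>s t. s \<in> diag_torus n \<Longrightarrow> t \<in> diag_torus n \<Longrightarrow>
       (\<Sum>K\<in>C. diag_char (X K) n s * cnj (diag_char (X K) n t)) = (if s = t then M else 0)"
    "\<And>K L. K \<in> C \<Longrightarrow> L \<in> C \<Longrightarrow>
       (\<Sum>t\<in>diag_torus n. diag_char (X K) n t * cnj (diag_char (X L) n t)) = (if K = L then M else 0)"
    "\<And>\<chi>. (\<And>i. i < n \<Longrightarrow> multiplicative_character (\<chi> i)) \<Longrightarrow>
       \<exists>K\<in>C. \<forall>i<n. \<forall>x. x \<noteq> 0 \<longrightarrow> \<chi> i x = X K i x"
proof -
  obtain N :: nat and ch :: "nat \<Rightarrow> 'a \<Rightarrow> complex"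
    where N: "N > 0" and ch: "\<And>k. multiplicative_character (ch k)"
    and o1: "\<And>x y. x \<noteq> 0 \<Longrightarrow> y \<noteq> 0 \<Longrightarrow> (\<Sum>k<N. ch k x * cnj (ch k y)) = (if x = y then of_nat N else 0)"
    and o2: "\<And>k l. k < N \<Longrightarrow> l < N \<Longrightarrow>
       (\<Sum>x\<in>{x. x \<noteq> 0}. ch k x * cnj (ch l x)) = (if k = l then of_nat N else 0)"
    and all: "\<And>\<chi>. multiplicative_character \<chi> \<Longrightarrow> \<exists>k<N. \<forall>x. x \<noteq> 0 \<longrightarrow> \<chi> x = ch k x"
    using character_family[where ?'a = 'a] by blast
  \<comment> \<open>Extensional index functions: distinct members differ at some index below
    \<open>n\<close>, as the second orthogonality relation requires.\<close>
  define C where "C = {..<n} \<rightarrow>\<^sub>E {..<N}"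
  define X where "X K i = ch (K i)" for K :: "nat \<Rightarrow> nat" and i
  have expand: "diag_char (X K) n s * cnj (diag_char (X L) n t) =
      (\<Prod>i<n. ch (K i) (s $$ (i, i)) * cnj (ch (L i) (t $$ (i, i))))" for K L s t
    by (simp add: diag_char_def X_def prod.distrib)
  show ?thesis
  proof
    show "of_nat N ^ n \<noteq> (0::complex)" using N by simp
    show "finite C" by (auto simp: C_def intro: finite_PiE)
    show "multiplicative_character (X K i)" for K i
      by (simp add: X_def ch)
    fix s t :: "'a mat" assume st: "s \<in> diag_torus n" "t \<in> diag_torus n"
    have "(\<Sum>K\<in>C. diag_char (X K) n s * cnj (diag_char (X K) n t)) =
        (\<Prod>i<n. \<Sum>k<N. ch k (s $$ (i, i)) * cnj (ch k (t $$ (i, i))))"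
      unfolding expand C_def by (rule prod_sum_PiE[symmetric]) auto
    also have "\<dots> = (\<Prod>i<n. if s $$ (i, i) = t $$ (i, i) then of_nat N else 0)"
      using st by (intro prod.cong refl o1) (auto simp: diag_torus_iff)
    also have "\<dots> = (if s = t then of_nat N ^ n else 0)"
    proof (cases "s = t")
      case False
      then obtain i where "i < n" "s $$ (i, i) \<noteq> t $$ (i, i)"
        using torus_eqI[OF st] by blast
      with False show ?thesis by (auto intro!: prod_zero)
    qed simp
    finally show "(\<Sum>K\<in>C. diag_char (X K) n s * cnj (diag_char (X K) n t)) = (if s = t then of_nat N ^ n else 0)" .
  next
    fix K L assume KL: "K \<in> C" "L \<in> C"
    have "(\<Sum>t\<in>diag_torus n. diag_char (X K) n t * cnj (diag_char (X L) n t)) =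
        (\<Prod>i<n. \<Sum>x\<in>{x. x \<noteq> 0}. ch (K i) x * cnj (ch (L i) x))"
      unfolding expand by (rule sum_diag_torus)
    also have "\<dots> = (\<Prod>i<n. if K i = L i then of_nat N else 0)"
      using KL by (intro prod.cong refl o2) (auto simp: C_def)
    also have "\<dots> = (if K = L then of_nat N ^ n else 0)"
    proof (cases "K = L")
      case False
      then obtain i where "i < n" "K i \<noteq> L i"
        using PiE_ext[OF KL[unfolded C_def]] by blast
      with False show ?thesis by (auto intro!: prod_zero)
    qed simp
    finally show "(\<Sum>t\<in>diag_torus n. diag_char (X K) n t * cnj (diag_char (X L) n t)) =
        (if K = L then of_nat N ^ n else 0)" .
  next
    fix \<chi> :: "nat \<Rightarrow> 'a \<Rightarrow> complex"
    assume "\<And>i. i < n \<Longrightarrow> multiplicative_character (\<chi> i)"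
    then have "\<forall>i. \<exists>k. i < n \<longrightarrow> k < N \<and> (\<forall>x. x \<noteq> 0 \<longrightarrow> \<chi> i x = ch k x)"
      using all by blast
    then obtain K where "\<And>i. i < n \<Longrightarrow> K i < N \<and> (\<forall>x. x \<noteq> 0 \<longrightarrow> \<chi> i x = ch (K i) x)"
      by metis
    then show "\<exists>K\<in>C. \<forall>i<n. \<forall>x. x \<noteq> 0 \<longrightarrow> \<chi> i x = X K i x"
      by (intro bexI[of _ "restrict K {..<n}"]) (auto simp: X_def C_def)
  qed
qed

section \<open>Fourier analysis on the torus and existence of the Curtis homomorphism\<close>

lemma diag_char_cong:
  assumes "\<And>i x. i < n \<Longrightarrow> x \<noteq> 0 \<Longrightarrow> \<chi> i x = \<chi>' i x" "t \<in> diag_torus n"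
  shows "diag_char \<chi> n t = diag_char \<chi>' n t"
  using assms by (auto simp: diag_char_def diag_torus_iff intro!: prod.cong)

text \<open>Fourier inversion: summing \<open>chi_hat\<close> against conjugate characters recovers
  each coefficient up to the nonzero factor \<open>M\<close>.\<close>

lemma chi_hat_inject:
  fixes c d :: "'a::{finite,field} mat \<Rightarrow> complex"
  assumes eq: "\<And>\<chi>. (\<And>i. i < n \<Longrightarrow> multiplicative_character (\<chi> i)) \<Longrightarrow> chi_hat n \<chi> c = chi_hat n \<chi> d"
    and t: "t \<in> diag_torus n"
  shows "c t = d t"
proof -
  obtain M C and X :: "(nat \<Rightarrow> nat) \<Rightarrow> nat \<Rightarrow> 'a \<Rightarrow> complex"
    where M: "M \<noteq> (0::complex)" and C: "finite C"
    and X: "\<And>K i. multiplicative_character (X K i)"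
    and orth: "\<And>s t. s \<in> diag_torus n \<Longrightarrow> t \<in> diag_torus n \<Longrightarrow>
       (\<Sum>K\<in>C. diag_char (X K) n s * cnj (diag_char (X K) n t)) = (if s = t then M else 0)"
    and dual_orth: "\<And>K L. K \<in> C \<Longrightarrow> L \<in> C \<Longrightarrow>
       (\<Sum>t\<in>diag_torus n. diag_char (X K) n t * cnj (diag_char (X L) n t)) = (if K = L then M else 0)"
    and all: "\<And>\<chi>. (\<And>i. i < n \<Longrightarrow> multiplicative_character (\<chi> i)) \<Longrightarrow>
       \<exists>K\<in>C. \<forall>i<n. \<forall>x. x \<noteq> 0 \<longrightarrow> \<chi> i x = X K i x"
    by (rule torus_orthogonality) blast
  have inv: "(\<Sum>K\<in>C. chi_hat n (X K) c * cnj (diag_char (X K) n t)) = M * c t" for c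
  proof -
    have "(\<Sum>K\<in>C. chi_hat n (X K) c * cnj (diag_char (X K) n t)) =
        (\<Sum>K\<in>C. \<Sum>s\<in>diag_torus n. c s * (diag_char (X K) n s * cnj (diag_char (X K) n t)))"
      by (simp add: chi_hat_def sum_distrib_right mult.assoc)
    also have "\<dots> = (\<Sum>s\<in>diag_torus n. c s * (\<Sum>K\<in>C. diag_char (X K) n s * cnj (diag_char (X K) n t)))"
      by (subst sum.swap) (simp add: sum_distrib_left)
    also have "\<dots> = (\<Sum>s\<in>diag_torus n. if s = t then M * c t else 0)"
      by (intro sum.cong) (auto simp: orth t)
    also have "\<dots> = M * c t"
      using t by (simp add: sum.delta finite_diag_torus)
    finally show ?thesis .
  qed
  have "chi_hat n (X K) c = chi_hat n (X K) d" for K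
    by (rule eq) (rule X)
  then have "M * c t = M * d t"
    unfolding inv[symmetric] by simp
  then show ?thesis using M by simp
qed

text \<open>Fourier synthesis, the converse of \<open>chi_hat_inject\<close>. The congruence
  hypothesis is needed to pass from the representatives indexed by \<open>C\<close> to functions
  with other values at 0 or at indices from \<open>n\<close> on.\<close>

lemma chi_hat_interpolate:
  fixes f :: "(nat \<Rightarrow> 'a::{finite,field} \<Rightarrow> complex) \<Rightarrow> complex"
  assumes cong: "\<And>\<chi> \<chi>'. (\<And>i x. i < n \<Longrightarrow> x \<noteq> 0 \<Longrightarrow> \<chi> i x = \<chi>' i x) \<Longrightarrow> f \<chi> = f \<chi>'"
  obtains c where "\<And>t. t \<notin> diag_torus n \<Longrightarrow> c t = 0"
    "\<And>\<chi>. (\<And>i. i < n \<Longrightarrow> multiplicative_character (\<chi> i)) \<Longrightarrow> chi_hat n \<chi> c = f \<chi>"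
proof -
  obtain M C and X :: "(nat \<Rightarrow> nat) \<Rightarrow> nat \<Rightarrow> 'a \<Rightarrow> complex"
    where M: "M \<noteq> (0::complex)" and C: "finite C"
    and X: "\<And>K i. multiplicative_character (X K i)"
    and orth: "\<And>s t. s \<in> diag_torus n \<Longrightarrow> t \<in> diag_torus n \<Longrightarrow>
       (\<Sum>K\<in>C. diag_char (X K) n s * cnj (diag_char (X K) n t)) = (if s = t then M else 0)"
    and dual_orth: "\<And>K L. K \<in> C \<Longrightarrow> L \<in> C \<Longrightarrow>
       (\<Sum>t\<in>diag_torus n. diag_char (X K) n t * cnj (diag_char (X L) n t)) = (if K = L then M else 0)"
    and all: "\<And>\<chi>. (\<And>i. i < n \<Longrightarrow> multiplicative_character (\<chi> i)) \<Longrightarrow>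
       \<exists>K\<in>C. \<forall>i<n. \<forall>x. x \<noteq> 0 \<longrightarrow> \<chi> i x = X K i x"
    by (rule torus_orthogonality) blast
  define c where "c t = (if t \<in> diag_torus n then (\<Sum>L\<in>C. f (X L) * cnj (diag_char (X L) n t)) / M else 0)" for t
  have c: "chi_hat n (X K) c = f (X K)" if K: "K \<in> C" for K
  proof -
    have "chi_hat n (X K) c =
        (\<Sum>t\<in>diag_torus n. \<Sum>L\<in>C. f (X L) * (diag_char (X K) n t * cnj (diag_char (X L) n t))) / M"
      by (simp add: chi_hat_def c_def sum_divide_distrib sum_distrib_left mult_ac)
    also have "\<dots> = (\<Sum>L\<in>C. f (X L) * (\<Sum>t\<in>diag_torus n. diag_char (X K) n t * cnj (diag_char (X L) n t))) / M"
      by (subst sum.swap) (simp add: sum_distrib_left)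
    also have "\<dots> = (\<Sum>L\<in>C. if L = K then f (X K) * M else 0) / M"
      by (intro arg_cong[where f = "\<lambda>x. x / M"] sum.cong) (auto simp: dual_orth K)
    also have "\<dots> = f (X K)"
      using K C M by (simp add: sum.delta)
    finally show ?thesis .
  qed
  show ?thesis
  proof
    show "c t = 0" if "t \<notin> diag_torus n" for t
      using that by (simp add: c_def)
    fix \<chi> :: "nat \<Rightarrow> 'a \<Rightarrow> complex"
    assume "\<And>i. i < n \<Longrightarrow> multiplicative_character (\<chi> i)"
    then obtain K where K: "K \<in> C" "\<And>i x. i < n \<Longrightarrow> x \<noteq> 0 \<Longrightarrow> \<chi> i x = X K i x"
      using all by metis
    have "chi_hat n \<chi> c = chi_hat n (X K) c"
      unfolding chi_hat_def using diag_char_cong[of n \<chi> "X K", OF K(2)] by (intro sum.cong) auto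
    then show "chi_hat n \<chi> c = f \<chi>"
      using c[OF K(1)] cong[OF K(2)] by simp
  qed
qed

lemma chi_hat_mult:
  fixes c d :: "'a::{finite,field} mat \<Rightarrow> complex"
  assumes \<chi>: "\<And>i. i < n \<Longrightarrow> multiplicative_character (\<chi> i)"
  shows "chi_hat n \<chi> (c \<otimes>\<^bsub>group_algebra (torus_group n)\<^esub> d) = chi_hat n \<chi> c * chi_hat n \<chi> d"
proof -
  interpret T: group "torus_group n :: 'a mat monoid"
    unfolding torus_group_def
    by (rule subgroup.subgroup_is_group[OF subgroup_diag_torus group_GL])
  have carr [simp]: "carrier (torus_group n) = (diag_torus n :: 'a mat set)"
    and mult [simp]: "\<And>x y :: 'a mat. x \<otimes>\<^bsub>torus_group n\<^esub> y = x * y"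
    by (simp_all add: torus_group_def)
  let ?T = "diag_torus n :: 'a mat set"
  let ?\<chi> = "diag_char \<chi> n"
  let ?inv = "\<lambda>y. inv\<^bsub>torus_group n\<^esub> y :: 'a mat"
  have "chi_hat n \<chi> (c \<otimes>\<^bsub>group_algebra (torus_group n)\<^esub> d) =
      (\<Sum>x\<in>?T. \<Sum>y\<in>?T. c y * d (?inv y * x) * ?\<chi> x)"
    by (simp add: chi_hat_def group_algebra_def sum_distrib_right)
  also have "\<dots> = (\<Sum>y\<in>?T. \<Sum>x\<in>?T. c y * d (?inv y * x) * ?\<chi> x)"
    by (rule sum.swap)
  also have "\<dots> = (\<Sum>y\<in>?T. c y * ?\<chi> y * (\<Sum>x\<in>?T. d x * ?\<chi> x))"
  proof (rule sum.cong)
    fix y :: "'a mat" assume y: "y \<in> ?T"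
    have "(\<Sum>x\<in>?T. c y * d (?inv y * x) * ?\<chi> x) = (\<Sum>x\<in>?T. c y * d (?inv y * (y * x)) * ?\<chi> (y * x))"
      using T.sum_mult_left[of y "\<lambda>x. c y * d (?inv y * x) * ?\<chi> x"] y by simp
    also have "\<dots> = (\<Sum>x\<in>?T. c y * ?\<chi> y * (d x * ?\<chi> x))"
    proof (rule sum.cong)
      fix x :: "'a mat" assume x: "x \<in> ?T"
      have "?inv y * (y * x) = x"
        using T.m_assoc[of "?inv y" y x] T.l_inv[of y] T.inv_closed[of y] T.l_one[of x] x y by simp
      moreover have "?\<chi> (y * x) = ?\<chi> y * ?\<chi> x"
        using x y diag_torus_subset by (intro diag_char_mult[OF \<chi>]) auto
      ultimately show "c y * d (?inv y * (y * x)) * ?\<chi> (y * x) = c y * ?\<chi> y * (d x * ?\<chi> x)"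
        by simp
    qed simp
    finally show "(\<Sum>x\<in>?T. c y * d (?inv y * x) * ?\<chi> x) = c y * ?\<chi> y * (\<Sum>x\<in>?T. d x * ?\<chi> x)"
      by (simp add: sum_distrib_left)
  qed simp
  also have "\<dots> = chi_hat n \<chi> c * chi_hat n \<chi> d"
    by (simp add: chi_hat_def sum_distrib_right)
  finally show ?thesis .
qed

text \<open>\<open>curtis_hom\<close> is a Hilbert choice, so a witness is needed. For each
  \<open>c\<close> the function with prescribed transform \<open>f_T_chi \<psi> n \<chi> c\<close>
  is interpolated. The resulting map respects all operations because its composite with every
  \<open>chi_hat n \<chi>\<close> does and these separate points.\<close>

lemma chi_hat_curtis_hom:
  fixes \<psi> :: "'a::{finite,field} \<Rightarrow> complex"
  assumes \<psi>: "additive_character \<psi>" "\<exists>x. \<psi> x \<noteq> 1"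
    and \<chi>: "\<And>i. i < n \<Longrightarrow> multiplicative_character (\<chi> i)"
    and c: "c \<in> carrier (hecke_algebra \<psi> n)"
  shows "chi_hat n \<chi> (curtis_hom \<psi> n c) = f_T_chi \<psi> n \<chi> c"
proof -
  let ?H = "hecke_algebra \<psi> n" and ?A = "group_algebra (torus_group n :: 'a mat monoid)"
  have carrA: "carrier ?A = {c. \<forall>x. x \<notin> diag_torus n \<longrightarrow> c x = 0}"
    by (simp add: group_algebra_def torus_group_def)
  have "\<exists>d. (\<forall>t. t \<notin> diag_torus n \<longrightarrow> d t = 0) \<and>
      (\<forall>\<chi>. (\<forall>i<n. multiplicative_character (\<chi> i)) \<longrightarrow> chi_hat n \<chi> d = f_T_chi \<psi> n \<chi> c)" for c
  proof -
    obtain d where "\<And>t. t \<notin> diag_torus n \<Longrightarrow> d t = 0"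
      "\<And>\<chi>. (\<And>i. i < n \<Longrightarrow> multiplicative_character (\<chi> i)) \<Longrightarrow> chi_hat n \<chi> d = f_T_chi \<psi> n \<chi> c"
    proof (rule chi_hat_interpolate[of n "\<lambda>\<chi>. f_T_chi \<psi> n \<chi> c"])
      show "f_T_chi \<psi> n \<chi> c = f_T_chi \<psi> n \<chi>' c"
        if "\<And>i x. i < n \<Longrightarrow> x \<noteq> 0 \<Longrightarrow> \<chi> i x = \<chi>' i x" for \<chi> \<chi>'
        using f_T_chi_cong[of n \<chi> \<chi>' \<psi>, OF that] by simp
    qed blast
    then show ?thesis by blast
  qed
  then have "\<forall>c. \<exists>d. (\<forall>t. t \<notin> diag_torus n \<longrightarrow> d t = 0) \<and>
      (\<forall>\<chi>. (\<forall>i<n. multiplicative_character (\<chi> i)) \<longrightarrow> chi_hat n \<chi> d = f_T_chi \<psi> n \<chi> c)"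
    by (rule allI)
  from choice[OF this] obtain F where F': "\<forall>c. (\<forall>t. t \<notin> diag_torus n \<longrightarrow> F c t = 0) \<and>
      (\<forall>\<chi>. (\<forall>i<n. multiplicative_character (\<chi> i)) \<longrightarrow> chi_hat n \<chi> (F c) = f_T_chi \<psi> n \<chi> c)"
    by (rule exE)
  have F0: "F c t = 0" if "t \<notin> diag_torus n" for c t
    using F' that by blast
  have F: "chi_hat n \<chi> (F c) = f_T_chi \<psi> n \<chi> c" if "\<And>i. i < n \<Longrightarrow> multiplicative_character (\<chi> i)" for c \<chi>
    using F' that by blast
  \<comment> \<open>Every algebra law for \<open>F\<close> below is checked through this separation
    of points, one character at a time.\<close>
  have eqI: "d = d'" if "d \<in> carrier ?A" "d' \<in> carrier ?A"
    "\<And>\<chi>. (\<And>i. i < n \<Longrightarrow> multiplicative_character (\<chi> i)) \<Longrightarrow> chi_hat n \<chi> d = chi_hat n \<chi> d'" for d d'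
  proof
    show "d t = d' t" for t
      using that chi_hat_inject[of n d d' t] by (cases "t \<in> diag_torus n") (auto simp: carrA)
  qed
  have FA: "F c \<in> carrier ?A" for c
    using F0 by (simp add: carrA)
  have hom: "f_T_chi \<psi> n \<chi> \<in> alg_hom ?H complex_algebra"
    if "\<And>i. i < n \<Longrightarrow> multiplicative_character (\<chi> i)" for \<chi>
    using f_T_chi_props[where \<chi> = \<chi>, OF \<psi> that] by blast
  have "F \<in> alg_hom ?H ?A"
    unfolding alg_hom_def
  proof (intro CollectI conjI ring_hom_memI allI ballI)
    fix x y assume xy: "x \<in> carrier ?H" "y \<in> carrier ?H"
    show "F (x \<otimes>\<^bsub>?H\<^esub> y) = F x \<otimes>\<^bsub>?A\<^esub> F y"
    proof (rule eqI)
      show "F x \<otimes>\<^bsub>?A\<^esub> F y \<in> carrier ?A"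
        by (auto simp: group_algebra_def)
      fix \<chi> :: "nat \<Rightarrow> 'a \<Rightarrow> complex"
      assume \<chi>: "\<And>i. i < n \<Longrightarrow> multiplicative_character (\<chi> i)"
      show "chi_hat n \<chi> (F (x \<otimes>\<^bsub>?H\<^esub> y)) = chi_hat n \<chi> (F x \<otimes>\<^bsub>?A\<^esub> F y)"
        using hom[OF \<chi>] xy ring_hom_mult[of "f_T_chi \<psi> n \<chi>" ?H complex_algebra x y]
        by (simp add: chi_hat_mult[OF \<chi>] F[OF \<chi>] alg_hom_def complex_algebra_def)
    qed (rule FA)
    show "F (x \<oplus>\<^bsub>?H\<^esub> y) = F x \<oplus>\<^bsub>?A\<^esub> F y"
    proof (rule eqI)
      show "F x \<oplus>\<^bsub>?A\<^esub> F y \<in> carrier ?A"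
        using FA[of x] FA[of y] by (auto simp: group_algebra_def)
      fix \<chi> :: "nat \<Rightarrow> 'a \<Rightarrow> complex"
      assume \<chi>: "\<And>i. i < n \<Longrightarrow> multiplicative_character (\<chi> i)"
      have "chi_hat n \<chi> (F x \<oplus>\<^bsub>?A\<^esub> F y) = chi_hat n \<chi> (F x) + chi_hat n \<chi> (F y)"
        by (simp add: chi_hat_def group_algebra_def sum.distrib algebra_simps)
      then show "chi_hat n \<chi> (F (x \<oplus>\<^bsub>?H\<^esub> y)) = chi_hat n \<chi> (F x \<oplus>\<^bsub>?A\<^esub> F y)"
        using hom[OF \<chi>] xy ring_hom_add[of "f_T_chi \<psi> n \<chi>" ?H complex_algebra x y]
        by (simp add: F[OF \<chi>] alg_hom_def complex_algebra_def)
    qed (rule FA)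
  next
    show "F \<one>\<^bsub>?H\<^esub> = \<one>\<^bsub>?A\<^esub>"
    proof (rule eqI)
      show "\<one>\<^bsub>?A\<^esub> \<in> carrier ?A"
        by (auto simp: carrA) (auto simp: group_algebra_def torus_group_def one_mem)
      fix \<chi> :: "nat \<Rightarrow> 'a \<Rightarrow> complex"
      assume \<chi>: "\<And>i. i < n \<Longrightarrow> multiplicative_character (\<chi> i)"
      have "chi_hat n \<chi> \<one>\<^bsub>?A\<^esub> = (\<Sum>t\<in>(diag_torus n :: 'a mat set). if t = 1\<^sub>m n then diag_char \<chi> n (1\<^sub>m n) else 0)"
        by (simp add: chi_hat_def group_algebra_def torus_group_def if_distrib[of "\<lambda>x. x * _"] sum.delta
            finite_diag_torus one_mem cong: if_cong)
      also have "\<dots> = 1"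
        using one_mem \<chi> by (simp add: sum.delta finite_diag_torus diag_char_def multiplicative_character_one)
      finally show "chi_hat n \<chi> (F \<one>\<^bsub>?H\<^esub>) = chi_hat n \<chi> \<one>\<^bsub>?A\<^esub>"
        using hom[OF \<chi>] ring_hom_one[of "f_T_chi \<psi> n \<chi>" ?H complex_algebra]
        by (simp add: F[OF \<chi>] alg_hom_def complex_algebra_def)
    qed (rule FA)
  next
    fix a x assume x: "x \<in> carrier ?H"
    show "F (a \<odot>\<^bsub>?H\<^esub> x) = a \<odot>\<^bsub>?A\<^esub> F x"
    proof (rule eqI)
      show "a \<odot>\<^bsub>?A\<^esub> F x \<in> carrier ?A"
        using FA[of x] by (auto simp: group_algebra_def cscale_def)
      fix \<chi> :: "nat \<Rightarrow> 'a \<Rightarrow> complex"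
      assume \<chi>: "\<And>i. i < n \<Longrightarrow> multiplicative_character (\<chi> i)"
      have "chi_hat n \<chi> (a \<odot>\<^bsub>?A\<^esub> F x) = a * chi_hat n \<chi> (F x)"
        by (simp add: chi_hat_def group_algebra_def cscale_def sum_distrib_left mult.assoc)
      then show "chi_hat n \<chi> (F (a \<odot>\<^bsub>?H\<^esub> x)) = chi_hat n \<chi> (a \<odot>\<^bsub>?A\<^esub> F x)"
        using hom[OF \<chi>] x by (simp add: F[OF \<chi>] alg_hom_def complex_algebra_def)
    qed (rule FA)
  qed (rule FA)
  let ?P = "\<lambda>F. F \<in> alg_hom ?H ?A \<and> (\<forall>\<chi>. (\<forall>i<n. multiplicative_character (\<chi> i)) \<longrightarrow>
      (\<forall>c\<in>carrier ?H. chi_hat n \<chi> (F c) = f_T_chi \<psi> n \<chi> c))"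
  from \<open>F \<in> alg_hom ?H ?A\<close> have "?P F"
    using F by blast
  then have "?P (curtis_hom \<psi> n)"
    unfolding curtis_hom_def by (rule someI[of ?P])
  then show ?thesis using \<chi> c by blast
qed

section \<open>Parametrization of torus elements with fixed determinant\<close>

lemma torus_param_entry:
  "n \<ge> 2 \<Longrightarrow> i < n \<Longrightarrow>
     torus_param n a y $$ (i, i) = (if i = 0 then y 1 else - ((y(n := a)) (Suc i) / y i))"
  by (auto simp: torus_param_def mat_diag_def)

text \<open>The product telescopes. With \<open>y(n := a)\<close> the case \<open>m = n - 1\<close>
  is the determinant.\<close>

lemma torus_param_partial_prod:
  assumes "n \<ge> 2" "\<And>k. k \<in> {1..n - 1} \<Longrightarrow> y k \<noteq> 0" "m < n"
  shows "(\<Prod>i<Suc m. torus_param n a y $$ (i, i)) = (- 1) ^ m * (y(n := a)) (Suc m)"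
  using assms(3)
proof (induction m)
  case 0
  then show ?case using assms(1) by (simp add: torus_param_entry)
next
  case (Suc m)
  have "(\<Prod>i<Suc (Suc m). torus_param n a y $$ (i, i)) =
      (- 1) ^ m * (y(n := a)) (Suc m) * torus_param n a y $$ (Suc m, Suc m)"
    using Suc by simp
  also have "\<dots> = (- 1) ^ Suc m * (y(n := a)) (Suc (Suc m))"
    using Suc.prems assms(1) assms(2)[of "Suc m"] by (simp add: torus_param_entry)
  finally show ?case .
qed

lemma det_diag_torus: "t \<in> diag_torus n \<Longrightarrow> det t = (\<Prod>i<n. t $$ (i, i))"
  by (intro det_lower_triangular_prod) (auto simp: diag_torus_iff)

text \<open>The inverse recovers y_k as the signed product of the first k diagonal entries; the
  determinant condition says that the same formula at k = n returns \<open>a\<close>.\<close>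

lemma bij_betw_torus_param:
  fixes a :: "'a::field"
  assumes n: "n \<ge> 2" and a: "a \<noteq> 0"
  shows "bij_betw (torus_param n a) ({1..n - 1} \<rightarrow>\<^sub>E {x. x \<noteq> 0})
       {t \<in> diag_torus n. det t = (- 1) ^ (n - 1) * a}"
proof (rule bij_betw_byWitness[where
      f' = "\<lambda>t. restrict (\<lambda>k. (- 1) ^ (k - 1) * (\<Prod>i<k. t $$ (i, i))) {1..n - 1}"])
  let ?Y = "{1..n - 1} \<rightarrow>\<^sub>E {x::'a. x \<noteq> 0}"
  let ?D = "{t \<in> diag_torus n. det t = (- 1) ^ (n - 1) * a}"
  let ?f = "\<lambda>t. restrict (\<lambda>k. (- 1) ^ (k - 1) * (\<Prod>i<k. t $$ (i, i))) {1..n - 1}"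
  have sq: "(- 1) ^ k * ((- 1) ^ k * z) = z" for k and z :: 'a
    by (simp add: mult.assoc[symmetric] power_mult_distrib[symmetric])
  show "\<forall>y\<in>?Y. ?f (torus_param n a y) = y"
  proof
    fix y assume y: "y \<in> ?Y"
    show "?f (torus_param n a y) = y"
    proof
      fix k
      show "?f (torus_param n a y) k = y k"
      proof (cases "k \<in> {1..n - 1}")
        case True
        then obtain m where m: "k = Suc m" "m < n" "Suc m \<noteq> n" by (cases k) auto
        have "(\<Prod>i<Suc m. torus_param n a y $$ (i, i)) = (- 1) ^ m * (y(n := a)) (Suc m)"
          using y n m by (intro torus_param_partial_prod) auto
        then show ?thesis
          using True m sq by (simp del: prod.lessThan_Suc)
      next
        case False
        then show ?thesis
          using y by (auto simp: PiE_def extensional_def)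
      qed
    qed
  qed
  show "torus_param n a ` ?Y \<subseteq> ?D"
  proof clarify
    fix y assume y: "y \<in> ?Y"
    then have nz: "y k \<noteq> 0" if "k \<in> {1..n - 1}" for k
      using that by auto
    have T: "torus_param n a y \<in> diag_torus n"
      unfolding diag_torus_iff
    proof (intro conjI allI impI)
      fix i assume i: "i < n"
      show "torus_param n a y $$ (i, i) \<noteq> 0"
        using i n a nz[of 1] nz[of i] nz[of "Suc i"] by (auto simp: torus_param_entry)
    qed (auto simp: torus_param_def mat_diag_def)
    moreover have "det (torus_param n a y) = (- 1) ^ (n - 1) * a"
      using det_diag_torus[OF T] torus_param_partial_prod[OF n nz, where m = "n - 1" and a = a] n
      by (simp del: prod.lessThan_Suc)
    ultimately show "torus_param n a y \<in> diag_torus n \<and> det (torus_param n a y) = (- 1) ^ (n - 1) * a"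
      by blast
  qed
  show "?f ` ?D \<subseteq> ?Y"
    by (auto simp: diag_torus_iff PiE_iff)
  show "\<forall>t\<in>?D. torus_param n a (?f t) = t"
  proof clarify
    fix t :: "'a mat" assume t: "t \<in> diag_torus n" and d: "det t = (- 1) ^ (n - 1) * a"
    have nz: "t $$ (i, i) \<noteq> 0" if "i < n" for i
      using t that by (simp add: diag_torus_iff)
    define y where "y = ?f t"
    have Y: "(y(n := a)) (Suc k) = (- 1) ^ k * (\<Prod>i<Suc k. t $$ (i, i))" if "k < n" for k
    \<comment> \<open>At \<open>Suc k = n\<close> the coordinate is \<open>a\<close> by the update
      rather than a partial product, so the determinant condition has to supply the formula.\<close>
    proof (cases "Suc k = n")
      case True
      then have "det t = (- 1) ^ k * a"
        using d by auto
      then have "(\<Prod>i<Suc k. t $$ (i, i)) = (- 1) ^ k * a"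
        using det_diag_torus[OF t] unfolding True by (rule trans[OF sym, rotated])
      then show ?thesis
        using True sq[of k a] by simp
    next
      case False
      then have "Suc k \<in> {1..n - 1}" using that by auto
      with False show ?thesis by (simp add: y_def)
    qed
    show "torus_param n a y = t"
    proof (rule eq_matI)
      fix i j assume "i < dim_row t" "j < dim_col t"
      then have ij: "i < n" "j < n" using t by (auto simp: diag_torus_iff)
      show "torus_param n a y $$ (i, j) = t $$ (i, j)"
      proof (cases "i = j")
        case False
        then show ?thesis
          using ij t by (simp add: torus_param_def mat_diag_def diag_torus_iff)
      next
        case True
        show ?thesis
        proof (cases i)
          case 0
          then show ?thesis
            using True n Y[of 0] by (simp add: torus_param_entry)
        next
          case (Suc l)
          have "y i = (- 1) ^ l * (\<Prod>i<Suc l. t $$ (i, i))"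
            using Y[of l] Suc ij by simp
          moreover have "(y(n := a)) (Suc i) = - ((- 1) ^ l * (\<Prod>i<Suc l. t $$ (i, i)) * t $$ (i, i))"
            using Y[of i] Suc ij by simp
          moreover have "(- 1) ^ l * (\<Prod>i<Suc l. t $$ (i, i)) \<noteq> 0"
            using nz Suc ij by auto
          ultimately show ?thesis
            using True Suc ij n by (simp add: torus_param_entry del: prod.lessThan_Suc fun_upd_apply)
        qed
      qed
    qed (use t in \<open>auto simp: torus_param_def mat_diag_def diag_torus_iff\<close>)
  qed
qed

section \<open>The trace and the Gelfand-Tsetlin diagram\<close>

lemma torus_param_trace:
  fixes a :: "'a::field"
  assumes "n \<ge> 2"
  shows "- (y 1 / 1) + (\<Sum>j = 2..n - 1. y j / y (j - 1)) + a / y (n - 1) =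
     - mat_trace (torus_param n a y)"
proof -
  obtain m where m: "n = Suc (Suc m)"
    using assms by (metis Suc_le_D numeral_2_eq_2 Suc_le_mono)
  have "mat_trace (torus_param n a y) =
      (\<Sum>i<n. if i = 0 then y 1 else - ((y(n := a)) (Suc i) / y i))"
    using torus_param_entry[OF assms, of _ a y] by (simp add: mat_trace_def torus_param_def mat_diag_def)
  also have "\<dots> = y 1 + (\<Sum>i<Suc m. - ((y(n := a)) (Suc (Suc i)) / y (Suc i)))"
    unfolding m by (subst sum.lessThan_Suc_shift) simp
  also have "(\<Sum>i<Suc m. - ((y(n := a)) (Suc (Suc i)) / y (Suc i))) =
      (\<Sum>i<m. - (y (Suc (Suc i)) / y (Suc i))) - a / y (Suc m)"
    by (simp add: m)
  also have "(\<Sum>i<m. - (y (Suc (Suc i)) / y (Suc i))) = - (\<Sum>j = 2..n - 1. y j / y (j - 1))"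
    unfolding sum_negf
    by (intro arg_cong[where f = uminus] sum.reindex_bij_witness[of _ "\<lambda>j. j - 2" "\<lambda>i. Suc (Suc i)"])
       (auto simp: m numeral_2_eq_2 Suc_diff_Suc)
  finally show ?thesis
    by (simp add: m)
qed

text \<open>The head \<open>z\<close> is arbitrary because the induction removes the top arrow,
  after which \<open>y (Suc m)\<close> heads the remaining chain.\<close>

lemma sum_vertical_arrows:
  fixes z :: "'a::field"
  assumes "m \<ge> 1"
  shows "sum_list (map arrow_value (map2 Vertical (z # map y (rev [1..<Suc m])) (map y (rev [1..<Suc m])))) =
     z / y m + (\<Sum>j = 2..m. y j / y (j - 1))"
  using assms
proof (induction m arbitrary: z rule: dec_induct)
  case (step m)
  have "rev [1..<Suc (Suc m)] = Suc m # rev [1..<Suc m]" by simp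
  then have "sum_list (map arrow_value (map2 Vertical (z # map y (rev [1..<Suc (Suc m)])) (map y (rev [1..<Suc (Suc m)])))) =
      z / y (Suc m) + sum_list (map arrow_value (map2 Vertical (y (Suc m) # map y (rev [1..<Suc m])) (map y (rev [1..<Suc m]))))"
    by (simp only: list.map zip_Cons_Cons sum_list.Cons prod.case arrow_value.simps)
  also have "\<dots> = z / y (Suc m) + (y (Suc m) / y m + (\<Sum>j = 2..m. y j / y (j - 1)))"
    by (simp only: step.IH)
  also have "\<dots> = z / y (Suc m) + (\<Sum>j = 2..Suc m. y j / y (j - 1))"
    using step.hyps by (subst sum.nat_ivl_Suc') (auto simp: add_ac)
  finally show ?case .
qed simp

theorem theorem2p2:
  fixes \<psi> :: "'a::{finite,field} \<Rightarrow> complex" and n :: nat and a\<^sub>1 :: 'a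
  assumes "odd CARD('a)"
    and "additive_character \<psi>" and "\<exists>x. \<psi> x \<noteq> 1"
    and "n \<ge> 2" and "a\<^sub>1 \<noteq> 0"
  shows
    "(\<forall>t\<in>diag_torus n.
        curtis_hom \<psi> n (hecke_elt \<psi> n (antidiag_block [(1, a\<^sub>1), (n - 1, 1)])) t =
          (if det t = (- 1) ^ (n - 1) * a\<^sub>1
           then 1 / of_nat CARD('a) ^ (n - 1) * \<psi> (- mat_trace t) else 0)) \<and>
     bij_betw (torus_param n a\<^sub>1) ({1..n - 1} \<rightarrow>\<^sub>E {x. x \<noteq> 0})
       {t \<in> diag_torus n. det t = (- 1) ^ (n - 1) * a\<^sub>1} \<and>
     (\<forall>y \<in> {1..n - 1} \<rightarrow>\<^sub>E {x. x \<noteq> 0}.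
        \<psi> (- mat_trace (torus_param n a\<^sub>1 y)) =
          \<psi> (- (y 1 / 1) + (\<Sum>j = 2..n - 1. y j / y (j - 1)) + a\<^sub>1 / y (n - 1)) \<and>
        - (y 1 / 1) + (\<Sum>j = 2..n - 1. y j / y (j - 1)) + a\<^sub>1 / y (n - 1) =
          sum_list (map arrow_value (gt_diagram n a\<^sub>1 y)))"
proof (intro conjI ballI)
  note \<psi> = assms(2,3) and n = assms(4) and a = assms(5)
  let ?D = "{t \<in> diag_torus n. det t = (- 1) ^ (n - 1) * a\<^sub>1}"
  let ?c = "hecke_elt \<psi> n (antidiag_block [(1, a\<^sub>1), (n - 1, 1)])"
  show bij: "bij_betw (torus_param n a\<^sub>1) ({1..n - 1} \<rightarrow>\<^sub>E {x. x \<noteq> 0}) ?D"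
    by (rule bij_betw_torus_param[OF n a])
  have c: "?c \<in> carrier (hecke_algebra \<psi> n)"
  proof -
    have "group_elt (shift_mat n a\<^sub>1) \<in> carrier (group_algebra (GL n))"
      using shift_mat_GL[OF a n] by (auto simp: group_algebra_def group_elt_def)
    then show ?thesis
      unfolding hecke_elt_def antidiag_block_shift[OF n]
      by (auto simp: hecke_algebra_def corner_algebra_def)
  qed
  have block: "[(1, a\<^sub>1), (n - 1, 1)] \<in> block_data n"
    using n a by (simp add: block_data_def)
  define d where "d t = (if det t = (- 1) ^ (n - 1) * a\<^sub>1
      then 1 / of_nat CARD('a) ^ (n - 1) * \<psi> (- mat_trace t) else 0)" for t
  fix t :: "'a mat" assume t: "t \<in> diag_torus n"
  have "curtis_hom \<psi> n ?c t = d t"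
  \<comment> \<open>The coefficient is not computed directly: it suffices that the claimed function
    \<open>d\<close> has the same sum as the Curtis image against every torus character.\<close>
  proof (rule chi_hat_inject[OF _ t])
    fix \<chi> :: "nat \<Rightarrow> 'a \<Rightarrow> complex"
    assume \<chi>: "\<And>i. i < n \<Longrightarrow> multiplicative_character (\<chi> i)"
    have "chi_hat n \<chi> (curtis_hom \<psi> n ?c) = f_T_chi \<psi> n \<chi> ?c"
      by (rule chi_hat_curtis_hom[OF \<psi> _ c]) (rule \<chi>)
    also have "\<dots> = bessel_function \<psi> n (pi_S \<psi> n \<chi>) (right_translation (GL n))
        (antidiag_block [(1, a\<^sub>1), (n - 1, 1)])"
      by (rule bspec[OF conjunct2[OF f_T_chi_props[OF \<psi>]] block]) (rule \<chi>)
    also have "\<dots> = (\<Sum>y\<in>{1..n - 1} \<rightarrow>\<^sub>E {x. x \<noteq> 0}.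
       \<psi> (- mat_trace (torus_param n a\<^sub>1 y)) * diag_char \<chi> n (torus_param n a\<^sub>1 y)) / of_nat CARD('a) ^ (n - 1)"
      unfolding antidiag_block_shift[OF n] by (rule bessel_function_shift[OF \<psi> _ n a]) (rule \<chi>)
    also have "\<dots> = (\<Sum>s\<in>?D. \<psi> (- mat_trace s) * diag_char \<chi> n s) / of_nat CARD('a) ^ (n - 1)"
      using sum.reindex_bij_betw[OF bij, of "\<lambda>s. \<psi> (- mat_trace s) * diag_char \<chi> n s"] by simp
    also have "\<dots> = (\<Sum>s\<in>?D. d s * diag_char \<chi> n s)"
      by (simp add: d_def sum_divide_distrib)
    \<comment> \<open>The sum extends from the determinant fibre to the whole torus because
      \<open>d\<close> is 0 off the fibre.\<close>
    also have "\<dots> = chi_hat n \<chi> d"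
      unfolding chi_hat_def using finite_diag_torus
      by (intro sum.mono_neutral_left) (auto simp: d_def)
    finally show "chi_hat n \<chi> (curtis_hom \<psi> n ?c) = chi_hat n \<chi> d" .
  qed
  then show "curtis_hom \<psi> n ?c t = (if det t = (- 1) ^ (n - 1) * a\<^sub>1
      then 1 / of_nat CARD('a) ^ (n - 1) * \<psi> (- mat_trace t) else 0)"
    by (simp add: d_def)
next
  note n = assms(4)
  fix y :: "nat \<Rightarrow> 'a"
  show "\<psi> (- mat_trace (torus_param n a\<^sub>1 y)) =
      \<psi> (- (y 1 / 1) + (\<Sum>j = 2..n - 1. y j / y (j - 1)) + a\<^sub>1 / y (n - 1))"
    by (simp only: torus_param_trace[OF n])
  obtain m where m: "n = Suc m" "m \<ge> 1" using n by (cases n) auto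
  show "- (y 1 / 1) + (\<Sum>j = 2..n - 1. y j / y (j - 1)) + a\<^sub>1 / y (n - 1) =
      sum_list (map arrow_value (gt_diagram n a\<^sub>1 y))"
    using sum_vertical_arrows[OF m(2), of a\<^sub>1 y] unfolding m(1) gt_diagram_def Let_def list.sel map_append sum_list_append
    by simp
qed

end
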